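(* Let $n\ge 3$, let $\alpha_3,\alpha_4,\ldots,\alpha_n$ be arbitrary nonpositive real numbers, and set $$\beta_3=-\alpha_3^2+\tfrac14,\qquad \beta_m=-\alpha_m^2+\left(\alpha_{m-1}-\tfrac12\right)^2,\quad m=4,\ldots,n.$$ Let $2<Q\le\frac{2n}{n-2}$, and consider the inequality $$( * )\qquad \int_{\mathbb{R}^n}|\nabla u|^2\,dx\ \ge\ \int_{\mathbb{R}^n}\left(\frac{\beta_3}{|\mathbf{X_3}|^2}+\ldots+\frac{\beta_n}{|\mathbf{X_n}|^2}\right)u^2\,dx+C\left(\int_{\mathbb{R}^n}|\mathbf{X_2}|^{\frac{Q-2}{2}n-Q}|u|^{Q}\,dx\right)^{\frac{2}{Q}}.$$ If $\alpha_n<0$, then there exists a constant $C>0$ such that $( * )$ holds for every $u\in C_0^\infty(\mathbb{R}^n)$. If $\alpha_n=0$, then there is no constant $C>0$ such that $( * )$ holds for every $u\in C_0^\infty(\mathbb{R}^n)$.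
   Context: For $x=(x_1,\ldots,x_n)\in\mathbb{R}^n$ and $1\le k\le n$, $\mathbf{X_k}:=(x_1,\ldots,x_k,0,\ldots,0)$, so $|\mathbf{X_k}|=(x_1^2+\ldots+x_k^2)^{1/2}$; in particular $|\mathbf{X_n}|=|x|$. Functions are real valued. When $n=3$ only $\alpha_3$ and $\beta_3$ occur. *)

theory Defs
  imports "HOL-Analysis.Analysis"
begin

text \<open>
  Smooth functions: \<open>C_diff k f\<close> says that \<open>f\<close> is of class \<open>C\<^sup>k\<close>
  (\<open>k\<close> times differentiable, all iterated directional derivatives being continuous).
\<close>

primrec C_diff :: "nat \<Rightarrow> ('a::real_normed_vector \<Rightarrow> real) \<Rightarrow> bool" where
  "C_diff 0 f \<longleftrightarrow> continuous_on UNIV f"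
| "C_diff (Suc k) f \<longleftrightarrow>
     (\<forall>x. f differentiable (at x)) \<and>
     (\<forall>v. C_diff k (\<lambda>x. frechet_derivative f (at x) v))"

definition C_infty_compact :: "('a::real_normed_vector \<Rightarrow> real) set" where
  "C_infty_compact = {u. (\<forall>k. C_diff k u) \<and> compact (closure (support_on UNIV u))}"

definition grad :: "(real ^ 'n::finite \<Rightarrow> real) \<Rightarrow> real ^ 'n \<Rightarrow> real ^ 'n" where
  "grad u x = (\<chi> i. frechet_derivative u (at x) (axis i 1))"

text \<open>
  The coordinates of \<open>x :: real ^ 'n\<close> are enumerated by a bijection \<open>e\<close> from \<open>{1..n}\<close>
  onto the index type, so that the coordinate \<open>x\<^sub>k\<close> is \<open>x $ e k\<close>. Then \<open>trunc e k x\<close> is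
  \<open>(x\<^sub>1, \<dots>, x\<^sub>k, 0, \<dots>, 0)\<close>.
\<close>

definition trunc :: "(nat \<Rightarrow> 'n::finite) \<Rightarrow> nat \<Rightarrow> real ^ 'n \<Rightarrow> real ^ 'n" where
  "trunc e k x = (\<chi> i. if i \<in> e ` {1..k} then x $ i else 0)"

definition beta :: "(nat \<Rightarrow> real) \<Rightarrow> nat \<Rightarrow> real" where
  "beta \<alpha> m =
     (if m = 3 then - (\<alpha> 3)\<^sup>2 + 1/4 else - (\<alpha> m)\<^sup>2 + (\<alpha> (m - 1) - 1/2)\<^sup>2)"

text \<open>
  For \<open>u\<close> in \<open>C_infty_compact\<close> and \<open>Q > 2\<close> all three integrands are integrable:
  \<open>\<bar>X\<^sub>k\<bar>\<^sup>-\<^sup>2\<close> is locally integrable for \<open>k \<ge> 3\<close>, and the exponent of \<open>\<bar>X\<^sub>2\<bar>\<close> exceeds \<open>-2\<close>.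
  Their values on the null sets \<open>{x. X\<^sub>k = 0}\<close>, where division by zero or \<open>0 powr _\<close>
  occurs, do not affect the integrals.
\<close>

definition hardy_sobolev_mazya ::
  "nat \<Rightarrow> (nat \<Rightarrow> 'n::finite) \<Rightarrow> (nat \<Rightarrow> real) \<Rightarrow> real \<Rightarrow> real \<Rightarrow> (real ^ 'n \<Rightarrow> real) \<Rightarrow> bool" where
  "hardy_sobolev_mazya n e \<alpha> Q C u \<longleftrightarrow>
     (\<integral>x. (norm (grad u x))\<^sup>2 \<partial>lborel) \<ge>
       (\<integral>x. (\<Sum>k=3..n. beta \<alpha> k / (norm (trunc e k x))\<^sup>2) * (u x)\<^sup>2 \<partial>lborel) +
       C * (\<integral>x. norm (trunc e 2 x) powr ((Q - 2) / 2 * real n - Q) * \<bar>u x\<bar> powr Q \<partial>lborel) powr (2 / Q)"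

end

theory Submission
  imports Defs
begin

text \<open>
  Put \<open>S\<^sub>2 = 0\<close>, \<open>S\<^sub>k = (k - 2)/2 + \<alpha>\<^sub>k\<close> and let \<open>\<Phi> = \<Prod> |X\<^sub>k| powr -(S\<^sub>k - S\<^sub>k\<^sub>-\<^sub>1)\<close>, the ground state of
  the quadratic form, which equals \<open>\<integral> |\<nabla>u - u \<nabla>\<Phi>/\<Phi>|\<^sup>2\<close>. All integrations by parts are done by
  differentiating the scaling in the first \<open>k\<close> coordinates.

  If \<open>\<alpha>\<^sub>n < 0\<close>, put \<open>s = Q/2 + 1\<close> and \<open>\<kappa> = 1 - (Q - 2)(n - 2)/4\<close>. The \<open>L\<^sup>1\<close> norm of
  \<open>|X\<^sub>2| powr -\<kappa> |u| powr (s - 1) |\<nabla>u - u \<nabla>\<Phi>/\<Phi>|\<close> controls \<open>f = |X\<^sub>2| powr -\<kappa> |u| powr s\<close> both in \<open>L\<^sup>1(dx/|X\<^sub>2|)\<close>, by a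
  Hardy inequality with the vector field \<open>\<Sum> c\<^sub>k X\<^sub>k/|X\<^sub>k|\<close> with rapidly increasing \<open>c\<^sub>k\<close>, and
  in \<open>L powr (n/(n - 1))\<close>, by the Gagliardo-Nirenberg inequality. Interpolation and Cauchy-Schwarz then close
  the estimate. The Hardy inequality needs \<open>\<kappa> + s S\<^sub>k < k - 1\<close> for all \<open>k\<close>, which is where
  \<open>\<alpha>\<^sub>n < 0\<close> enters.

  If \<open>\<alpha>\<^sub>n = 0\<close>, replace \<open>\<alpha>\<close> by \<open>\<alpha> - \<delta>\<close>, where \<open>\<delta>\<^sub>n = 1/L\<close> and \<open>\<delta>\<^sub>k\<close> grows so fast with \<open>k\<close> that
  the potential decreases. The new ground state, times a cutoff that is an average over \<open>L\<close> dyadic scales,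
  has energy \<open>O(1/L)\<close>, while its norm on the right-hand side stays bounded below.
\<close>

section \<open>The Gagliardo--Nirenberg inequality\<close>

text \<open>With u = \<Phi> v, the vector \<open>gs_grad S u g\<close> is \<Phi> \<nabla>v. The
  value of s is forced by Cauchy-Schwarz: |u|^(s-1) has to be the square root of |u|^Q. And -2
  \<kappa> is just the exponent of |X_2| in the theorem; with these two choices one interpolation
  parameter matches the powers of |u| and of |X_2| at once. If \<alpha>_n = 0, then \<Phi> is
  homogeneous of degree -(n - 2)/2, so (\<Phi>/|x|)^2 has degree -n and just fails to be integrable,
  at infinity and at the origin. At infinity the averaged cutoff helps; at the origin only a smaller
  exponent does, hence \<delta>_n > 0, and the size 1/L costs no more than a bounded factor over L
  dyadic scales. The same divergence occurs on X_k = 0 if \<alpha>_k = 0. Lowering \<alpha>_k raises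
  the coefficient \<beta>_(k+1), which the lowering of \<alpha>_(k+1) must outweigh. For arbitrary
  \<alpha>_k <= 0 the exponents S_k - S_(k-1) have no sign. Therefore \<Phi> is dominated by the
  perturbed ground state belonging to \<alpha> = 0, whose exponents lie in [0, 1/2).\<close>

lemma nn_integral_Hoelder_powr:
  fixes f g :: "'a \<Rightarrow> real"
  assumes [measurable]: "f \<in> borel_measurable M" "g \<in> borel_measurable M"
    and f0: "\<And>x. x \<in> space M \<Longrightarrow> 0 \<le> f x" and g0: "\<And>x. x \<in> space M \<Longrightarrow> 0 \<le> g x"
    and ab: "0 \<le> a" "0 \<le> b" "a + b = 1"
    and A: "A > 0" "(\<integral>\<^sup>+x. ennreal (f x) \<partial>M) \<le> ennreal A"
    and B: "B > 0" "(\<integral>\<^sup>+x. ennreal (g x) \<partial>M) \<le> ennreal B"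
  shows "(\<integral>\<^sup>+x. ennreal (f x powr a * g x powr b) \<partial>M) \<le> ennreal (A powr a * B powr b)"
proof -
  let ?c = "A powr a * B powr b"
  have pw: "f x powr a * g x powr b \<le> ?c * (a / A) * f x + ?c * (b / B) * g x" if "x \<in> space M" for x
  \<comment> \<open>Since 0 powr a = 0 even for a = 0, the left side vanishes here; the endpoints a
    = 0 and b = 0 are thereby covered.\<close>
  proof (cases "f x = 0 \<or> g x = 0")
    case True
    have "0 \<le> ?c * (a / A) * f x + ?c * (b / B) * g x"
      using ab A B f0[OF that] g0[OF that] by auto
    then show ?thesis using True by auto
  next
    case False
    then have pos: "f x / A > 0" "g x / B > 0"
      using f0[OF that] g0[OF that] A B by auto
    have "f x powr a * g x powr b = ?c * ((f x / A) powr a * (g x / B) powr b)"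
      using A B f0[OF that] g0[OF that] by (simp add: powr_divide)
    also have "\<dots> \<le> ?c * (a * (f x / A) + b * (g x / B))"
      using Youngs_inequality_0[OF ab pos] by (intro mult_left_mono) auto
    also have "\<dots> = ?c * (a / A) * f x + ?c * (b / B) * g x" by (simp add: algebra_simps)
    finally show ?thesis .
  qed
  have "(\<integral>\<^sup>+x. ennreal (f x powr a * g x powr b) \<partial>M)
     \<le> (\<integral>\<^sup>+x. ennreal (?c * (a / A)) * ennreal (f x) + ennreal (?c * (b / B)) * ennreal (g x) \<partial>M)"
    using ab A B f0 g0 pw
    by (intro nn_integral_mono) (simp flip: ennreal_mult ennreal_plus)
  also have "\<dots> = ennreal (?c * (a / A)) * (\<integral>\<^sup>+x. ennreal (f x) \<partial>M)
                  + ennreal (?c * (b / B)) * (\<integral>\<^sup>+x. ennreal (g x) \<partial>M)"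
    by (simp add: nn_integral_add nn_integral_cmult)
  also have "\<dots> \<le> ennreal (?c * (a / A)) * ennreal A + ennreal (?c * (b / B)) * ennreal B"
    by (intro add_mono mult_left_mono A B) auto
  also have "\<dots> = ennreal (?c * (a / A) * A + ?c * (b / B) * B)"
    using ab A B by (simp flip: ennreal_mult ennreal_plus)
  also have "?c * (a / A) * A + ?c * (b / B) * B = ?c * (a + b)"
    using A B by (simp add: field_simps)
  finally show ?thesis using ab by simp
qed

text \<open>Induction on the number m of variables. On the slice x_i = t, Hoelder splits the
  exponent p = 1/m + 1: the L^1 norm is at most K by integrating the hypothesis for i, and the
  L^(m/(m-1)) norm is at most \<open>kk t\<close> by the induction hypothesis, where
  \<open>kk\<close> again has integral at most K. The hypothesis speaks of line integrals of
  \<open>g i\<close> and not of derivatives, so it passes to slices.\<close>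

lemma Gagliardo_Nirenberg_PiM:
  fixes f :: "('i \<Rightarrow> real) \<Rightarrow> real" and g :: "'i \<Rightarrow> ('i \<Rightarrow> real) \<Rightarrow> ennreal"
  assumes "finite I" "card I \<ge> 2"
    and "f \<in> borel_measurable (Pi\<^sub>M I (\<lambda>_. lborel))"
    and "\<And>x. x \<in> space (Pi\<^sub>M I (\<lambda>_. lborel)) \<Longrightarrow> 0 \<le> f x"
    and "\<And>i. i \<in> I \<Longrightarrow> g i \<in> borel_measurable (Pi\<^sub>M I (\<lambda>_. lborel))"
    and "\<And>i x. i \<in> I \<Longrightarrow> x \<in> space (Pi\<^sub>M I (\<lambda>_. lborel)) \<Longrightarrow>
           ennreal (f x) \<le> (\<integral>\<^sup>+t. g i (x(i := t)) \<partial>lborel)"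
    and "K > 0" "(\<Sum>i\<in>I. \<integral>\<^sup>+x. g i x \<partial>Pi\<^sub>M I (\<lambda>_. lborel)) \<le> ennreal K"
  shows "(\<integral>\<^sup>+x. ennreal (f x powr (card I / (real (card I) - 1))) \<partial>Pi\<^sub>M I (\<lambda>_. lborel))
           \<le> ennreal (K powr (card I / (real (card I) - 1)))"
  using assms
proof (induction I arbitrary: f g K rule: finite_induct)
  case empty
  then show ?case by simp
next
  case (insert i I)
  interpret product_sigma_finite "\<lambda>_::'i. lborel :: real measure" ..
  let ?P = "Pi\<^sub>M I (\<lambda>_. lborel) :: ('i \<Rightarrow> real) measure"
  let ?PI = "Pi\<^sub>M (insert i I) (\<lambda>_. lborel) :: ('i \<Rightarrow> real) measure"
  define m where "m = real (card I)"
  have m1: "m \<ge> 1" using insert.prems(1) insert.hyps by (simp add: m_def)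
  have cI: "real (card (insert i I)) = m + 1" using insert.hyps by (simp add: m_def)
  define p where "p = (m + 1) / m"
  note [measurable] = insert.prems(2) insert.prems(4)
  have sp: "y(i := t) \<in> space ?PI" if "y \<in> space ?P" for y t
    using that by (auto simp: space_PiM PiE_def extensional_def)
  have f0: "0 \<le> f (y(i := t))" if "y \<in> space ?P" for y t
    using insert.prems(3)[OF sp[OF that]] .
  have [measurable]: "(\<lambda>y. f (y(i := t))) \<in> borel_measurable ?P" for t
    by measurable
  have [measurable]: "(\<lambda>y. g j (y(i := t))) \<in> borel_measurable ?P" if "j \<in> insert i I" for t j
    using insert.prems(4)[OF that] by measurable
  have gm2: "(\<lambda>z. g j ((snd z)(i := fst z))) \<in> borel_measurable (lborel \<Otimes>\<^sub>M ?P)" if "j \<in> insert i I" for j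
    using insert.prems(4)[OF that] by measurable
  interpret P: sigma_finite_measure ?P
    using insert.hyps by (intro sigma_finite) auto
  have km[measurable]: "(\<lambda>t. \<integral>\<^sup>+y. g j (y(i := t)) \<partial>?P) \<in> borel_measurable lborel" if "j \<in> insert i I" for j
    using P.borel_measurable_nn_integral_fst[OF gm2[OF that]] by simp
  define kk where "kk t = (\<Sum>j\<in>I. \<integral>\<^sup>+y. g j (y(i := t)) \<partial>?P)" for t
  have K0: "K > 0" by fact
  have le_sum: "(\<integral>\<^sup>+x. g i x \<partial>?PI) + (\<Sum>j\<in>I. \<integral>\<^sup>+x. g j x \<partial>?PI) \<le> ennreal K"
    using insert.prems(7) insert.hyps by simp
  have f1: "(\<integral>\<^sup>+y. ennreal (f (y(i := t))) \<partial>?P) \<le> ennreal K" for t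
  proof -
    have "(\<integral>\<^sup>+y. ennreal (f (y(i := t))) \<partial>?P) \<le> (\<integral>\<^sup>+y. \<integral>\<^sup>+s. g i (y(i := s)) \<partial>lborel \<partial>?P)"
    proof (intro nn_integral_mono)
      fix y assume y: "y \<in> space ?P"
      show "ennreal (f (y(i := t))) \<le> (\<integral>\<^sup>+s. g i (y(i := s)) \<partial>lborel)"
        using insert.prems(5)[OF insertI1 sp[OF y], of t] by (simp only: fun_upd_upd)
    qed
    also have "\<dots> = (\<integral>\<^sup>+x. g i x \<partial>?PI)"
      using insert.hyps by (subst product_nn_integral_insert) auto
    also have "\<dots> \<le> ennreal K"
      by (rule order_trans[OF _ le_sum]) simp
    finally show ?thesis .
  qed
  have slice: "(\<integral>\<^sup>+y. ennreal (f (y(i := t)) powr p) \<partial>?P) \<le> ennreal (K powr (1 / m)) * kk t" for t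
  proof (cases "kk t = top")
    case True
    then show ?thesis using K0 by (simp add: ennreal_mult_top)
  next
    case False
    then obtain k where k: "kk t = ennreal k" "k \<ge> 0" by (cases "kk t") auto
    have hyp: "ennreal (f (y(i := t))) \<le> (\<integral>\<^sup>+s. g j ((y(j := s))(i := t)) \<partial>lborel)"
      if "j \<in> I" "y \<in> space ?P" for j y
    proof -
      have "i \<noteq> j" using that insert.hyps by auto
      then show ?thesis
        using insert.prems(5)[OF _ sp[OF that(2)], of j t] that(1) by (simp only: fun_upd_twist[OF \<open>i \<noteq> j\<close>] insertI2)
    qed
    \<comment> \<open>The induction hypothesis asks for a positive bound, while \<open>k\<close> may
      be 0; the excess of \<open>k'\<close> over \<open>k\<close> is sent to 0 afterwards.\<close>
    have main: "(\<integral>\<^sup>+y. ennreal (f (y(i := t)) powr p) \<partial>?P) \<le> ennreal (K powr (1 / m) * k')" if "k' > k" for k'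
    \<comment> \<open>The recursion starts here: for m = 1 the exponent m/(m - 1) degenerates, and
      the sup bound f <= k takes its place.\<close>
    proof (cases "card I = 1")
      case True
      then obtain j where j: "I = {j}" by (auto simp: card_1_singleton_iff)
      have m: "m = 1" "p = 2" using True by (auto simp: m_def p_def)
      have kkj: "kk t = (\<integral>\<^sup>+s. g j ((y(j := s))(i := t)) \<partial>lborel)" if "y \<in> space ?P" for y
      proof -
        have eq: "(\<lambda>x\<in>{}. undefined)(j := s) = y(j := s)" for s
          using that unfolding j by (auto simp: space_PiM PiE_def extensional_def fun_eq_iff)
        have "kk t = (\<integral>\<^sup>+x. g j (x(i := t)) \<partial>Pi\<^sub>M (insert j {}) (\<lambda>_. lborel))"
          by (simp add: kk_def j)
        also have "\<dots> = (\<integral>\<^sup>+x. \<integral>\<^sup>+s. g j ((x(j := s))(i := t)) \<partial>lborel \<partial>Pi\<^sub>M {} (\<lambda>_. lborel))"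
          using \<open>\<And>t' j'. j' \<in> insert i I \<Longrightarrow> (\<lambda>y. g j' (y(i := t'))) \<in> borel_measurable ?P\<close>[of j t]
          by (intro product_nn_integral_insert) (auto simp: j)
        also have "\<dots> = (\<integral>\<^sup>+s. g j ((y(j := s))(i := t)) \<partial>lborel)"
          using eq by (simp add: PiM_empty nn_integral_count_space_finite restrict_def)
        finally show ?thesis .
      qed
      have b: "f (y(i := t)) \<le> k" if "y \<in> space ?P" for y
      proof -
        have "ennreal (f (y(i := t))) \<le> kk t"
          unfolding kkj[OF that] by (rule hyp) (use that j in auto)
        then show ?thesis using k by simp
      qed
      have "(\<integral>\<^sup>+y. ennreal (f (y(i := t)) powr p) \<partial>?P) \<le> (\<integral>\<^sup>+y. ennreal k' * ennreal (f (y(i := t))) \<partial>?P)"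
      proof (intro nn_integral_mono)
        fix y assume y: "y \<in> space ?P"
        have "f (y(i := t)) * f (y(i := t)) \<le> k' * f (y(i := t))"
          using b[OF y] that f0[OF y] by (intro mult_right_mono) auto
        then have "f (y(i := t)) powr p \<le> k' * f (y(i := t))"
          using f0[OF y, of t] by (simp add: m power2_eq_square)
        then show "ennreal (f (y(i := t)) powr p) \<le> ennreal k' * ennreal (f (y(i := t)))"
          using that k f0[OF y, of t] by (simp flip: ennreal_mult)
      qed
      also have "\<dots> = ennreal k' * (\<integral>\<^sup>+y. ennreal (f (y(i := t))) \<partial>?P)"
        by (simp add: nn_integral_cmult)
      also have "\<dots> \<le> ennreal k' * ennreal K"
        by (intro mult_left_mono f1) auto
      also have "\<dots> = ennreal (K powr (1 / m) * k')"
        using K0 that k by (simp add: m mult.commute flip: ennreal_mult)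
      finally show ?thesis .
    next
      case False
      then have c2: "card I \<ge> 2" using m1 by (simp add: m_def)
      then have m2: "m \<ge> 2" by (simp add: m_def)
      have k'0: "k' > 0" using that k by simp
      have IH: "(\<integral>\<^sup>+y. ennreal (f (y(i := t)) powr (m / (m - 1))) \<partial>?P) \<le> ennreal (k' powr (m / (m - 1)))"
      proof -
        have "(\<integral>\<^sup>+y. ennreal (f (y(i := t)) powr (real (card I) / (real (card I) - 1))) \<partial>?P)
            \<le> ennreal (k' powr (real (card I) / (real (card I) - 1)))"
        proof (rule insert.IH[where g = "\<lambda>j y. g j (y(i := t))" and f = "\<lambda>y. f (y(i := t))"])
          show "card I \<ge> 2" "k' > 0" by fact+
          show "(\<lambda>y. f (y(i := t))) \<in> borel_measurable ?P" by measurable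
          show "\<And>j. j \<in> I \<Longrightarrow> (\<lambda>y. g j (y(i := t))) \<in> borel_measurable ?P" by measurable
          show "\<And>y. y \<in> space ?P \<Longrightarrow> 0 \<le> f (y(i := t))" by (rule f0)
          show "\<And>j y. j \<in> I \<Longrightarrow> y \<in> space ?P \<Longrightarrow>
            ennreal (f (y(i := t))) \<le> (\<integral>\<^sup>+s. g j ((y(j := s))(i := t)) \<partial>lborel)" by (rule hyp)
          show "(\<Sum>j\<in>I. \<integral>\<^sup>+y. g j (y(i := t)) \<partial>?P) \<le> ennreal k'"
            using k that unfolding kk_def by (simp add: ennreal_leI)
        qed
        then show ?thesis by (simp add: m_def)
      qed
      have "(\<integral>\<^sup>+y. ennreal (f (y(i := t)) powr p) \<partial>?P) =
            (\<integral>\<^sup>+y. ennreal (f (y(i := t)) powr (1 / m) * (f (y(i := t)) powr (m / (m - 1))) powr ((m - 1) / m)) \<partial>?P)"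
      proof (intro nn_integral_cong)
        fix y assume y: "y \<in> space ?P"
        have "p = 1 / m + m / (m - 1) * ((m - 1) / m)"
          using m2 by (simp add: p_def field_simps)
        then have "f (y(i := t)) powr p = f (y(i := t)) powr (1 / m) * (f (y(i := t)) powr (m / (m - 1))) powr ((m - 1) / m)"
          by (simp only: powr_powr powr_add)
        then show "ennreal (f (y(i := t)) powr p) = ennreal (f (y(i := t)) powr (1 / m) * (f (y(i := t)) powr (m / (m - 1))) powr ((m - 1) / m))"
          by simp
      qed
      also have "\<dots> \<le> ennreal (K powr (1 / m) * (k' powr (m / (m - 1))) powr ((m - 1) / m))"
        using m2 K0 k'0 IH f0 f1 by (intro nn_integral_Hoelder_powr) (auto simp: field_simps)
      also have "(k' powr (m / (m - 1))) powr ((m - 1) / m) = k'"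
        using m2 k'0 by (simp add: powr_powr)
      finally show ?thesis .
    qed
    have "(\<integral>\<^sup>+y. ennreal (f (y(i := t)) powr p) \<partial>?P) \<le> ennreal (K powr (1 / m) * k)"
    proof (rule ennreal_le_epsilon)
      fix e :: real assume e: "e > 0"
      define k' where "k' = k + e / K powr (1/m)"
      have kp: "K powr (1/m) > 0" using K0 by simp
      have "k' > k" using e kp by (simp add: k'_def)
      from main[OF this] have "(\<integral>\<^sup>+y. ennreal (f (y(i := t)) powr p) \<partial>?P) \<le> ennreal (K powr (1 / m) * k')" .
      also have "K powr (1 / m) * k' = K powr (1 / m) * k + e"
        using kp by (simp add: k'_def field_simps)
      also have "ennreal \<dots> = ennreal (K powr (1 / m) * k) + ennreal e"
        using e k kp by (simp flip: ennreal_plus)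
      finally show "(\<integral>\<^sup>+y. ennreal (f (y(i := t)) powr p) \<partial>?P) \<le> ennreal (K powr (1 / m) * k) + ennreal e" .
    qed
    then show ?thesis using k by (simp add: ennreal_mult)
  qed
  have "(\<integral>\<^sup>+x. ennreal (f x powr p) \<partial>?PI) = (\<integral>\<^sup>+t. \<integral>\<^sup>+y. ennreal (f (y(i := t)) powr p) \<partial>?P \<partial>lborel)"
    using insert.hyps by (subst product_nn_integral_insert_rev) auto
  also have "\<dots> \<le> (\<integral>\<^sup>+t. ennreal (K powr (1 / m)) * kk t \<partial>lborel)"
    by (intro nn_integral_mono slice)
  also have "\<dots> = ennreal (K powr (1 / m)) * (\<Sum>j\<in>I. \<integral>\<^sup>+t. \<integral>\<^sup>+y. g j (y(i := t)) \<partial>?P \<partial>lborel)"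
  proof -
    have "(\<integral>\<^sup>+t. ennreal (K powr (1 / m)) * kk t \<partial>lborel) = ennreal (K powr (1 / m)) * (\<integral>\<^sup>+t. kk t \<partial>lborel)"
      unfolding kk_def by (intro nn_integral_cmult) (auto intro!: borel_measurable_sum km)
    also have "(\<integral>\<^sup>+t. kk t \<partial>lborel) = (\<Sum>j\<in>I. \<integral>\<^sup>+t. \<integral>\<^sup>+y. g j (y(i := t)) \<partial>?P \<partial>lborel)"
      unfolding kk_def by (intro nn_integral_sum) (auto intro!: km)
    finally show ?thesis .
  qed
  also have "(\<Sum>j\<in>I. \<integral>\<^sup>+t. \<integral>\<^sup>+y. g j (y(i := t)) \<partial>?P \<partial>lborel) = (\<Sum>j\<in>I. \<integral>\<^sup>+x. g j x \<partial>?PI)"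
    using insert.hyps insert.prems(4) by (intro sum.cong refl product_nn_integral_insert_rev[symmetric]) auto
  also have "ennreal (K powr (1 / m)) * \<dots> \<le> ennreal (K powr (1 / m)) * ennreal K"
    by (intro mult_left_mono order_trans[OF _ le_sum]) auto
  also have "\<dots> = ennreal (K powr p)"
    using K0 m1 by (simp add: p_def add_divide_distrib powr_add ennreal_mult mult.commute)
  finally show ?case
    unfolding cI p_def by simp
qed

text \<open>Only C^1 is asked, because |u|^s with s > 1 need not be smooth at the zeros of u. The
  gradient is an argument, so that powers and regularized products carry explicit formulas for
  it.\<close>

definition C1c :: "('a::euclidean_space \<Rightarrow> real) \<Rightarrow> ('a \<Rightarrow> 'a) \<Rightarrow> bool" where
  "C1c u g \<longleftrightarrow> (\<forall>x. (u has_derivative (\<lambda>v. g x \<bullet> v)) (at x)) \<and> continuous_on UNIV g \<and>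
     (\<exists>R. \<forall>x. norm x > R \<longrightarrow> u x = 0 \<and> g x = 0)"

lemma C1cD:
  assumes "C1c u g"
  shows "(u has_derivative (\<lambda>v. g x \<bullet> v)) (at x)" "continuous_on UNIV g" "continuous_on UNIV u"
    "u \<in> borel_measurable borel" "g \<in> borel_measurable borel"
proof -
  show d: "(u has_derivative (\<lambda>v. g x \<bullet> v)) (at x)" for x using assms by (simp add: C1c_def)
  show c: "continuous_on UNIV g" using assms by (simp add: C1c_def)
  show cu: "continuous_on UNIV u"
    using has_derivative_continuous[OF d] by (simp add: continuous_on_eq_continuous_at)
  show "u \<in> borel_measurable borel" "g \<in> borel_measurable borel"
    using c cu by (auto intro: borel_measurable_continuous_onI)
qed

lemma C1c_bound:
  assumes "C1c u g"
  obtains R M where "R > 0" "M > 0" "\<And>x. norm x > R \<Longrightarrow> u x = 0" "\<And>x. norm x > R \<Longrightarrow> g x = 0"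
    "\<And>x. \<bar>u x\<bar> \<le> M" "\<And>x. norm (g x) \<le> M"
proof -
  obtain R0 where R0: "\<And>x. norm x > R0 \<Longrightarrow> u x = 0" "\<And>x. norm x > R0 \<Longrightarrow> g x = 0"
    using assms by (auto simp: C1c_def)
  define R where "R = \<bar>R0\<bar> + 1"
  have R: "R > 0" "\<And>x. norm x > R \<Longrightarrow> u x = 0" "\<And>x. norm x > R \<Longrightarrow> g x = 0"
    using R0 by (auto simp: R_def)
  have "compact (u ` cball 0 R)" "compact (g ` cball 0 R)"
    by (auto intro!: compact_continuous_image continuous_on_subset[OF C1cD(3)[OF assms]]
        continuous_on_subset[OF C1cD(2)[OF assms]])
  then obtain M1 M2 where M: "\<And>x. x \<in> cball 0 R \<Longrightarrow> norm (u x) \<le> M1" "\<And>x. x \<in> cball 0 R \<Longrightarrow> norm (g x) \<le> M2"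
    unfolding compact_eq_bounded_closed bounded_iff by (metis image_eqI)
  have "\<bar>u x\<bar> \<le> \<bar>M1\<bar> + \<bar>M2\<bar> + 1" "norm (g x) \<le> \<bar>M1\<bar> + \<bar>M2\<bar> + 1" for x
    using M[of x] R(2,3)[of x] by (cases "norm x > R"; force)+
  then show ?thesis using R by (intro that[of R "\<bar>M1\<bar> + \<bar>M2\<bar> + 1"]) (auto intro: add_nonneg_pos)
qed

lemma C1c_line_bound:
  fixes u :: "'a::euclidean_space \<Rightarrow> real"
  assumes "C1c u g" and b: "b \<in> Basis"
  shows "ennreal \<bar>u x\<bar> \<le> (\<integral>\<^sup>+t. ennreal \<bar>g (x + (t - x \<bullet> b) *\<^sub>R b) \<bullet> b\<bar> \<partial>lborel)"
proof -
  obtain R M where R: "R > 0" "\<And>x. norm x > R \<Longrightarrow> u x = 0" using C1c_bound[OF assms(1)] by metis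
  define p where "p t = x + (t - x \<bullet> b) *\<^sub>R b" for t
  have nb: "norm b = 1" "b \<bullet> b = 1" using b by (auto simp: norm_Basis inner_same_Basis)
  have pt: "p t \<bullet> b = t" for t using nb by (simp add: p_def inner_add_left)
  \<comment> \<open>The point \<open>p a\<close> has b-coordinate a, and |a| > R puts it outside the
    support, so integration along the line starts from the value 0.\<close>
  define a where "a = - (\<bar>x \<bullet> b\<bar> + R + 1)"
  have ale: "a \<le> x \<bullet> b" using R by (auto simp: a_def)
  have "norm (p a) \<ge> \<bar>a\<bar>" using Cauchy_Schwarz_ineq2[of "p a" b] pt[of a] nb by simp
  then have pa: "u (p a) = 0" using R by (auto simp: a_def)
  have der: "DERIV (\<lambda>t. u (p t)) t :> g (p t) \<bullet> b" for t
  proof -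
    have "(p has_derivative (\<lambda>s. s *\<^sub>R b)) (at t)"
      unfolding p_def by (auto intro!: derivative_eq_intros)
    from has_derivative_compose[OF this C1cD(1)[OF assms(1)]]
    show ?thesis unfolding has_field_derivative_def by (rule has_derivative_eq_rhs) (auto simp: mult.commute)
  qed
  have cp: "continuous_on UNIV p" unfolding p_def by (intro continuous_intros)
  have cont: "isCont (\<lambda>t. g (p t) \<bullet> b) t" for t
    using continuous_on_inner[OF continuous_on_compose2[OF C1cD(2)[OF assms(1)] cp] continuous_on_const]
    by (simp add: continuous_on_eq_continuous_at)
  have hb: "has_bochner_integral lborel (\<lambda>t. g (p t) \<bullet> b * indicator {a..x \<bullet> b} t) (u (p (x \<bullet> b)) - u (p a))"
    by (rule has_bochner_integral_FTC_Icc_real[OF ale der cont])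
  have "ennreal (norm (u (p (x \<bullet> b)) - u (p a))) \<le> (\<integral>\<^sup>+t. norm (g (p t) \<bullet> b * indicator {a..x \<bullet> b} t) \<partial>lborel)"
    using integral_norm_bound_ennreal[of lborel "\<lambda>t. g (p t) \<bullet> b * indicator {a..x \<bullet> b} t"] hb
    by (simp add: has_bochner_integral_iff)
  also have "\<dots> \<le> (\<integral>\<^sup>+t. ennreal \<bar>g (p t) \<bullet> b\<bar> \<partial>lborel)"
    by (intro nn_integral_mono) (auto split: split_indicator)
  finally show ?thesis using pa by (simp add: p_def)
qed

text \<open>Each partial derivative is bounded by the full gradient, and there are
  \<open>DIM('a)\<close> of them; this gives the (not sharp) factor in front of K.\<close>

proposition Gagliardo_Nirenberg_L1:
  fixes u :: "'a::euclidean_space \<Rightarrow> real" and K :: real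
  assumes u: "C1c u g" and dim: "DIM('a) \<ge> 2"
    and K: "K > 0" "(\<integral>\<^sup>+x. ennreal (norm (g x)) \<partial>lborel) \<le> ennreal K"
  shows "(\<integral>\<^sup>+x. ennreal (\<bar>u x\<bar> powr (DIM('a) / (real DIM('a) - 1))) \<partial>lborel)
           \<le> ennreal ((DIM('a) * K) powr (DIM('a) / (real DIM('a) - 1)))"
proof -
  let ?P = "Pi\<^sub>M Basis (\<lambda>_. lborel) :: ('a \<Rightarrow> real) measure"
  define T :: "('a \<Rightarrow> real) \<Rightarrow> 'a" where "T y = (\<Sum>b\<in>Basis. y b *\<^sub>R b)" for y
  have lb: "(lborel :: 'a measure) = distr ?P borel T" by (subst lborel_eq) (simp add: T_def[abs_def])
  have Tm[measurable]: "T \<in> ?P \<rightarrow>\<^sub>M borel" unfolding T_def by measurable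
  note [measurable] = C1cD(4,5)[OF u]
  have Tb: "T y \<bullet> b = y b" if "b \<in> Basis" for y b
    using that by (simp add: T_def inner_sum_left_Basis)
  have Tupd: "T (y(b := t)) = T y + (t - T y \<bullet> b) *\<^sub>R b" if "b \<in> Basis" for y b t
  proof (rule euclidean_eqI)
    fix c :: 'a assume c: "c \<in> Basis"
    show "T (y(b := t)) \<bullet> c = (T y + (t - T y \<bullet> b) *\<^sub>R b) \<bullet> c"
      unfolding inner_add_left inner_scaleR_left Tb[OF c] Tb[OF that] inner_Basis[OF that c] by simp
  qed
  have D0: "real DIM('a) * K > 0" using K by simp
  have "(\<integral>\<^sup>+y. ennreal (\<bar>u (T y)\<bar> powr (card (Basis::'a set) / (real (card (Basis::'a set)) - 1))) \<partial>?P)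
           \<le> ennreal ((DIM('a) * K) powr (card (Basis::'a set) / (real (card (Basis::'a set)) - 1)))"
  proof (rule Gagliardo_Nirenberg_PiM[where g = "\<lambda>b y. ennreal \<bar>g (T y) \<bullet> b\<bar>"])
    show "(\<lambda>x. \<bar>u (T x)\<bar>) \<in> borel_measurable ?P" by measurable
    show "(\<lambda>x. ennreal \<bar>g (T x) \<bullet> b\<bar>) \<in> borel_measurable ?P" for b by measurable
    show "ennreal \<bar>u (T x)\<bar> \<le> (\<integral>\<^sup>+t. ennreal \<bar>g (T (x(b := t))) \<bullet> b\<bar> \<partial>lborel)" if "b \<in> Basis" for b x
      using C1c_line_bound[OF u that, of "T x"] by (simp only: Tupd[OF that])
    have "(\<Sum>b\<in>Basis. \<integral>\<^sup>+x. ennreal \<bar>g (T x) \<bullet> b\<bar> \<partial>?P) = (\<Sum>b\<in>Basis. \<integral>\<^sup>+x. ennreal \<bar>g x \<bullet> b\<bar> \<partial>lborel)"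
      unfolding lb by (intro sum.cong refl nn_integral_distr[symmetric]) auto
    also have "\<dots> \<le> (\<Sum>b\<in>(Basis::'a set). ennreal K)"
    proof (intro sum_mono)
      fix b :: 'a assume "b \<in> Basis"
      then have "(\<integral>\<^sup>+x. ennreal \<bar>g x \<bullet> b\<bar> \<partial>lborel) \<le> (\<integral>\<^sup>+x. ennreal (norm (g x)) \<partial>lborel)"
        by (intro nn_integral_mono ennreal_leI) (simp add: Basis_le_norm)
      then show "(\<integral>\<^sup>+x. ennreal \<bar>g x \<bullet> b\<bar> \<partial>lborel) \<le> ennreal K" using K by (rule_tac order_trans)
    qed
    also have "\<dots> = ennreal (DIM('a) * K)" using K by (simp add: ennreal_mult ennreal_of_nat_eq_real_of_nat)
    finally show "(\<Sum>b\<in>Basis. \<integral>\<^sup>+x. ennreal \<bar>g (T x) \<bullet> b\<bar> \<partial>?P) \<le> ennreal (DIM('a) * K)" .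
  qed (use dim D0 in auto)
  also have "(\<integral>\<^sup>+y. ennreal (\<bar>u (T y)\<bar> powr (card (Basis::'a set) / (real (card (Basis::'a set)) - 1))) \<partial>?P) =
    (\<integral>\<^sup>+x. ennreal (\<bar>u x\<bar> powr (DIM('a) / (real DIM('a) - 1))) \<partial>lborel)"
    unfolding lb by (subst nn_integral_distr) auto
  finally show ?thesis .
qed

section \<open>Singular weights and dilations\<close>

lemma nn_integral_powr_Icc_finite:
  fixes a R :: real
  assumes "a < 1"
  shows "(\<integral>\<^sup>+t. ennreal (indicator {-R..R} t * \<bar>t\<bar> powr (-a)) \<partial>lborel) < \<infinity>"
proof (cases "R > 0")
  case False
  then have "(\<integral>\<^sup>+t. ennreal (indicator {-R..R} t * \<bar>t\<bar> powr (-a)) \<partial>lborel) = (\<integral>\<^sup>+t. 0 \<partial>(lborel :: real measure))"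
    by (intro nn_integral_cong) (auto split: split_indicator)
  then show ?thesis by simp
next
  case True
  let ?I = "\<integral>\<^sup>+t. ennreal (indicator {0..R} t * t powr (-a)) \<partial>lborel"
  have "((\<lambda>t. t powr (-a)) has_integral (R powr (-a+1) / (-a+1))) {0..R}"
    using assms True by (intro has_integral_powr_from_0) auto
  then have "((\<lambda>t. if t \<in> {0..R} then t powr (-a) else 0) has_integral (R powr (-a+1) / (-a+1))) UNIV"
    by (simp only: has_integral_restrict_UNIV)
  also have "(\<lambda>t. if t \<in> {0..R} then t powr (-a) else 0) = (\<lambda>t. indicator {0..R} t * t powr (-a))"
    by (auto simp: fun_eq_iff)
  finally have "((\<lambda>t. indicator {0..R} t * t powr (-a)) has_integral (R powr (-a+1) / (-a+1))) UNIV" .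
  then have I: "?I = ennreal (R powr (-a+1) / (-a+1))"
    by (intro nn_integral_has_integral_lborel) auto
  have neg: "(\<integral>\<^sup>+t. ennreal (indicator {0..R} (-t) * (-t) powr (-a)) \<partial>lborel) = ?I"
    using nn_integral_real_affine[of "\<lambda>t. ennreal (indicator {0..R} t * t powr (-a))" "-1" 0] by simp
  have "(\<integral>\<^sup>+t. ennreal (indicator {-R..R} t * \<bar>t\<bar> powr (-a)) \<partial>lborel)
     \<le> (\<integral>\<^sup>+t. ennreal (indicator {0..R} t * t powr (-a)) + ennreal (indicator {0..R} (-t) * (-t) powr (-a)) \<partial>lborel)"
    by (intro nn_integral_mono) (auto simp: abs_if split: split_indicator)
  also have "\<dots> = ?I + ?I" unfolding neg[symmetric] by (subst nn_integral_add) (auto simp: neg)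
  also have "\<dots> < \<infinity>" unfolding I by (simp add: less_top flip: ennreal_plus)
  finally show ?thesis .
qed

text \<open>The ball lies in a cube, over which the integral factors by Tonelli. All singular
  weights below are compared with such products, so polar coordinates never occur.\<close>

lemma integrable_prod_powr:
  fixes a :: "'a::euclidean_space \<Rightarrow> real"
  assumes "\<And>b. b \<in> Basis \<Longrightarrow> a b < 1"
  shows "integrable lborel (\<lambda>x::'a. indicator (cball 0 R) x * (\<Prod>b\<in>Basis. \<bar>x \<bullet> b\<bar> powr (- a b)))"
proof (rule integrableI_bounded)
  show "(\<lambda>x::'a. indicator (cball 0 R) x * (\<Prod>b\<in>Basis. \<bar>x \<bullet> b\<bar> powr (- a b))) \<in> borel_measurable lborel"
    by (intro borel_measurable_times borel_measurable_indicator borel_measurable_prod) auto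
  have "(\<integral>\<^sup>+x. ennreal (norm (indicator (cball 0 R) x * (\<Prod>b\<in>Basis. \<bar>x \<bullet> b\<bar> powr (- a b)))) \<partial>lborel)
    \<le> (\<integral>\<^sup>+x. (\<Prod>b\<in>Basis. ennreal (indicator {-R..R} (x \<bullet> b) * \<bar>x \<bullet> b\<bar> powr (- a b))) \<partial>lborel)"
  proof (intro nn_integral_mono)
    fix x :: 'a
    have "x \<bullet> b \<in> {-R..R}" if "norm x \<le> R" "b \<in> Basis" for b
      using Basis_le_norm[OF that(2), of x] that by auto
    then show "ennreal (norm (indicator (cball 0 R) x * (\<Prod>b\<in>Basis. \<bar>x \<bullet> b\<bar> powr (- a b))))
      \<le> (\<Prod>b\<in>Basis. ennreal (indicator {-R..R} (x \<bullet> b) * \<bar>x \<bullet> b\<bar> powr (- a b)))"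
      by (auto simp: prod_ennreal abs_prod prod_nonneg split: split_indicator intro!: ennreal_leI prod_mono)
  qed
  also have "\<dots> = (\<Prod>b\<in>(Basis::'a set). \<integral>\<^sup>+t. ennreal (indicator {-R..R} t * \<bar>t\<bar> powr (- a b)) \<partial>lborel)"
    by (intro nn_integral_lborel_prod) auto
  also have "\<dots> < \<infinity>"
    using nn_integral_powr_Icc_finite assms by (auto simp: ennreal_prod_eq_top less_top[symmetric])
  finally show "(\<integral>\<^sup>+x. ennreal (norm (indicator (cball 0 R) x * (\<Prod>b\<in>Basis. \<bar>x \<bullet> b\<bar> powr (- a b)))) \<partial>lborel) < \<infinity>" .
qed

text \<open>Outside this null set every |X_k| is positive, so the pointwise estimates may divide by
  it.\<close>

lemma AE_lborel_coordinates_nonzero: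
  "AE x::'a::euclidean_space in lborel. \<forall>b\<in>Basis. x \<bullet> b \<noteq> 0"
proof -
  have "AE x::'a in lborel. x \<bullet> b \<noteq> 0" if "b \<in> Basis" for b
  proof -
    have "{x::'a. x \<bullet> b = 0} \<in> sets borel" by measurable
    moreover have "{x::'a. x \<bullet> b = 0} \<in> null_sets lebesgue"
      using negligible_standard_hyperplane[OF that, of 0] by (simp add: negligible_iff_null_sets)
    ultimately have "{x::'a. x \<bullet> b = 0} \<in> null_sets lborel"
      by (simp add: null_sets_completion_iff)
    then show ?thesis by (rule AE_I') auto
  qed
  then show ?thesis by (subst AE_ball_countable) (auto intro: countable_finite)
qed

lemma lborel_integral_diagonal:
  fixes f :: "'a::euclidean_space \<Rightarrow> real" and c :: "'a \<Rightarrow> real"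
  assumes [measurable]: "f \<in> borel_measurable borel" and c: "\<And>j. j \<in> Basis \<Longrightarrow> c j \<noteq> 0"
  shows "(LBINT x. f x) = (\<Prod>j\<in>Basis. \<bar>c j\<bar>) * (LBINT x. f (\<Sum>j\<in>Basis. (c j * (x \<bullet> j)) *\<^sub>R j))"
proof -
  let ?T = "\<lambda>x::'a. 0 + (\<Sum>j\<in>Basis. (c j * (x \<bullet> j)) *\<^sub>R j)"
  have "(LBINT x. f x) = (\<integral>x. f x \<partial>density (distr lborel borel ?T) (\<lambda>_. (\<Prod>j\<in>Basis. \<bar>c j\<bar>)))"
    using lborel_affine_euclidean[of c 0] c by simp
  also have "\<dots> = (\<integral>x. (\<Prod>j\<in>Basis. \<bar>c j\<bar>) * f x \<partial>distr lborel borel ?T)"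
    by (subst integral_density) (auto simp: prod_nonneg)
  also have "\<dots> = (LBINT x. (\<Prod>j\<in>Basis. \<bar>c j\<bar>) * f (?T x))"
    by (subst integral_distr) auto
  also have "\<dots> = (\<Prod>j\<in>Basis. \<bar>c j\<bar>) * (LBINT x. f (?T x))"
    by (rule Bochner_Integration.integral_mult_right_zero)
  finally show ?thesis by (simp only: add_0)
qed

text \<open>
  Differentiating \<open>\<integral> h (D\<^sub>\<lambda> x) W x dx = \<lambda>\<^sup>d\<^sup>-\<^sup>|\<^sup>S\<^sup>| \<integral> h W\<close> at \<open>\<lambda> = 1\<close>, where \<open>D\<^sub>\<lambda>\<close> dilates the coordinates
  in \<open>S\<close>: no regularization of the singular weight \<open>W\<close> is needed.
\<close>

lemma Euler_dilation_identity:
  fixes h :: "'a::euclidean_space \<Rightarrow> real" and W :: "'a \<Rightarrow> real"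
  assumes h: "C1c h g" and S: "S \<subseteq> Basis"
    and [measurable]: "W \<in> borel_measurable borel"
    and Wint: "\<And>R. integrable lborel (\<lambda>x. indicator (cball 0 R) x * W x)"
    and hom: "\<And>l x. l > 0 \<Longrightarrow> W (x + (l - 1) *\<^sub>R (\<Sum>j\<in>S. (x \<bullet> j) *\<^sub>R j)) = l powr (- d) * W x"
  shows "integrable lborel (\<lambda>x. h x * W x)"
    and "integrable lborel (\<lambda>x. ((\<Sum>j\<in>S. (x \<bullet> j) *\<^sub>R j) \<bullet> g x) * W x)"
    and "(LBINT x. ((\<Sum>j\<in>S. (x \<bullet> j) *\<^sub>R j) \<bullet> g x) * W x) = (d - card S) * (LBINT x. h x * W x)"
proof -
  define P where "P x = (\<Sum>j\<in>S. (x \<bullet> j) *\<^sub>R j)" for x :: 'a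
  obtain R M where R: "R > 0" "M > 0" "\<And>x. norm x > R \<Longrightarrow> h x = 0" "\<And>x. norm x > R \<Longrightarrow> g x = 0"
    "\<And>x. \<bar>h x\<bar> \<le> M" "\<And>x. norm (g x) \<le> M" using C1c_bound[OF h] by metis
  note [measurable] = C1cD(4,5)[OF h]
  have [measurable]: "P \<in> borel_measurable borel" unfolding P_def by measurable
  have fS: "finite S" using S finite_Basis finite_subset by blast
  have Pb: "P x \<bullet> b = (if b \<in> S then x \<bullet> b else 0)" if "b \<in> Basis" for x b
  proof -
    have "P x \<bullet> b = (\<Sum>j\<in>S. if j = b then x \<bullet> b else 0)"
      unfolding P_def inner_sum_left using S that by (intro sum.cong) (auto simp: inner_Basis subset_iff)
    then show ?thesis using fS by simp
  qed
  have PP: "P x \<bullet> x = (norm (P x))\<^sup>2" for x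
    unfolding power2_norm_eq_inner by (subst (1 2) euclidean_inner, intro sum.cong) (auto simp: Pb)
  have normP: "norm (P x) \<le> norm x" for x
  proof -
    have "(norm (P x))\<^sup>2 \<le> norm (P x) * norm x" using PP Cauchy_Schwarz_ineq2[of "P x" x] by simp
    then show ?thesis by (cases "P x = 0") (auto simp: power2_eq_square)
  qed
  define D where "D l x = x + (l - 1) *\<^sub>R P x" for l and x :: 'a
  have normD: "norm (D l x) \<ge> norm x" if "l \<ge> 1" for l x
  proof -
    have "(norm (D l x))\<^sup>2 = (norm x)\<^sup>2 + 2 * (l - 1) * (P x \<bullet> x) + (l-1)\<^sup>2 * (norm (P x))\<^sup>2"
      unfolding D_def power2_norm_eq_inner
      by (simp add: inner_add_left inner_add_right inner_commute power2_eq_square algebra_simps)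
    also have "\<dots> \<ge> (norm x)\<^sup>2" using that by (simp add: PP)
    finally show ?thesis using power2_le_imp_le norm_ge_zero by blast
  qed
  let ?dom = "\<lambda>x. M * (R + 1) * \<bar>indicator (cball 0 R) x * W x\<bar>"
  have domint: "integrable lborel ?dom" by (rule integrable_mult_right, rule integrable_abs, rule Wint)
  have MR: "M \<le> M * (R + 1)" using R(1,2) by simp
  show hW: "integrable lborel (\<lambda>x. h x * W x)"
  proof (rule Bochner_Integration.integrable_bound[OF domint])
    show "AE x in lborel. norm (h x * W x) \<le> norm (?dom x)"
    proof (rule AE_I2)
      fix x
      have "\<bar>h x\<bar> \<le> M * (R+1) * indicator (cball 0 R) x"
        using R(3,5)[of x] MR by (auto split: split_indicator)
      then have "\<bar>h x\<bar> * \<bar>W x\<bar> \<le> M * (R+1) * indicator (cball 0 R) x * \<bar>W x\<bar>"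
        by (intro mult_right_mono) auto
      then show "norm (h x * W x) \<le> norm (?dom x)" using R(1,2) by (simp add: abs_mult mult.assoc)
    qed
  qed measurable
  have lip: "\<bar>h y - h x\<bar> \<le> M * norm (y - x)" for x y
  proof -
    have "norm (h y - h x) \<le> M * norm (y - x)"
    proof (rule differentiable_bound[of UNIV])
      show "onorm (\<lambda>v. g x \<bullet> v) \<le> M" for x
        using R(6)[of x] by (intro onorm_le) (metis Cauchy_Schwarz_ineq2 real_norm_def mult_right_mono norm_ge_zero order_trans)
    qed (use C1cD(1)[OF h] in auto)
    then show ?thesis by simp
  qed
  define l where "l i = 1 + 1 / real (Suc i)" for i
  have l1: "l i > 1" for i by (simp add: l_def)
  have llim: "l \<longlonglongrightarrow> 1"
    unfolding l_def using tendsto_add[OF tendsto_const[of 1] LIMSEQ_inverse_real_of_nat] by (simp add: inverse_eq_divide)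
  have llim': "filterlim l (at 1) sequentially"
    using llim l1 by (auto simp: filterlim_at intro!: always_eventually) (metis less_irrefl)
  define s where "s i x = (h (D (l i) x) - h x) / (l i - 1) * W x" for i x
  have [measurable]: "D c \<in> borel_measurable borel" for c unfolding D_def by measurable
  have sm: "s i \<in> borel_measurable lborel" for i unfolding s_def by measurable
  have lim: "(\<lambda>i. s i x) \<longlonglongrightarrow> (P x \<bullet> g x) * W x" for x
  proof -
    have "((\<lambda>c. D c x) has_derivative (\<lambda>t. t *\<^sub>R P x)) (at 1)"
      unfolding D_def by (auto intro!: derivative_eq_intros)
    from has_derivative_compose[OF this C1cD(1)[OF h]]
    have "((\<lambda>c. h (D c x)) has_derivative (\<lambda>t. g (D 1 x) \<bullet> (t *\<^sub>R P x))) (at 1)" .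
    moreover have "D 1 x = x" by (simp add: D_def)
    ultimately have "((\<lambda>c. h (D c x)) has_derivative (\<lambda>t. g x \<bullet> (t *\<^sub>R P x))) (at 1)" by simp
    then have "DERIV (\<lambda>c. h (D c x)) 1 :> g x \<bullet> P x"
      unfolding has_field_derivative_def by (rule has_derivative_eq_rhs) (auto simp: mult.commute)
    then have "((\<lambda>c. (h (D c x) - h (D 1 x)) / (c - 1)) \<longlongrightarrow> g x \<bullet> P x) (at 1)"
      by (simp add: has_field_derivative_iff)
    from filterlim_compose[OF this llim'] show ?thesis
      unfolding s_def by (intro tendsto_mult) (auto simp: inner_commute D_def)
  qed
  have bnd: "norm (s i x) \<le> ?dom x" for i x
  proof (cases "norm x \<le> R")
    case False
    then have "h x = 0" "h (D (l i) x) = 0" using R(3) normD[of "l i" x] l1[of i] by auto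
    then show ?thesis using R(1,2) by (simp add: s_def)
  next
    case True
    have "\<bar>h (D (l i) x) - h x\<bar> \<le> M * ((l i - 1) * norm (P x))"
      using lip[of "D (l i) x" x] l1[of i] by (simp add: D_def)
    then have "\<bar>h (D (l i) x) - h x\<bar> / (l i - 1) \<le> M * norm (P x)"
      using l1[of i] by (simp add: divide_le_eq mult_ac)
    also have "\<dots> \<le> M * (R + 1)" using R(2) normP[of x] True by (intro mult_left_mono) auto
    finally have "\<bar>h (D (l i) x) - h x\<bar> / (l i - 1) * \<bar>W x\<bar> \<le> M * (R + 1) * \<bar>W x\<bar>"
      by (rule mult_right_mono) auto
    then show ?thesis using True l1[of i] by (simp add: s_def abs_mult abs_divide)
  qed
  have fm: "(\<lambda>x. (P x \<bullet> g x) * W x) \<in> borel_measurable lborel" by measurable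
  show int2: "integrable lborel (\<lambda>x. ((\<Sum>j\<in>S. (x \<bullet> j) *\<^sub>R j) \<bullet> g x) * W x)"
    unfolding P_def[symmetric]
    by (rule integrable_dominated_convergence[OF fm sm domint AE_I2 AE_I2]) (rule lim bnd)+
  have conv: "(\<lambda>i. \<integral>x. s i x \<partial>lborel) \<longlonglongrightarrow> (LBINT x. (P x \<bullet> g x) * W x)"
    by (rule integral_dominated_convergence[OF fm sm domint AE_I2 AE_I2]) (rule lim bnd)+
  define J where "J = (LBINT x. h x * W x)"
  \<comment> \<open>Change of variables and homogeneity turn the integral of h (D_l x) W x into l
    powr (d - card S) times J, so this is a difference quotient of t powr (d - card S) at t =
    1.\<close>
  have val: "(LBINT x. s i x) = ((l i) powr (d - card S) - 1) / (l i - 1) * J" for i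
  proof -
    define c where "c j = (if j \<in> S then l i else 1)" for j :: 'a
    have li: "l i > 0" using l1[of i] by simp
    have Dc: "(\<Sum>j\<in>Basis. (c j * (x \<bullet> j)) *\<^sub>R j) = D (l i) x" for x
    proof (rule euclidean_eqI)
      fix b :: 'a assume "b \<in> Basis"
      then show "(\<Sum>j\<in>Basis. (c j * (x \<bullet> j)) *\<^sub>R j) \<bullet> b = D (l i) x \<bullet> b"
        by (simp add: inner_sum_left_Basis D_def inner_add_left Pb c_def left_diff_distrib)
    qed
    have "(\<Prod>j\<in>Basis. \<bar>c j\<bar>) = (\<Prod>j\<in>S. \<bar>c j\<bar>) * (\<Prod>j\<in>Basis - S. \<bar>c j\<bar>)"
      using S by (metis finite_Basis prod.subset_diff mult.commute)
    also have "\<dots> = l i powr card S" using li by (simp add: c_def powr_realpow)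
    finally have pc: "(\<Prod>j\<in>Basis. \<bar>c j\<bar>) = l i powr card S" .
    have "J = l i powr card S * (LBINT x. h (D (l i) x) * W (D (l i) x))"
    proof -
      have "J = (\<Prod>j\<in>Basis. \<bar>c j\<bar>) * (LBINT x. h (\<Sum>j\<in>Basis. (c j * (x \<bullet> j)) *\<^sub>R j) * W (\<Sum>j\<in>Basis. (c j * (x \<bullet> j)) *\<^sub>R j))"
        unfolding J_def using li by (intro lborel_integral_diagonal) (auto simp: c_def)
      then show ?thesis unfolding Dc pc .
    qed
    also have "(\<lambda>x. h (D (l i) x) * W (D (l i) x)) = (\<lambda>x. l i powr (-d) * (h (D (l i) x) * W x))"
      using hom[OF li] by (auto simp: D_def P_def)
    also have "l i powr card S * (LBINT x. l i powr (-d) * (h (D (l i) x) * W x))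
      = l i powr (card S - d) * (LBINT x. h (D (l i) x) * W x)"
      by (simp add: powr_diff powr_minus divide_inverse)
    finally have "l i powr (d - card S) * J = l i powr (d - card S) * l i powr (card S - d) * (LBINT x. h (D (l i) x) * W x)"
      by simp
    also have "l i powr (d - card S) * l i powr (card S - d) = 1"
      using li by (simp flip: powr_add)
    finally have eq: "(LBINT x. h (D (l i) x) * W x) = l i powr (d - card S) * J" by simp
    have i1: "integrable lborel (\<lambda>x. h (D (l i) x) * W x)"
    proof (rule Bochner_Integration.integrable_bound[OF domint])
      show "AE x in lborel. norm (h (D (l i) x) * W x) \<le> norm (?dom x)"
      proof (rule AE_I2)
        fix x
        have "\<bar>h (D (l i) x)\<bar> \<le> M * (R+1) * indicator (cball 0 R) x"
        proof (cases "norm x \<le> R")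
          case True
          then show ?thesis using R(5)[of "D (l i) x"] MR by simp
        next
          case False
          then show ?thesis using R(3)[of "D (l i) x"] normD[of "l i" x] l1[of i] R(1,2) by auto
        qed
        then have "\<bar>h (D (l i) x)\<bar> * \<bar>W x\<bar> \<le> M * (R+1) * indicator (cball 0 R) x * \<bar>W x\<bar>"
          by (intro mult_right_mono) auto
        then show "norm (h (D (l i) x) * W x) \<le> norm (?dom x)" using R(1,2) by (simp add: abs_mult mult.assoc)
      qed
    qed measurable
    have "(LBINT x. s i x) = (LBINT x. (h (D (l i) x) * W x - h x * W x) / (l i - 1))"
      unfolding s_def by (intro Bochner_Integration.integral_cong) (auto simp: algebra_simps diff_divide_distrib)
    also have "\<dots> = (l i powr (d - card S) * J - J) / (l i - 1)"
      using i1 hW by (simp add: eq J_def)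
    finally show ?thesis by (simp add: algebra_simps diff_divide_distrib)
  qed
  have "DERIV (\<lambda>t. t powr (d - card S)) 1 :> (d - card S)"
    by (auto intro!: derivative_eq_intros)
  then have "((\<lambda>t. (t powr (d - card S) - 1) / (t - 1)) \<longlongrightarrow> (d - card S)) (at 1)"
    by (simp add: has_field_derivative_iff)
  from tendsto_mult[OF filterlim_compose[OF this llim'] tendsto_const[of J]]
  have "(\<lambda>i. \<integral>x. s i x \<partial>lborel) \<longlonglongrightarrow> (d - card S) * J" unfolding val .
  from LIMSEQ_unique[OF conv this]
  show "(LBINT x. ((\<Sum>j\<in>S. (x \<bullet> j) *\<^sub>R j) \<bullet> g x) * W x) = (d - card S) * (LBINT x. h x * W x)"
    unfolding P_def J_def .
qed

section \<open>Truncated coordinates and the ground state\<close>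

lemma Bochner_integral_sum_cmult:
  fixes f :: "'b \<Rightarrow> 'a \<Rightarrow> real"
  assumes "\<And>k. k \<in> A \<Longrightarrow> integrable M (f k)"
  shows "(\<integral>x. (\<Sum>k\<in>A. c k * f k x) \<partial>M) = (\<Sum>k\<in>A. c k * (\<integral>x. f k x \<partial>M))"
proof -
  have "(\<integral>x. (\<Sum>k\<in>A. c k * f k x) \<partial>M) = (\<Sum>k\<in>A. (\<integral>x. c k * f k x \<partial>M))"
    by (intro Bochner_Integration.integral_sum integrable_mult_right assms)
  then show ?thesis by simp
qed

locale enumerated_coordinates =
  fixes n :: nat and e :: "nat \<Rightarrow> 'n::finite"
  assumes n3: "n \<ge> 3" and bij: "bij_betw e {1..n} (UNIV :: 'n set)"
begin

abbreviation r :: "nat \<Rightarrow> real ^ 'n \<Rightarrow> real" where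
  "r k x \<equiv> norm (trunc e k x)"

lemma bij_Basis: "bij_betw (\<lambda>k. axis (e k) 1 :: real ^ 'n) {1..n} Basis"
proof -
  have "bij_betw (\<lambda>i. axis i 1 :: real ^ 'n) UNIV Basis"
    by (auto simp: bij_betw_def inj_on_def axis_eq_axis Basis_vec_def)
  from bij_betw_trans[OF bij this] show ?thesis by (simp add: comp_def)
qed

lemma DIM_eq: "DIM(real ^ 'n) = n"
proof -
  have "card {1..n} = n" by simp
  then show ?thesis using bij_betw_same_card[OF bij_Basis] by (simp only:)
qed

lemma inj_e: "i \<in> {1..n} \<Longrightarrow> j \<in> {1..n} \<Longrightarrow> e i = e j \<longleftrightarrow> i = j"
  using inj_on_eq_iff[OF bij_betw_imp_inj_on[OF bij]] by blast

lemma e_surj: obtains j where "j \<in> {1..n}" "i = e j"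
  using bij_betw_imp_surj_on[OF bij] by (metis UNIV_I imageE)

lemma sum_coordinates: "(\<Sum>i\<in>UNIV. f i) = (\<Sum>j=1..n. f (e j))"
  using sum.reindex_bij_betw[OF bij, of f] by simp

lemma trunc_nth: "j \<in> {1..n} \<Longrightarrow> k \<le> n \<Longrightarrow> trunc e k x $ e j = (if j \<le> k then x $ e j else 0)"
proof -
  assume j: "j \<in> {1..n}" and k: "k \<le> n"
  have "e j \<in> e ` {1..k} \<longleftrightarrow> j \<le> k"
    using j k inj_e[of j] by (force simp: image_iff)
  then show ?thesis by (simp add: trunc_def)
qed

lemma trunc_add: "trunc e k (x + y) = trunc e k x + trunc e k y"
  and trunc_scaleR: "trunc e k (c *\<^sub>R x) = c *\<^sub>R trunc e k x"
  by (auto simp: trunc_def vec_eq_iff)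

lemma bounded_linear_trunc: "bounded_linear (trunc e k)"
  by (intro linear_conv_bounded_linear[THEN iffD1] linearI) (auto simp: trunc_add trunc_scaleR)

lemma measurable_trunc[measurable]: "trunc e k \<in> borel_measurable borel"
  using linear_continuous_on[OF bounded_linear_trunc] by (rule borel_measurable_continuous_onI)

lemma measurable_r[measurable]: "(\<lambda>x. r k x) \<in> borel_measurable borel"
  by measurable

lemma inner_trunc: "k \<le> n \<Longrightarrow> trunc e k x \<bullet> y = (\<Sum>j=1..k. x $ e j * y $ e j)"
proof -
  assume k: "k \<le> n"
  have "trunc e k x \<bullet> y = (\<Sum>j=1..n. trunc e k x $ e j * y $ e j)"
    by (simp add: inner_vec_def sum_coordinates)
  also have "\<dots> = (\<Sum>j=1..n. if j \<le> k then x $ e j * y $ e j else 0)"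
    using k by (intro sum.cong) (auto simp: trunc_nth)
  also have "\<dots> = (\<Sum>j=1..k. x $ e j * y $ e j)"
    using k by (intro sum.mono_neutral_cong_right) auto
  finally show ?thesis .
qed

lemma trunc_trunc: "j \<le> n \<Longrightarrow> k \<le> n \<Longrightarrow> trunc e j (trunc e k x) = trunc e (min j k) x"
proof (rule vec_eq_iff[THEN iffD2], rule)
  fix i assume "j \<le> n" "k \<le> n"
  obtain m where "m \<in> {1..n}" "i = e m" by (rule e_surj)
  then show "trunc e j (trunc e k x) $ i = trunc e (min j k) x $ i"
    using \<open>j \<le> n\<close> \<open>k \<le> n\<close> by (auto simp: trunc_nth)
qed

lemma r_sq: "k \<le> n \<Longrightarrow> (r k x)\<^sup>2 = (\<Sum>j=1..k. (x $ e j)\<^sup>2)"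
  by (simp add: power2_norm_eq_inner inner_trunc) (auto intro!: sum.cong simp: trunc_nth power2_eq_square)

lemma inner_trunc_trunc:
  assumes "j \<le> n" "k \<le> n"
  shows "trunc e j x \<bullet> trunc e k x = (r (min j k) x)\<^sup>2"
proof -
  have "trunc e j x \<bullet> trunc e k x = (\<Sum>i=1..j. if i \<le> k then (x $ e i)\<^sup>2 else 0)"
    using assms by (auto simp: inner_trunc trunc_nth power2_eq_square intro!: sum.cong)
  also have "\<dots> = (\<Sum>i=1..min j k. (x $ e i)\<^sup>2)"
    by (intro sum.mono_neutral_cong_right) auto
  finally show ?thesis using assms by (simp add: r_sq)
qed

lemma r_mono: "j \<le> k \<Longrightarrow> k \<le> n \<Longrightarrow> r j x \<le> r k x"
  by (rule power2_le_imp_le) (auto simp: r_sq intro!: sum_mono2)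

lemma abs_nth_le_r: "j \<in> {1..k} \<Longrightarrow> k \<le> n \<Longrightarrow> \<bar>x $ e j\<bar> \<le> r k x"
proof (rule power2_le_imp_le)
  assume "j \<in> {1..k}" "k \<le> n"
  then have "(\<Sum>i\<in>{j}. (x $ e i)\<^sup>2) \<le> (\<Sum>i=1..k. (x $ e i)\<^sup>2)" by (intro sum_mono2) auto
  then show "\<bar>x $ e j\<bar>\<^sup>2 \<le> (r k x)\<^sup>2" using \<open>k \<le> n\<close> by (simp add: r_sq)
qed simp

lemma r_n: "r n x = norm x"
proof -
  have "trunc e n x $ i = x $ i" for i
  proof -
    obtain j where "j \<in> {1..n}" "i = e j" by (rule e_surj)
    then show ?thesis by (simp add: trunc_nth)
  qed
  then have "trunc e n x = x" by (simp add: vec_eq_iff)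
  then show ?thesis by simp
qed

lemma r_le_norm: "k \<le> n \<Longrightarrow> r k x \<le> norm x"
  using r_mono[of k n x] by (simp add: r_n)

lemma r_pos: "\<forall>i. x $ i \<noteq> 0 \<Longrightarrow> k \<in> {1..n} \<Longrightarrow> r k x > 0"
  using abs_nth_le_r[of 1 k x] by (smt (verit) atLeastAtMost_iff order_refl)

lemma AE_nonzero: "AE x in (lborel :: (real ^ 'n) measure). \<forall>i. x $ i \<noteq> 0"
  using AE_lborel_coordinates_nonzero[where 'a = "real ^ 'n"]
  by (rule AE_mp) (auto simp: Basis_vec_def inner_axis intro!: AE_I2)

lemma sum_Basis_trunc: "k \<le> n \<Longrightarrow> (\<Sum>b\<in>(\<lambda>j. axis (e j) 1) ` {1..k}. (x \<bullet> b) *\<^sub>R b) = trunc e k x"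
proof (rule vec_eq_iff[THEN iffD2], rule)
  fix i assume k: "k \<le> n"
  obtain m where m: "m \<in> {1..n}" "i = e m" by (rule e_surj)
  have inj: "inj_on (\<lambda>j. axis (e j) 1 :: real ^ 'n) {1..k}"
    using bij_Basis k by (auto simp: bij_betw_def intro: inj_on_subset)
  have ax: "axis (e j) (1::real) $ e m = (if e m = e j then 1 else 0)" for j by (simp add: axis_def)
  have "(\<Sum>b\<in>(\<lambda>j. axis (e j) 1) ` {1..k}. (x \<bullet> b) *\<^sub>R b) $ i = (\<Sum>j=1..k. x $ e j * (if e m = e j then 1 else 0))"
    unfolding sum.reindex[OF inj] by (simp add: inner_axis ax m)
  also have "\<dots> = (\<Sum>j=1..k. if j = m then x $ e m else 0)"
    using m k by (intro sum.cong refl) (simp add: inj_e)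
  also have "\<dots> = trunc e k x $ i" using m k by (simp add: trunc_nth)
  finally show "(\<Sum>b\<in>(\<lambda>j. axis (e j) 1) ` {1..k}. (x \<bullet> b) *\<^sub>R b) $ i = trunc e k x $ i" .
qed

lemma r_dilate:
  assumes "j \<le> k" "k \<le> n" "l > 0"
  shows "r j (x + (l - 1) *\<^sub>R trunc e k x) = l * r j x"
proof -
  have "trunc e j (x + (l - 1) *\<^sub>R trunc e k x) = l *\<^sub>R trunc e j x"
  proof -
    have "trunc e j (x + (l - 1) *\<^sub>R trunc e k x) = trunc e j x + (l - 1) *\<^sub>R trunc e j (trunc e k x)"
      by (simp only: trunc_add trunc_scaleR)
    also have "trunc e j (trunc e k x) = trunc e j x" using assms by (simp add: trunc_trunc)
    finally show ?thesis by (simp add: scaleR_left_diff_distrib)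
  qed
  then show ?thesis using assms by simp
qed

lemma Euler_identity:
  fixes h :: "real ^ 'n \<Rightarrow> real"
  assumes h: "C1c h g" and k: "k \<le> n"
    and W: "W \<in> borel_measurable borel" "\<And>R. integrable lborel (\<lambda>x. indicator (cball 0 R) x * W x)"
    and hom: "\<And>l x. l > 0 \<Longrightarrow> W (x + (l - 1) *\<^sub>R trunc e k x) = l powr (- d) * W x"
  shows "integrable lborel (\<lambda>x. h x * W x)"
    and "integrable lborel (\<lambda>x. (trunc e k x \<bullet> g x) * W x)"
    and "(LBINT x. (trunc e k x \<bullet> g x) * W x) = (d - k) * (LBINT x. h x * W x)"
proof -
  let ?S = "(\<lambda>j. axis (e j) 1 :: real ^ 'n) ` {1..k}"
  have S: "?S \<subseteq> Basis" by (auto simp: Basis_vec_def)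
  have "card ?S = k"
    using bij_Basis k by (subst card_image) (auto simp: bij_betw_def intro: inj_on_subset)
  note * = Euler_dilation_identity[OF h S W, of d, unfolded sum_Basis_trunc[OF k] this, OF hom]
  show "integrable lborel (\<lambda>x. h x * W x)"
    and "integrable lborel (\<lambda>x. (trunc e k x \<bullet> g x) * W x)"
    and "(LBINT x. (trunc e k x \<bullet> g x) * W x) = (d - k) * (LBINT x. h x * W x)"
    by (rule *; assumption)+
qed

section \<open>Local integrability of the singular weights\<close>

definition cwt :: "(nat \<Rightarrow> real) \<Rightarrow> real ^ 'n \<Rightarrow> real" where
  "cwt a x = (\<Prod>k=1..n. \<bar>x $ e k\<bar> powr (- a k))"

lemma measurable_cwt[measurable]: "cwt a \<in> borel_measurable borel"
  unfolding cwt_def by measurable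

lemma integrable_cwt:
  assumes "\<And>k. k \<in> {1..n} \<Longrightarrow> a k < 1"
  shows "integrable lborel (\<lambda>x. indicator (cball 0 R) x * cwt a x)"
proof -
  define b where "b v = a (inv_into {1..n} (\<lambda>k. axis (e k) 1 :: real ^ 'n) v)" for v
  have bk: "b (axis (e k) 1) = a k" if "k \<in> {1..n}" for k
    using that bij_Basis unfolding b_def by (subst inv_into_f_f) (auto simp: bij_betw_def)
  have eq: "(\<Prod>v\<in>Basis. \<bar>x \<bullet> v\<bar> powr (- b v)) = cwt a x" for x
  proof -
    have "(\<Prod>v\<in>Basis. \<bar>x \<bullet> v\<bar> powr (- b v)) = (\<Prod>k=1..n. \<bar>x \<bullet> axis (e k) 1\<bar> powr (- b (axis (e k) 1)))"
      by (rule prod.reindex_bij_betw[OF bij_Basis, symmetric])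
    also have "\<dots> = cwt a x"
      unfolding cwt_def by (intro prod.cong refl) (simp add: bk inner_axis)
    finally show ?thesis .
  qed
  have "b v < 1" if "v \<in> Basis" for v
  proof -
    from that obtain k where "k \<in> {1..n}" "v = axis (e k) 1"
      unfolding bij_betw_imp_surj_on[OF bij_Basis, symmetric] by blast
    then show ?thesis using assms bk by simp
  qed
  then show ?thesis using integrable_prod_powr[of b R] by (simp add: eq)
qed

text \<open>Since |x_k| <= |X_j| for k <= j, a negative power of |X_j| is at most a product of
  negative powers of coordinates. The exponent can be shared out among them so that each share stays
  below 1.\<close>

lemma integrable_cwt_bound:
  fixes W :: "real ^ 'n \<Rightarrow> real"
  assumes a: "\<And>k. k \<in> {1..n} \<Longrightarrow> a k < 1" and W: "W \<in> borel_measurable borel"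
    and le: "\<And>x. \<forall>i. x $ i \<noteq> 0 \<Longrightarrow> norm x \<le> R \<Longrightarrow> \<bar>W x\<bar> \<le> C * cwt a x"
  shows "integrable lborel (\<lambda>x. indicator (cball 0 R) x * W x)"
proof (rule Bochner_Integration.integrable_bound)
  show "integrable lborel (\<lambda>x. C * (indicator (cball 0 R) x * cwt a x))"
    by (intro integrable_mult_right integrable_cwt a)
  show "(\<lambda>x. indicator (cball 0 R) x * W x) \<in> borel_measurable lborel"
    using W by (intro borel_measurable_times borel_measurable_indicator) auto
  show "AE x in lborel. norm (indicator (cball 0 R) x * W x) \<le> norm (C * (indicator (cball 0 R) x * cwt a x))"
    using AE_nonzero
  proof eventually_elim
    case (elim x)
    then show ?case using le[of x] by (auto split: split_indicator)
  qed
qed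

lemma integrable_r2:
  assumes "a < 2" "a \<ge> 0"
  shows "integrable lborel (\<lambda>x. indicator (cball 0 R) x * r 2 x powr (- a))"
proof (rule integrable_cwt_bound[where a = "\<lambda>k. if k \<le> 2 then a / 2 else 0" and C = 1])
  fix x :: "real ^ 'n" assume x: "\<forall>i. x $ i \<noteq> 0"
  have r: "r 2 x > 0" using r_pos[OF x, of 2] n3 by simp
  \<comment> \<open>The first two coordinates share the exponent equally, and a / 2 < 1.\<close>
  have "cwt (\<lambda>k. if k \<le> 2 then a / 2 else 0) x = (\<Prod>k=1..n. if k \<le> 2 then \<bar>x $ e k\<bar> powr (- (a / 2)) else 1)"
    unfolding cwt_def using x by (intro prod.cong) auto
  also have "\<dots> = (\<Prod>k\<in>{1,2}. \<bar>x $ e k\<bar> powr (- (a / 2)))"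
    using n3 by (intro prod.mono_neutral_cong_right) auto
  also have "\<dots> = \<bar>x $ e 1\<bar> powr (- (a / 2)) * \<bar>x $ e 2\<bar> powr (- (a / 2))" by simp
  also have "\<dots> \<ge> r 2 x powr (- (a/2)) * r 2 x powr (- (a/2))"
    using x n3 assms abs_nth_le_r[of 1 2 x] abs_nth_le_r[of 2 2 x]
    by (intro mult_mono powr_mono2') auto
  finally show "\<bar>r 2 x powr (- a)\<bar> \<le> 1 * cwt (\<lambda>k. if k \<le> 2 then a / 2 else 0) x"
    by (simp flip: powr_add)
qed (use assms in auto)

lemma integrable_r3_sq:
  assumes k: "k \<in> {3..n}"
  shows "integrable lborel (\<lambda>x. indicator (cball 0 R) x * (1 / (r k x)\<^sup>2))"
proof (rule integrable_cwt_bound[where a = "\<lambda>k. if k \<le> 3 then 2/3 else 0" and C = 1])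
  fix x :: "real ^ 'n" assume x: "\<forall>i. x $ i \<noteq> 0"
  have r: "r k x > 0" using r_pos[OF x, of k] k by simp
  \<comment> \<open>The first three coordinates share the exponent 2, and 2/3 < 1.\<close>
  have "cwt (\<lambda>k. if k \<le> 3 then 2/3 else 0) x = (\<Prod>k=1..n. if k \<le> 3 then \<bar>x $ e k\<bar> powr (- (2/3)) else 1)"
    unfolding cwt_def using x by (intro prod.cong) auto
  also have "\<dots> = (\<Prod>k\<in>{1,2,3}. \<bar>x $ e k\<bar> powr (- (2/3)))"
    using n3 by (intro prod.mono_neutral_cong_right) auto
  also have "\<dots> = \<bar>x $ e 1\<bar> powr (- (2/3)) * (\<bar>x $ e 2\<bar> powr (- (2/3)) * \<bar>x $ e 3\<bar> powr (- (2/3)))" by simp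
  also have "\<dots> \<ge> r k x powr (- (2/3)) * (r k x powr (- (2/3)) * r k x powr (- (2/3)))"
    using x k abs_nth_le_r[of 1 k x] abs_nth_le_r[of 2 k x] abs_nth_le_r[of 3 k x]
    by (intro mult_mono powr_mono2') auto
  finally have "r k x powr (- 2) \<le> cwt (\<lambda>k. if k \<le> 3 then 2/3 else 0) x"
    by (simp flip: powr_add)
  moreover have "r k x powr (- 2) = 1 / (r k x)\<^sup>2"
    using r by (simp add: powr_minus divide_inverse)
  ultimately show "\<bar>1 / (r k x)\<^sup>2\<bar> \<le> 1 * cwt (\<lambda>k. if k \<le> 3 then 2/3 else 0) x" by simp
qed auto

text \<open>\<open>gs_field S\<close> is \<open>-\<nabla>\<Phi>/\<Phi>\<close> for the ground state \<open>\<Phi> = \<Prod> |X\<^sub>k| powr -(S\<^sub>k - S\<^sub>k\<^sub>-\<^sub>1)\<close>.\<close>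

definition gs_field :: "(nat \<Rightarrow> real) \<Rightarrow> real ^ 'n \<Rightarrow> real ^ 'n" where
  "gs_field S x = (\<Sum>k=3..n. ((S k - S (k - 1)) / (r k x)\<^sup>2) *\<^sub>R trunc e k x)"

abbreviation gs_grad :: "(nat \<Rightarrow> real) \<Rightarrow> (real ^ 'n \<Rightarrow> real) \<Rightarrow> (real ^ 'n \<Rightarrow> real ^ 'n) \<Rightarrow> real ^ 'n \<Rightarrow> real ^ 'n" where
  "gs_grad S u g x \<equiv> g x + u x *\<^sub>R gs_field S x"

lemma measurable_gs_field[measurable]: "gs_field S \<in> borel_measurable borel"
  unfolding gs_field_def by measurable

text \<open>Induction on the number of summands. As X_k . X_(m+1) = |X_k|^2 for k <= m, the partial
  sum has inner product S_m with X_(m+1), by telescoping; the new summand therefore adds 2 S_m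
  (S_(m+1) - S_m) + (S_(m+1) - S_m)^2, a difference of squares, over |X_(m+1)|^2.\<close>

lemma norm_gs_field_sq:
  assumes S2: "S 2 = 0" and x: "\<forall>i. x $ i \<noteq> 0"
  shows "(norm (gs_field S x))\<^sup>2 = (\<Sum>k=3..n. ((S k)\<^sup>2 - (S (k - 1))\<^sup>2) / (r k x)\<^sup>2)"
proof -
  define A where "A m = (\<Sum>k=3..m. ((S k - S (k - 1)) / (r k x)\<^sup>2) *\<^sub>R trunc e k x)" for m
  have tel: "(\<Sum>k=3..m. S k - S (k - 1)) = S m" if "m \<ge> 2" for m
    using that by (induction m rule: dec_induct) (auto simp: S2)
  have "m \<le> n \<longrightarrow> A m \<bullet> A m = (\<Sum>k=3..m. ((S k)\<^sup>2 - (S (k - 1))\<^sup>2) / (r k x)\<^sup>2)" if "m \<ge> 2" for m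
    using that
  proof (induction m rule: dec_induct)
    case base
    then show ?case by (simp add: A_def)
  next
    case (step m)
    show ?case
    proof
      assume m: "Suc m \<le> n"
      let ?a = "(S (Suc m) - S m) / (r (Suc m) x)\<^sup>2"
      have pos: "r k x > 0" if "k \<in> {1..n}" for k using r_pos[OF x that] .
      have Suc: "A (Suc m) = A m + ?a *\<^sub>R trunc e (Suc m) x" using step(1) by (simp add: A_def)
      have "A m \<bullet> trunc e (Suc m) x = (\<Sum>k=3..m. S k - S (k - 1))"
        unfolding A_def inner_sum_left
      proof (intro sum.cong refl)
        fix k assume k: "k \<in> {3..m}"
        then have "r k x > 0" using pos[of k] m by simp
        then show "((S k - S (k - 1)) / (r k x)\<^sup>2) *\<^sub>R trunc e k x \<bullet> trunc e (Suc m) x = S k - S (k - 1)"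
          using k m by (simp add: inner_trunc_trunc)
      qed
      then have c: "A m \<bullet> trunc e (Suc m) x = S m" using tel step(1) by simp
      have p: "r (Suc m) x > 0" using pos[of "Suc m"] m by simp
      have "A (Suc m) \<bullet> A (Suc m) = A m \<bullet> A m + 2 * ?a * (A m \<bullet> trunc e (Suc m) x) + ?a\<^sup>2 * (r (Suc m) x)\<^sup>2"
        unfolding Suc power2_norm_eq_inner
        by (simp add: inner_add_left inner_add_right inner_commute power2_eq_square)
      also have "?a\<^sup>2 * (r (Suc m) x)\<^sup>2 = (S (Suc m) - S m)\<^sup>2 / (r (Suc m) x)\<^sup>2"
        using p by (simp add: power_divide power2_eq_square)
      also have "A m \<bullet> A m + 2 * ?a * (A m \<bullet> trunc e (Suc m) x) + (S (Suc m) - S m)\<^sup>2 / (r (Suc m) x)\<^sup>2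
         = A m \<bullet> A m + ((S (Suc m))\<^sup>2 - (S m)\<^sup>2) / (r (Suc m) x)\<^sup>2"
        unfolding c by (simp add: power2_eq_square algebra_simps flip: add_divide_distrib diff_divide_distrib)
      finally show "A (Suc m) \<bullet> A (Suc m) = (\<Sum>k=3..Suc m. ((S k)\<^sup>2 - (S (k - 1))\<^sup>2) / (r k x)\<^sup>2)"
        using step m by simp
    qed
  qed
  from this[of n] n3 show ?thesis by (simp add: A_def gs_field_def power2_norm_eq_inner)
qed

lemma norm_gs_field_le:
  assumes x: "\<forall>i. x $ i \<noteq> 0"
  shows "norm (gs_field S x) \<le> (\<Sum>k=3..n. \<bar>S k - S (k - 1)\<bar>) / r 3 x"
proof -
  have p3: "r 3 x > 0" using r_pos[OF x, of 3] n3 by simp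
  have "norm (gs_field S x) \<le> (\<Sum>k=3..n. norm (((S k - S (k - 1)) / (r k x)\<^sup>2) *\<^sub>R trunc e k x))"
    unfolding gs_field_def by (rule norm_sum)
  also have "\<dots> \<le> (\<Sum>k=3..n. \<bar>S k - S (k - 1)\<bar> / r 3 x)"
  proof (intro sum_mono)
    fix k assume k: "k \<in> {3..n}"
    have p: "r k x > 0" using r_pos[OF x, of k] k by simp
    have "norm (((S k - S (k - 1)) / (r k x)\<^sup>2) *\<^sub>R trunc e k x) = \<bar>S k - S (k - 1)\<bar> / r k x"
      using p by (simp add: power2_eq_square)
    also have "\<dots> \<le> \<bar>S k - S (k - 1)\<bar> / r 3 x"
      using p p3 r_mono[of 3 k x] k by (intro divide_left_mono) auto
    finally show "norm (((S k - S (k - 1)) / (r k x)\<^sup>2) *\<^sub>R trunc e k x) \<le> \<bar>S k - S (k - 1)\<bar> / r 3 x" .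
  qed
  finally show ?thesis by (simp add: sum_divide_distrib)
qed

lemma C1c_square:
  fixes u :: "real ^ 'n \<Rightarrow> real"
  assumes "C1c u g" shows "C1c (\<lambda>x. (u x)\<^sup>2) (\<lambda>x. (2 * u x) *\<^sub>R g x)"
  unfolding C1c_def
proof (intro conjI allI)
  show "((\<lambda>x. (u x)\<^sup>2) has_derivative (\<lambda>v. (2 * u x) *\<^sub>R g x \<bullet> v)) (at x)" for x
    using C1cD(1)[OF assms, of x] by (auto intro!: derivative_eq_intros)
  show "continuous_on UNIV (\<lambda>x. (2 * u x) *\<^sub>R g x)"
    by (intro continuous_intros C1cD[OF assms])
  show "\<exists>R. \<forall>x. norm x > R \<longrightarrow> (u x)\<^sup>2 = 0 \<and> (2 * u x) *\<^sub>R g x = 0"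
    using assms unfolding C1c_def by (metis scaleR_eq_0_iff mult_zero_right zero_eq_power2)
qed

lemma integrable_grad_sq:
  fixes u :: "real ^ 'n \<Rightarrow> real"
  assumes "C1c u g" shows "integrable lborel (\<lambda>x. (norm (g x))\<^sup>2)"
proof -
  obtain R M where R: "R > 0" "M > 0" "\<And>x. norm x > R \<Longrightarrow> u x = 0" "\<And>x. norm x > R \<Longrightarrow> g x = 0"
    "\<And>x. \<bar>u x\<bar> \<le> M" "\<And>x. norm (g x) \<le> M" using C1c_bound[OF assms] by metis
  have "integrable lborel (\<lambda>x. indicator (cball 0 R) x *\<^sub>R (norm (g x))\<^sup>2)"
    by (rule borel_integrable_compact)
       (auto intro!: continuous_intros continuous_on_subset[OF C1cD(2)[OF assms]])
  moreover have "(\<lambda>x. indicator (cball 0 R) x *\<^sub>R (norm (g x))\<^sup>2) = (\<lambda>x. (norm (g x))\<^sup>2)"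
    using R(4) by (auto simp: fun_eq_iff split: split_indicator)
  ultimately show ?thesis by simp
qed

text \<open>Expand the square. The cross term is a sum of (S_k - S_(k-1)) X_k . \<nabla>(u^2) /
  |X_k|^2, and the Euler identity for the weight |X_k|^(-2), of degree -2 in k variables, replaces
  X_k . \<nabla> by the factor 2 - k. The sequence S stays free because the formula serves both for
  \<alpha> and for its perturbation.\<close>

proposition ground_state_representation:
  fixes u :: "real ^ 'n \<Rightarrow> real"
  assumes u: "C1c u g" and S2: "S 2 = 0"
    and b: "\<And>k. k \<in> {3..n} \<Longrightarrow> b k = (real k - 2) * (S k - S (k - 1)) - (S k)\<^sup>2 + (S (k - 1))\<^sup>2"
  shows "integrable lborel (\<lambda>x. (norm (gs_grad S u g x))\<^sup>2)"
    and "integrable lborel (\<lambda>x. (\<Sum>k=3..n. b k / (r k x)\<^sup>2) * (u x)\<^sup>2)"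
    and "(LBINT x. (norm (gs_grad S u g x))\<^sup>2)
      = (LBINT x. (norm (g x))\<^sup>2) - (LBINT x. (\<Sum>k=3..n. b k / (r k x)\<^sup>2) * (u x)\<^sup>2)"
proof -
  let ?W = "\<lambda>k x. 1 / (r k x)\<^sup>2"
  let ?h = "\<lambda>x. (u x)\<^sup>2" and ?dh = "\<lambda>x. (2 * u x) *\<^sub>R g x"
  note h = C1c_square[OF u]
  have E: "integrable lborel (\<lambda>x. ?h x * ?W k x)"
    "integrable lborel (\<lambda>x. (trunc e k x \<bullet> ?dh x) * ?W k x)"
    "(LBINT x. (trunc e k x \<bullet> ?dh x) * ?W k x) = (2 - real k) * (LBINT x. ?h x * ?W k x)"
    if k: "k \<in> {3..n}" for k
  proof -
    have m: "?W k \<in> borel_measurable borel" by measurable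
    have hom: "?W k (x + (l - 1) *\<^sub>R trunc e k x) = l powr (- 2) * ?W k x" if "l > 0" for l x
      using that k by (simp add: r_dilate power_mult_distrib powr_minus divide_inverse)
    show "integrable lborel (\<lambda>x. ?h x * ?W k x)"
      "integrable lborel (\<lambda>x. (trunc e k x \<bullet> ?dh x) * ?W k x)"
      "(LBINT x. (trunc e k x \<bullet> ?dh x) * ?W k x) = (2 - real k) * (LBINT x. ?h x * ?W k x)"
      using Euler_identity[OF h _ m integrable_r3_sq[OF k] hom] k by auto
  qed
  define J where "J k = (LBINT x. ?h x * ?W k x)" for k
  let ?F = "\<lambda>x. (norm (g x))\<^sup>2 + (\<Sum>k=3..n. (S k - S (k - 1)) * ((trunc e k x \<bullet> ?dh x) * ?W k x))
     + (\<Sum>k=3..n. ((S k)\<^sup>2 - (S (k - 1))\<^sup>2) * (?h x * ?W k x))"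
  have Fint: "integrable lborel ?F"
    by (intro Bochner_Integration.integrable_add Bochner_Integration.integrable_sum integrable_mult_right E integrable_grad_sq[OF u])
  note [measurable] = C1cD(4,5)[OF u]
  have AEF: "AE x in lborel. (norm (gs_grad S u g x))\<^sup>2 = ?F x"
    using AE_nonzero
  proof eventually_elim
    case (elim x)
    have "(norm (gs_grad S u g x))\<^sup>2 = (norm (g x))\<^sup>2 + 2 * u x * (gs_field S x \<bullet> g x) + (u x)\<^sup>2 * (norm (gs_field S x))\<^sup>2"
      unfolding power2_norm_eq_inner
      by (simp add: inner_add_left inner_add_right inner_commute power2_eq_square algebra_simps)
    also have "2 * u x * (gs_field S x \<bullet> g x) = (\<Sum>k=3..n. (S k - S (k - 1)) * ((trunc e k x \<bullet> ?dh x) * ?W k x))"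
      by (simp add: gs_field_def inner_sum_left sum_distrib_left mult_ac)
    also have "(u x)\<^sup>2 * (norm (gs_field S x))\<^sup>2 = (\<Sum>k=3..n. ((S k)\<^sup>2 - (S (k - 1))\<^sup>2) * (?h x * ?W k x))"
      unfolding norm_gs_field_sq[of S, OF S2 elim] by (simp add: sum_distrib_left mult_ac)
    finally show ?case .
  qed
  show "integrable lborel (\<lambda>x. (norm (gs_grad S u g x))\<^sup>2)"
    using Fint by (rule integrable_cong_AE_imp) (use AEF in \<open>auto elim: AE_mp\<close>)
  have Veq: "(\<lambda>x. (\<Sum>k=3..n. b k / (r k x)\<^sup>2) * (u x)\<^sup>2) = (\<lambda>x. \<Sum>k=3..n. b k * (?h x * ?W k x))"
    by (simp add: fun_eq_iff sum_distrib_right sum_distrib_left mult_ac)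
  show "integrable lborel (\<lambda>x. (\<Sum>k=3..n. b k / (r k x)\<^sup>2) * (u x)\<^sup>2)"
    unfolding Veq by (intro Bochner_Integration.integrable_sum integrable_mult_right E)
  have "(LBINT x. (norm (gs_grad S u g x))\<^sup>2) = (LBINT x. ?F x)"
    using AEF by (intro integral_cong_AE) auto
  also have "\<dots> = (LBINT x. (norm (g x))\<^sup>2) + (LBINT x. (\<Sum>k=3..n. (S k - S (k - 1)) * ((trunc e k x \<bullet> ?dh x) * ?W k x)))
     + (LBINT x. (\<Sum>k=3..n. ((S k)\<^sup>2 - (S (k - 1))\<^sup>2) * (?h x * ?W k x)))"
    by (simp only: Bochner_Integration.integral_add Bochner_Integration.integrable_add
        Bochner_Integration.integrable_sum integrable_mult_right E integrable_grad_sq[OF u])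
  also have "(LBINT x. (\<Sum>k=3..n. (S k - S (k - 1)) * ((trunc e k x \<bullet> ?dh x) * ?W k x)))
     = (\<Sum>k=3..n. (S k - S (k - 1)) * ((2 - real k) * J k))"
    by (subst Bochner_integral_sum_cmult) (rule E, assumption, intro sum.cong refl, simp only: J_def E(3))
  also have "(LBINT x. (\<Sum>k=3..n. ((S k)\<^sup>2 - (S (k - 1))\<^sup>2) * (?h x * ?W k x)))
     = (\<Sum>k=3..n. ((S k)\<^sup>2 - (S (k - 1))\<^sup>2) * J k)"
    unfolding J_def by (rule Bochner_integral_sum_cmult) (rule E)
  also have "(LBINT x. (norm (g x))\<^sup>2) + (\<Sum>k=3..n. (S k - S (k - 1)) * ((2 - real k) * J k)) + (\<Sum>k=3..n. ((S k)\<^sup>2 - (S (k - 1))\<^sup>2) * J k)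
    = (LBINT x. (norm (g x))\<^sup>2) - (\<Sum>k=3..n. b k * J k)"
  proof -
    have "(\<Sum>k=3..n. (S k - S (k - 1)) * ((2 - real k) * J k)) + (\<Sum>k=3..n. ((S k)\<^sup>2 - (S (k - 1))\<^sup>2) * J k) = - (\<Sum>k=3..n. b k * J k)"
      unfolding sum.distrib[symmetric] sum_negf[symmetric]
      by (intro sum.cong refl) (simp add: b algebra_simps)
    then show ?thesis by simp
  qed
  also have "(\<Sum>k=3..n. b k * J k) = (LBINT x. (\<Sum>k=3..n. b k / (r k x)\<^sup>2) * (u x)\<^sup>2)"
    unfolding Veq J_def by (rule Bochner_integral_sum_cmult[symmetric]) (rule E)
  finally show "(LBINT x. (norm (gs_grad S u g x))\<^sup>2)
      = (LBINT x. (norm (g x))\<^sup>2) - (LBINT x. (\<Sum>k=3..n. b k / (r k x)\<^sup>2) * (u x)\<^sup>2)" .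
qed

end

section \<open>Weighted Hardy and Sobolev inequalities\<close>

lemma powr_minus_Suc: "x powr (- (\<kappa> + 1)) = x powr (- \<kappa>) * x powr (- 1)" for x \<kappa> :: real
proof -
  have "- (\<kappa> + 1) = - \<kappa> + - 1" by simp
  then show ?thesis by (simp only: powr_add)
qed

lemma DERIV_abs_powr:
  fixes t s :: real
  assumes "s > 1"
  shows "DERIV (\<lambda>t. \<bar>t\<bar> powr s) t :> s * \<bar>t\<bar> powr (s - 1) * sgn t"
proof -
  consider "t > 0" | "t < 0" | "t = 0" by linarith
  then show ?thesis
  proof cases
    case 1
    have "DERIV (\<lambda>t. t powr s) t :> s * t powr (s - 1)" using 1 by (auto intro!: derivative_eq_intros)
    then have "DERIV (\<lambda>t. \<bar>t\<bar> powr s) t :> s * t powr (s - 1)"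
      by (rule has_field_derivative_transform_within_open[where S = "{0<..}"]) (use 1 in auto)
    then show ?thesis using 1 by simp
  next
    case 2
    have "DERIV (\<lambda>t. (-t) powr s) t :> - (s * (-t) powr (s - 1))" using 2 by (auto intro!: derivative_eq_intros)
    then have "DERIV (\<lambda>t. \<bar>t\<bar> powr s) t :> - (s * (-t) powr (s - 1))"
      by (rule has_field_derivative_transform_within_open[where S = "{..<0}"]) (use 2 in auto)
    then show ?thesis using 2 by simp
  next
    case 3
    have A: "((\<lambda>h::real. \<bar>h\<bar> powr (s - 1)) \<longlongrightarrow> 0) (at 0)"
      by (rule tendsto_zero_powrI[where b = "s - 1"]) (auto intro!: tendsto_eq_intros assms simp: assms)
    have B: "norm (\<bar>h\<bar> powr s / h) \<le> \<bar>h\<bar> powr (s - 1)" for h :: real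
      by (cases "h = 0") (auto simp: powr_diff)
    have "((\<lambda>h::real. \<bar>h\<bar> powr s / h) \<longlongrightarrow> 0) (at 0)"
      by (rule Lim_null_comparison[OF always_eventually[OF allI[OF B]] A])
    then show ?thesis using 3 by (simp add: has_field_derivative_iff)
  qed
qed

lemma continuous_abs_powr_sgn:
  fixes p :: real
  assumes "p > 0"
  shows "continuous_on UNIV (\<lambda>t::real. \<bar>t\<bar> powr p * sgn t)"
proof -
  have "isCont (\<lambda>t::real. \<bar>t\<bar> powr p * sgn t) t" for t
  proof (cases "t = 0")
    case True
    have A: "((\<lambda>h::real. \<bar>h\<bar> powr p) \<longlongrightarrow> 0) (at 0)"
      by (rule tendsto_zero_powrI[where b = p]) (auto intro!: tendsto_eq_intros assms simp: assms)
    have B: "norm (\<bar>h\<bar> powr p * sgn h) \<le> \<bar>h\<bar> powr p" for h :: real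
      by (auto simp: sgn_if)
    have "((\<lambda>h::real. \<bar>h\<bar> powr p * sgn h) \<longlongrightarrow> 0) (at 0)"
      by (rule Lim_null_comparison[OF always_eventually[OF allI[OF B]] A])
    then show ?thesis using True by (simp add: isCont_def)
  next
    case False
    then show ?thesis unfolding isCont_def by (auto intro!: tendsto_eq_intros)
  qed
  then show ?thesis by (simp add: continuous_on_eq_continuous_at)
qed

lemma C1c_abs_powr:
  assumes u: "C1c u g" and s: "s > 1"
  shows "C1c (\<lambda>x. \<bar>u x\<bar> powr s) (\<lambda>x. (s * \<bar>u x\<bar> powr (s - 1) * sgn (u x)) *\<^sub>R g x)"
  unfolding C1c_def
proof (intro conjI allI)
  fix x
  show "((\<lambda>x. \<bar>u x\<bar> powr s) has_derivative (\<lambda>v. (s * \<bar>u x\<bar> powr (s - 1) * sgn (u x)) *\<^sub>R g x \<bullet> v)) (at x)"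
    using has_derivative_compose[OF C1cD(1)[OF u, of x] DERIV_abs_powr[OF s, of "u x", unfolded has_field_derivative_def]]
    by (rule has_derivative_eq_rhs) (simp add: fun_eq_iff)
next
  have "continuous_on UNIV (\<lambda>x. \<bar>u x\<bar> powr (s - 1) * sgn (u x))"
    using continuous_on_compose2[OF continuous_abs_powr_sgn[of "s - 1"] C1cD(3)[OF u]] s by auto
  then have "continuous_on UNIV (\<lambda>x. (s * (\<bar>u x\<bar> powr (s - 1) * sgn (u x))) *\<^sub>R g x)"
    by (intro continuous_on_scaleR continuous_on_mult[OF continuous_on_const] C1cD(2)[OF u])
  then show "continuous_on UNIV (\<lambda>x. (s * \<bar>u x\<bar> powr (s - 1) * sgn (u x)) *\<^sub>R g x)"
    by (simp add: mult.assoc)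
next
  obtain R where "\<And>x. norm x > R \<Longrightarrow> u x = 0 \<and> g x = 0" using u by (auto simp: C1c_def)
  then show "\<exists>R. \<forall>x. norm x > R \<longrightarrow> \<bar>u x\<bar> powr s = 0 \<and> (s * \<bar>u x\<bar> powr (s - 1) * sgn (u x)) *\<^sub>R g x = 0"
    by (intro exI[of _ R]) auto
qed

text \<open>
  With these constants the negative off-diagonal terms in the divergence of
  \<open>\<Sum> c\<^sub>k X\<^sub>k/|X\<^sub>k|\<close> are absorbed by the diagonal ones.
\<close>

lemma triangular_constants:
  fixes \<delta> \<Gamma> :: "nat \<Rightarrow> real"
  assumes \<delta>: "\<And>j. j \<in> {2..n} \<Longrightarrow> \<delta> j > 0"
  shows "\<exists>c. (\<forall>k. c k > 0) \<and> (\<forall>j\<in>{3..n}. \<Gamma> j * (\<Sum>k=2..<j. c k) \<le> c j * \<delta> j)"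
proof -
  define B where "B = 1 + (\<Sum>j=3..n. \<bar>\<Gamma> j\<bar> / \<delta> j)"
  have nn: "\<bar>\<Gamma> j\<bar> / \<delta> j \<ge> 0" if "j \<in> {3..n}" for j using \<delta>[of j] that by auto
  have "(\<Sum>j=3..n. \<bar>\<Gamma> j\<bar> / \<delta> j) \<ge> 0" by (intro sum_nonneg nn)
  then have B1: "B \<ge> 1" by (simp add: B_def)
  \<comment> \<open>B bounds every ratio |\<open>\<Gamma> j\<close>| / \<open>\<delta> j\<close>.
    Since B (1 + B)^k = (1 + B)^(k+1) - (1 + B)^k, the sum of all earlier constants, multiplied by
    B, telescopes below the next one.\<close>
  define c where "c k = (1 + B) ^ k" for k :: nat
  have geo: "B * (\<Sum>k=2..<j. c k) \<le> c j" for j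
    by (induction j) (use B1 in \<open>auto simp: c_def algebra_simps\<close>)
  have "\<Gamma> j * (\<Sum>k=2..<j. c k) \<le> c j * \<delta> j" if j: "j \<in> {3..n}" for j
  proof -
    have d: "\<delta> j > 0" using \<delta> j by auto
    have "\<bar>\<Gamma> j\<bar> / \<delta> j \<le> (\<Sum>j=3..n. \<bar>\<Gamma> j\<bar> / \<delta> j)"
      using j nn by (intro member_le_sum) auto
    then have "\<bar>\<Gamma> j\<bar> / \<delta> j \<le> B" by (simp add: B_def)
    then have "\<bar>\<Gamma> j\<bar> \<le> B * \<delta> j" using d by (simp add: divide_le_eq)
    then have "\<Gamma> j \<le> B * \<delta> j" by linarith
    then have "\<Gamma> j * (\<Sum>k=2..<j. c k) \<le> (B * \<delta> j) * (\<Sum>k=2..<j. c k)"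
      using B1 by (intro mult_right_mono sum_nonneg) (auto simp: c_def)
    also have "\<dots> = \<delta> j * (B * (\<Sum>k=2..<j. c k))" by simp
    also have "\<dots> \<le> \<delta> j * c j" using d by (intro mult_left_mono geo) auto
    finally show ?thesis by (simp add: mult.commute)
  qed
  moreover have "\<forall>k. c k > 0" using B1 by (simp add: c_def)
  ultimately show ?thesis by blast
qed

context enumerated_coordinates
begin

lemma inner_trunc_trunc_right: "k \<le> n \<Longrightarrow> trunc e k x \<bullet> trunc e k v = trunc e k x \<bullet> v"
  by (simp add: inner_trunc trunc_nth)

lemma has_derivative_r_sq:
  assumes "k \<le> n"
  shows "((\<lambda>x. (r k x)\<^sup>2) has_derivative (\<lambda>v. 2 * (trunc e k x \<bullet> v))) (at x)"
proof -
  have "(trunc e k has_derivative trunc e k) (at x)"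
    by (rule bounded_linear_imp_has_derivative[OF bounded_linear_trunc])
  then have "((\<lambda>x. trunc e k x \<bullet> trunc e k x) has_derivative (\<lambda>v. trunc e k x \<bullet> trunc e k v + trunc e k v \<bullet> trunc e k x)) (at x)"
    by (intro derivative_intros)
  then show ?thesis unfolding power2_norm_eq_inner
  proof (rule has_derivative_eq_rhs, intro ext)
    fix v
    show "trunc e k x \<bullet> trunc e k v + trunc e k v \<bullet> trunc e k x = 2 * (trunc e k x \<bullet> v)"
      using inner_trunc_trunc_right[OF assms, of x v] inner_commute[of "trunc e k v" "trunc e k x"] by simp
  qed
qed

lemma has_derivative_r_powr:
  assumes "k \<le> n" "\<epsilon> \<noteq> 0"
  shows "((\<lambda>x. ((r k x)\<^sup>2 + \<epsilon>\<^sup>2) powr p) has_derivative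
     (\<lambda>v. 2 * p * ((r k x)\<^sup>2 + \<epsilon>\<^sup>2) powr (p - 1) * (trunc e k x \<bullet> v))) (at x)"
proof -
  have pos: "(r k x)\<^sup>2 + \<epsilon>\<^sup>2 > 0" using assms by (simp add: add_nonneg_pos)
  have "((\<lambda>x. (r k x)\<^sup>2 + \<epsilon>\<^sup>2) has_derivative (\<lambda>v. 2 * (trunc e k x \<bullet> v))) (at x)"
    using has_derivative_add[OF has_derivative_r_sq[OF assms(1)] has_derivative_const[of "\<epsilon>\<^sup>2"]] by simp
  moreover have "DERIV (\<lambda>t. t powr p) ((r k x)\<^sup>2 + \<epsilon>\<^sup>2) :> p * ((r k x)\<^sup>2 + \<epsilon>\<^sup>2) powr (p - 1)"
    using pos by (auto intro!: derivative_eq_intros)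
  ultimately have "((\<lambda>x. ((r k x)\<^sup>2 + \<epsilon>\<^sup>2) powr p) has_derivative
     (\<lambda>v. p * ((r k x)\<^sup>2 + \<epsilon>\<^sup>2) powr (p - 1) * (2 * (trunc e k x \<bullet> v)))) (at x)"
    unfolding has_field_derivative_def by (rule has_derivative_compose)
  then show ?thesis by (rule has_derivative_eq_rhs) (simp add: fun_eq_iff)
qed

lemma continuous_on_r_powr:
  assumes "\<epsilon> \<noteq> 0"
  shows "continuous_on UNIV (\<lambda>x. ((r k x)\<^sup>2 + \<epsilon>\<^sup>2) powr p)"
proof -
  have "(r k x)\<^sup>2 + \<epsilon>\<^sup>2 \<noteq> 0" for x
    using assms by (metis add_nonneg_pos less_irrefl zero_le_power2 zero_less_power2)
  then show ?thesis
    by (intro continuous_intros linear_continuous_on[OF bounded_linear_trunc]) auto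
qed

text \<open>The weight |X_2|^(2p) with p < 0 is singular on X_2 = 0; with \<epsilon> the product
  stays C^1, which the Gagliardo-Nirenberg inequality demands.\<close>

lemma C1c_regularized:
  fixes h :: "real ^ 'n \<Rightarrow> real"
  assumes h: "C1c h dh" and \<epsilon>: "\<epsilon> \<noteq> 0"
  shows "C1c (\<lambda>x. ((r 2 x)\<^sup>2 + \<epsilon>\<^sup>2) powr p * h x)
    (\<lambda>x. ((r 2 x)\<^sup>2 + \<epsilon>\<^sup>2) powr p *\<^sub>R dh x + (2 * p * ((r 2 x)\<^sup>2 + \<epsilon>\<^sup>2) powr (p - 1) * h x) *\<^sub>R trunc e 2 x)"
  unfolding C1c_def
proof (intro conjI allI)
  have n2: "2 \<le> n" using n3 by simp
  show "((\<lambda>x. ((r 2 x)\<^sup>2 + \<epsilon>\<^sup>2) powr p * h x) has_derivative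
    (\<lambda>v. (((r 2 x)\<^sup>2 + \<epsilon>\<^sup>2) powr p *\<^sub>R dh x + (2 * p * ((r 2 x)\<^sup>2 + \<epsilon>\<^sup>2) powr (p - 1) * h x) *\<^sub>R trunc e 2 x) \<bullet> v)) (at x)" for x
    using has_derivative_mult[OF has_derivative_r_powr[OF n2 \<epsilon>, of p x] C1cD(1)[OF h, of x]]
    by (rule has_derivative_eq_rhs) (auto simp: fun_eq_iff inner_add_left mult_ac)
  show "continuous_on UNIV (\<lambda>x. ((r 2 x)\<^sup>2 + \<epsilon>\<^sup>2) powr p *\<^sub>R dh x + (2 * p * ((r 2 x)\<^sup>2 + \<epsilon>\<^sup>2) powr (p - 1) * h x) *\<^sub>R trunc e 2 x)"
    by (intro continuous_on_add continuous_on_scaleR continuous_on_mult continuous_on_const continuous_on_r_powr[OF \<epsilon>] C1cD[OF h]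
       linear_continuous_on[OF bounded_linear_trunc])
  obtain R where "\<And>x. norm x > R \<Longrightarrow> h x = 0 \<and> dh x = 0" using h by (auto simp: C1c_def)
  then show "\<exists>R. \<forall>x. norm x > R \<longrightarrow> ((r 2 x)\<^sup>2 + \<epsilon>\<^sup>2) powr p * h x = 0 \<and>
     ((r 2 x)\<^sup>2 + \<epsilon>\<^sup>2) powr p *\<^sub>R dh x + (2 * p * ((r 2 x)\<^sup>2 + \<epsilon>\<^sup>2) powr (p - 1) * h x) *\<^sub>R trunc e 2 x = 0"
    by (intro exI[of _ R]) auto
qed

text \<open>X_k . X_j is the square of |X_min(j,k)|: the terms j <= k telescope to S_k, and those
  with j > k keep a ratio |X_k|^2 / |X_j|^2. The latter are the off-diagonal terms of the Hardy
  inequality.\<close>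

lemma inner_trunc_gs_field:
  assumes S2: "S 2 = 0" and x: "\<forall>i. x $ i \<noteq> 0" and k: "k \<in> {2..n}"
  shows "trunc e k x \<bullet> gs_field S x = S k + (\<Sum>j=3..n. if k < j then (S j - S (j - 1)) * (r k x)\<^sup>2 / (r j x)\<^sup>2 else 0)"
proof -
  have tel: "(\<Sum>k=3..m. S k - S (k - 1)) = S m" if "m \<ge> 2" for m
    using that by (induction m rule: dec_induct) (auto simp: S2)
  have "trunc e k x \<bullet> gs_field S x = (\<Sum>j=3..n. (if j \<le> k then S j - S (j - 1) else 0) + (if k < j then (S j - S (j - 1)) * (r k x)\<^sup>2 / (r j x)\<^sup>2 else 0))"
    unfolding gs_field_def inner_sum_right
  proof (intro sum.cong refl)
    fix j assume j: "j \<in> {3..n}"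
    then have "r j x > 0" using r_pos[OF x, of j] by simp
    then show "trunc e k x \<bullet> ((S j - S (j - 1)) / (r j x)\<^sup>2) *\<^sub>R trunc e j x =
      (if j \<le> k then S j - S (j - 1) else 0) + (if k < j then (S j - S (j - 1)) * (r k x)\<^sup>2 / (r j x)\<^sup>2 else 0)"
      using j k by (simp add: inner_trunc_trunc min_def)
  qed
  also have "\<dots> = (\<Sum>j=3..n. (if j \<le> k then S j - S (j - 1) else 0)) + (\<Sum>j=3..n. if k < j then (S j - S (j - 1)) * (r k x)\<^sup>2 / (r j x)\<^sup>2 else 0)"
    by (rule sum.distrib)
  also have "(\<Sum>j=3..n. (if j \<le> k then S j - S (j - 1) else 0)) = (\<Sum>j=3..k. S j - S (j - 1))"
    using k by (intro sum.mono_neutral_cong_right) auto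
  finally show ?thesis using tel k by simp
qed

text \<open>With v = u/\<Phi> this is |X_2|^(-\<kappa>) \<Phi>^s |\<nabla> |v|^s|, a weighted total
  variation density.\<close>

definition gs_flux :: "(nat \<Rightarrow> real) \<Rightarrow> real \<Rightarrow> real \<Rightarrow> (real ^ 'n \<Rightarrow> real) \<Rightarrow> (real ^ 'n \<Rightarrow> real ^ 'n) \<Rightarrow> real ^ 'n \<Rightarrow> real" where
  "gs_flux S \<kappa> s u g x = r 2 x powr (- \<kappa>) * (s * \<bar>u x\<bar> powr (s - 1) * norm (gs_grad S u g x))"

text \<open>The field is of size 1/|X_3| <= 1/|X_2|, so on the support of u the flux is at most a
  constant times |X_2|^(-(\<kappa> + 1)), and \<kappa> + 1 < 2.\<close>

lemma integrable_gs_flux: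
  assumes u: "C1c u g" and \<kappa>: "0 \<le> \<kappa>" "\<kappa> < 1" and s: "s > 1"
  shows "integrable lborel (gs_flux S \<kappa> s u g)"
proof -
  obtain R M where R: "R > 0" "M > 0" "\<And>x. norm x > R \<Longrightarrow> u x = 0" "\<And>x. norm x > R \<Longrightarrow> g x = 0"
    "\<And>x. \<bar>u x\<bar> \<le> M" "\<And>x. norm (g x) \<le> M" using C1c_bound[OF u] by metis
  note [measurable] = C1cD(4,5)[OF u]
  define \<Gamma> where "\<Gamma> = (\<Sum>k=3..n. \<bar>S k - S (k - 1)\<bar>)"
  have \<Gamma>0: "\<Gamma> \<ge> 0" by (simp add: \<Gamma>_def sum_nonneg)
  let ?C = "s * M powr (s - 1) * (M * R + M * \<Gamma>)"
  show ?thesis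
  proof (rule Bochner_Integration.integrable_bound)
    show "integrable lborel (\<lambda>x. ?C * (indicator (cball 0 R) x * r 2 x powr (- (\<kappa> + 1))))"
      using \<kappa> by (intro integrable_mult_right integrable_r2) auto
    show "gs_flux S \<kappa> s u g \<in> borel_measurable lborel" unfolding gs_flux_def by measurable
    show "AE x in lborel. norm (gs_flux S \<kappa> s u g x) \<le> norm (?C * (indicator (cball 0 R) x * r 2 x powr (- (\<kappa> + 1))))"
      using AE_nonzero
    proof eventually_elim
      case (elim x)
      show ?case
      proof (cases "norm x \<le> R")
        case False
        then show ?thesis using R(3)[of x] by (simp add: gs_flux_def)
      next
        case True
        have p2: "r 2 x > 0" using r_pos[OF elim, of 2] n3 by simp
        have r23: "r 2 x \<le> r 3 x" "r 2 x \<le> R" using r_mono[of 2 3 x] r_le_norm[of 2 x] n3 True by auto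
        have "norm (gs_grad S u g x) \<le> norm (g x) + \<bar>u x\<bar> * norm (gs_field S x)"
          by (rule order_trans[OF norm_triangle_ineq]) simp
        also have "\<dots> \<le> M * (R / r 2 x) + M * (\<Gamma> / r 2 x)"
        proof (intro add_mono mult_mono)
          have "norm (g x) \<le> M * 1" using R(6) by simp
          also have "\<dots> \<le> M * (R / r 2 x)" using R(2) r23 p2 by (intro mult_left_mono) auto
          finally show "norm (g x) \<le> M * (R / r 2 x)" .
          have "norm (gs_field S x) \<le> \<Gamma> / r 3 x" using norm_gs_field_le[OF elim] by (simp add: \<Gamma>_def)
          also have "\<dots> \<le> \<Gamma> / r 2 x" using \<Gamma>0 r23 p2 by (intro divide_left_mono mult_pos_pos) auto
          finally show "norm (gs_field S x) \<le> \<Gamma> / r 2 x" .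
        qed (use R in auto)
        also have "\<dots> = (M * R + M * \<Gamma>) * r 2 x powr (-1)"
          using p2 by (simp add: powr_minus_divide add_divide_distrib)
        finally have G: "norm (gs_grad S u g x) \<le> (M * R + M * \<Gamma>) * r 2 x powr (-1)" .
        have "gs_flux S \<kappa> s u g x \<le> r 2 x powr (- \<kappa>) * (s * M powr (s - 1) * ((M * R + M * \<Gamma>) * r 2 x powr (-1)))"
          unfolding gs_flux_def using s R G by (intro mult_left_mono mult_mono powr_mono2) auto
        also have "\<dots> = ?C * (r 2 x powr (- \<kappa>) * r 2 x powr (-1))" by simp
        also have "r 2 x powr (- \<kappa>) * r 2 x powr (-1) = r 2 x powr (- (\<kappa> + 1))"
          by (simp only: powr_minus_Suc)
        finally have "gs_flux S \<kappa> s u g x \<le> ?C * r 2 x powr (- (\<kappa> + 1))" .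
        moreover have "gs_flux S \<kappa> s u g x \<ge> 0" using s by (simp add: gs_flux_def)
        ultimately show ?thesis using True s R \<Gamma>0 by simp
      qed
    qed
  qed
qed

text \<open>By homogeneity in the first k coordinates, |X_2|^(-\<kappa>) X_k/|X_k| has divergence (k
  - 1 - \<kappa>) |X_2|^(-\<kappa>)/|X_k|. Tested against |u|^s, with g written as
  \<open>gs_grad\<close> minus u times \<open>gs_field\<close>, it loses s X_k .
  \<open>gs_field\<close>, whose main part is s S_k. What is left on the diagonal is
  \<open>\<delta> k\<close>, positive by \<open>sub\<close>.\<close>

proposition L1_Hardy:
  assumes S2: "S 2 = 0" and \<kappa>: "0 \<le> \<kappa>" "\<kappa> < 1" and s: "s > 1"
    and sub: "\<And>k. k \<in> {2..n} \<Longrightarrow> \<kappa> + s * S k < real k - 1"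
  shows "\<exists>C>0. \<forall>u g. C1c u g \<longrightarrow>
    integrable lborel (\<lambda>x. r 2 x powr (- (\<kappa> + 1)) * \<bar>u x\<bar> powr s) \<and>
    (LBINT x. r 2 x powr (- (\<kappa> + 1)) * \<bar>u x\<bar> powr s) \<le> C * (LBINT x. gs_flux S \<kappa> s u g x)"
proof -
  define \<delta> where "\<delta> k = real k - 1 - \<kappa> - s * S k" for k
  define \<Gamma> where "\<Gamma> j = s * \<bar>S j - S (j - 1)\<bar>" for j
  have \<delta>: "\<delta> k > 0" if "k \<in> {2..n}" for k using sub[OF that] by (simp add: \<delta>_def)
  have \<Gamma>0: "\<Gamma> j \<ge> 0" for j using s by (simp add: \<Gamma>_def)
  obtain c where c: "\<And>k. c k > 0" "\<And>j. j \<in> {3..n} \<Longrightarrow> \<Gamma> j * (\<Sum>k=2..<j. c k) \<le> c j * \<delta> j"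
    using triangular_constants[of n \<delta> \<Gamma>] \<delta> by blast
  \<comment> \<open>Losses occur only at 1/|X_j| with j >= 3, so the diagonal term k = 2 survives
    intact and produces the weight 1/|X_2|.\<close>
  define \<eta> where "\<eta> = c 2 * \<delta> 2"
  have \<eta>: "\<eta> > 0" using c(1) \<delta>[of 2] n3 by (simp add: \<eta>_def)
  define K where "K = (\<Sum>k=2..n. c k)"
  have K: "K > 0" unfolding K_def using c(1) n3 by (intro sum_pos) auto
  have key: "\<eta> / r 2 x \<le> (\<Sum>k=2..n. c k * ((real k - 1 - \<kappa>) - s * (trunc e k x \<bullet> gs_field S x)) / r k x)"
    if x: "\<forall>i. x $ i \<noteq> 0" for x
  proof -
    have pos: "r k x > 0" if "k \<in> {1..n}" for k using r_pos[OF x that] .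
    have trm: "c k * \<delta> k / r k x - (\<Sum>j=3..n. if k < j then c k * (\<Gamma> j / r j x) else 0)
       \<le> c k * ((real k - 1 - \<kappa>) - s * (trunc e k x \<bullet> gs_field S x)) / r k x" if k: "k \<in> {2..n}" for k
    proof -
      have pk: "r k x > 0" using pos k by simp
      have "s * (trunc e k x \<bullet> gs_field S x) / r k x
        = s * S k / r k x + (\<Sum>j=3..n. if k < j then s * ((S j - S (j - 1)) * (r k x)\<^sup>2 / (r j x)\<^sup>2) / r k x else 0)"
        unfolding inner_trunc_gs_field[of S, OF S2 x k] distrib_left add_divide_distrib sum_distrib_left sum_divide_distrib
        by (intro arg_cong2[where f = "(+)"] refl sum.cong) auto
      also have "\<dots> \<le> s * S k / r k x + (\<Sum>j=3..n. if k < j then \<Gamma> j / r j x else 0)"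
      proof (intro add_mono sum_mono order_refl)
        fix j assume j: "j \<in> {3..n}"
        show "(if k < j then s * ((S j - S (j - 1)) * (r k x)\<^sup>2 / (r j x)\<^sup>2) / r k x else 0) \<le> (if k < j then \<Gamma> j / r j x else 0)"
        proof (cases "k < j")
          case True
          have pj: "r j x > 0" using pos j by simp
          have le: "r k x \<le> r j x" using r_mono[of k j x] True j by simp
          have "s * ((S j - S (j - 1)) * (r k x)\<^sup>2 / (r j x)\<^sup>2) / r k x = (s * (S j - S (j - 1))) * (r k x / (r j x)\<^sup>2)"
            using pk by (simp add: power2_eq_square)
          also have "\<dots> \<le> \<Gamma> j * (r k x / (r j x)\<^sup>2)"
            using s pk by (intro mult_right_mono) (auto simp: \<Gamma>_def)
          also have "\<dots> \<le> \<Gamma> j * (r j x / (r j x)\<^sup>2)"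
            using le \<Gamma>0[of j] by (intro mult_left_mono divide_right_mono) auto
          also have "\<dots> = \<Gamma> j / r j x" using pj by (simp add: power2_eq_square)
          finally show ?thesis using True by simp
        qed simp
      qed
      finally have "s * (trunc e k x \<bullet> gs_field S x) / r k x \<le> s * S k / r k x + (\<Sum>j=3..n. if k < j then \<Gamma> j / r j x else 0)" .
      then have "\<delta> k / r k x - (\<Sum>j=3..n. if k < j then \<Gamma> j / r j x else 0) \<le> ((real k - 1 - \<kappa>) - s * (trunc e k x \<bullet> gs_field S x)) / r k x"
        by (simp add: \<delta>_def diff_divide_distrib)
      from mult_left_mono[OF this less_imp_le[OF c(1)[of k]]]
      have "c k * (\<delta> k / r k x) - c k * (\<Sum>j=3..n. if k < j then \<Gamma> j / r j x else 0) \<le> c k * (((real k - 1 - \<kappa>) - s * (trunc e k x \<bullet> gs_field S x)) / r k x)"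
        by (simp only: right_diff_distrib)
      moreover have "c k * (\<Sum>j=3..n. if k < j then \<Gamma> j / r j x else 0) = (\<Sum>j=3..n. if k < j then c k * (\<Gamma> j / r j x) else 0)"
        unfolding sum_distrib_left by (intro sum.cong) auto
      ultimately show ?thesis by simp
    qed
    \<comment> \<open>Exchanging the sums collects all losses at the same 1/|X_j|, where
      \<open>c j * \<delta> j\<close> pays for them.\<close>
    have "(\<Sum>k=2..n. \<Sum>j=3..n. if k < j then c k * (\<Gamma> j / r j x) else 0) = (\<Sum>j=3..n. \<Sum>k=2..n. if k < j then c k * (\<Gamma> j / r j x) else 0)"
      by (rule sum.swap)
    also have "\<dots> = (\<Sum>j=3..n. (\<Gamma> j * (\<Sum>k=2..<j. c k)) / r j x)"
    proof (intro sum.cong refl)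
      fix j assume j: "j \<in> {3..n}"
      have "(\<Sum>k=2..n. if k < j then c k * (\<Gamma> j / r j x) else 0) = (\<Sum>k=2..<j. c k * (\<Gamma> j / r j x))"
        using j by (intro sum.mono_neutral_cong_right) auto
      then show "(\<Sum>k=2..n. if k < j then c k * (\<Gamma> j / r j x) else 0) = (\<Gamma> j * (\<Sum>k=2..<j. c k)) / r j x"
        by (simp add: sum_distrib_right sum_distrib_left sum_divide_distrib mult.commute)
    qed
    also have "\<dots> \<le> (\<Sum>j=3..n. c j * \<delta> j / r j x)"
      using c(2) by (intro sum_mono divide_right_mono) auto
    finally have "(\<Sum>k=2..n. \<Sum>j=3..n. if k < j then c k * (\<Gamma> j / r j x) else 0) \<le> (\<Sum>j=3..n. c j * \<delta> j / r j x)" .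
    moreover have "(\<Sum>k=2..n. c k * \<delta> k / r k x) = \<eta> / r 2 x + (\<Sum>j=3..n. c j * \<delta> j / r j x)"
    proof -
      have "{2..n} = insert 2 {3..n}" using n3 by auto
      then show ?thesis by (simp add: \<eta>_def)
    qed
    moreover have "(\<Sum>k=2..n. c k * \<delta> k / r k x) - (\<Sum>k=2..n. \<Sum>j=3..n. if k < j then c k * (\<Gamma> j / r j x) else 0)
      \<le> (\<Sum>k=2..n. c k * ((real k - 1 - \<kappa>) - s * (trunc e k x \<bullet> gs_field S x)) / r k x)"
      unfolding sum_subtractf[symmetric] by (intro sum_mono trm)
    ultimately show ?thesis by linarith
  qed
  show ?thesis
  proof (intro exI[of _ "K / \<eta>"] conjI allI impI)
    show "K / \<eta> > 0" using K \<eta> by simp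
    fix u :: "real ^ 'n \<Rightarrow> real" and g assume u: "C1c u g"
    note [measurable] = C1cD(4,5)[OF u]
    let ?h = "\<lambda>x. \<bar>u x\<bar> powr s" and ?t = "\<lambda>x. s * \<bar>u x\<bar> powr (s - 1) * sgn (u x)"
    let ?dh = "\<lambda>x. ?t x *\<^sub>R g x"
    note h = C1c_abs_powr[OF u s]
    define W where "W k x = r 2 x powr (- \<kappa>) * r k x powr (- 1)" for k x
    have E: "integrable lborel (\<lambda>x. ?h x * W k x)"
      "integrable lborel (\<lambda>x. (trunc e k x \<bullet> ?dh x) * W k x)"
      "(LBINT x. (trunc e k x \<bullet> ?dh x) * W k x) = (\<kappa> + 1 - k) * (LBINT x. ?h x * W k x)"
      if k: "k \<in> {2..n}" for k
    proof -
      have m[measurable]: "W k \<in> borel_measurable borel" unfolding W_def by measurable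
      have hom: "W k (x + (l - 1) *\<^sub>R trunc e k x) = l powr (- (\<kappa> + 1)) * W k x" if "l > 0" for l x
      proof -
        have "l powr (- (\<kappa> + 1)) = l powr (- \<kappa>) * l powr (- 1)" by (simp only: powr_minus_Suc)
        then show ?thesis unfolding W_def using that k by (simp add: r_dilate powr_mult)
      qed
      have int: "integrable lborel (\<lambda>x. indicator (cball 0 R) x * W k x)" for R
      proof (rule Bochner_Integration.integrable_bound[OF integrable_r2[of "\<kappa> + 1" R]])
        show "AE x in lborel. norm (indicator (cball 0 R) x * W k x) \<le> norm (indicator (cball 0 R) x * r 2 x powr (- (\<kappa> + 1)))"
          using AE_nonzero
        proof eventually_elim
          case (elim x)
          have "0 < r 2 x" "r 2 x \<le> r k x" using r_pos[OF elim, of 2] n3 r_mono[of 2 k x] k by auto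
          then have "r k x powr (- 1) \<le> r 2 x powr (- 1)" by (intro powr_mono2') auto
          then have "W k x \<le> r 2 x powr (- \<kappa>) * r 2 x powr (- 1)" unfolding W_def by (intro mult_left_mono) auto
          also have "\<dots> = r 2 x powr (- (\<kappa> + 1))" by (simp only: powr_minus_Suc)
          finally show ?case by (auto simp: W_def split: split_indicator)
        qed
      qed (use \<kappa> in \<open>auto intro!: borel_measurable_times borel_measurable_indicator\<close>)
      show "integrable lborel (\<lambda>x. ?h x * W k x)"
        "integrable lborel (\<lambda>x. (trunc e k x \<bullet> ?dh x) * W k x)"
        "(LBINT x. (trunc e k x \<bullet> ?dh x) * W k x) = (\<kappa> + 1 - k) * (LBINT x. ?h x * W k x)"
        using Euler_identity[OF h _ m int hom] k by auto
    qed
    have W2: "?h x * W 2 x = r 2 x powr (- (\<kappa> + 1)) * \<bar>u x\<bar> powr s" for x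
    proof -
      have "r 2 x powr (- (\<kappa> + 1)) = r 2 x powr (- \<kappa>) * r 2 x powr (- 1)" by (simp only: powr_minus_Suc)
      then show ?thesis by (simp add: W_def)
    qed
    show i2: "integrable lborel (\<lambda>x. r 2 x powr (- (\<kappa> + 1)) * \<bar>u x\<bar> powr s)"
      using E(1)[of 2] n3 unfolding W2 by simp
    \<comment> \<open>\<open>?Z\<close> is the divergence of |u|^s times the combined field; its
      integral vanishes by the Euler identities.\<close>
    let ?Z = "\<lambda>x. \<Sum>k=2..n. c k * ((real k - 1 - \<kappa>) * (?h x * W k x) + (trunc e k x \<bullet> ?dh x) * W k x)"
    have Zint: "integrable lborel ?Z"
      by (intro Bochner_Integration.integrable_sum integrable_mult_right Bochner_Integration.integrable_add E)
    have Z0: "(LBINT x. ?Z x) = 0"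
    proof -
      have "(LBINT x. ?Z x) = (\<Sum>k=2..n. (LBINT x. c k * ((real k - 1 - \<kappa>) * (?h x * W k x) + (trunc e k x \<bullet> ?dh x) * W k x)))"
        by (intro Bochner_Integration.integral_sum integrable_mult_right Bochner_Integration.integrable_add E)
      also have "\<dots> = (\<Sum>k=2..n. 0)"
      proof (intro sum.cong refl)
        fix k assume k: "k \<in> {2..n}"
        have "(LBINT x. (real k - 1 - \<kappa>) * (?h x * W k x) + (trunc e k x \<bullet> ?dh x) * W k x)
          = (LBINT x. (real k - 1 - \<kappa>) * (?h x * W k x)) + (LBINT x. (trunc e k x \<bullet> ?dh x) * W k x)"
          by (intro Bochner_Integration.integral_add integrable_mult_right E k)
        also have "\<dots> = (real k - 1 - \<kappa>) * (LBINT x. ?h x * W k x) + (\<kappa> + 1 - k) * (LBINT x. ?h x * W k x)"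
          unfolding E(3)[OF k] by simp
        also have "\<dots> = 0" by (simp add: algebra_simps)
        finally show "(LBINT x. c k * ((real k - 1 - \<kappa>) * (?h x * W k x) + (trunc e k x \<bullet> ?dh x) * W k x)) = 0" by simp
      qed
      finally show ?thesis by simp
    qed
    have pw: "AE x in lborel. \<eta> * (r 2 x powr (- (\<kappa> + 1)) * \<bar>u x\<bar> powr s) \<le> ?Z x + K * gs_flux S \<kappa> s u g x"
      using AE_nonzero
    proof eventually_elim
      case (elim x)
      have pos: "r k x > 0" if "k \<in> {1..n}" for k using r_pos[OF elim that] .
      define G where "G = gs_grad S u g x"
      have tu: "?t x * u x = s * ?h x"
        by (cases "u x = 0") (auto simp: powr_diff sgn_if)
      \<comment> \<open>The gradient of |u|^s splits into a part bounded by the flux and a multiple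
        of \<open>gs_field\<close>; the latter is what \<open>key\<close> accounts for.\<close>
      have dh: "?dh x = ?t x *\<^sub>R G - (s * ?h x) *\<^sub>R gs_field S x"
        unfolding tu[symmetric] G_def by (simp add: scaleR_add_right)
      have H: "- gs_flux S \<kappa> s u g x \<le> (trunc e k x \<bullet> (?t x *\<^sub>R G)) * W k x" if k: "k \<in> {2..n}" for k
      proof -
        have pk: "r k x > 0" using pos k by simp
        have "\<bar>(trunc e k x \<bullet> (?t x *\<^sub>R G)) * W k x\<bar> = \<bar>?t x\<bar> * \<bar>trunc e k x \<bullet> G\<bar> * W k x"
          by (simp add: abs_mult W_def)
        also have "\<dots> \<le> (s * \<bar>u x\<bar> powr (s - 1)) * (r k x * norm G) * W k x"
          using s by (intro mult_right_mono mult_mono Cauchy_Schwarz_ineq2) (auto simp: W_def abs_mult sgn_if)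
        also have "\<dots> = gs_flux S \<kappa> s u g x"
          using pk by (simp add: W_def gs_flux_def G_def powr_minus_divide)
        finally show ?thesis by linarith
      qed
      have "\<eta> * (r 2 x powr (- (\<kappa> + 1)) * \<bar>u x\<bar> powr s) = (\<eta> / r 2 x) * (?h x * r 2 x powr (- \<kappa>))"
        unfolding W2[symmetric] using pos[of 2] n3 by (simp add: W_def mult_ac)
      also have "\<dots> \<le> (\<Sum>k=2..n. c k * ((real k - 1 - \<kappa>) - s * (trunc e k x \<bullet> gs_field S x)) / r k x) * (?h x * r 2 x powr (- \<kappa>))"
        by (intro mult_right_mono key elim) auto
      also have "\<dots> = (\<Sum>k=2..n. c k * (((real k - 1 - \<kappa>) - s * (trunc e k x \<bullet> gs_field S x)) * (?h x * W k x)))"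
        unfolding sum_distrib_right
      proof (intro sum.cong refl)
        fix k assume k: "k \<in> {2..n}"
        have "r k x > 0" using pos k by simp
        then show "c k * ((real k - 1 - \<kappa>) - s * (trunc e k x \<bullet> gs_field S x)) / r k x * (?h x * r 2 x powr (- \<kappa>)) =
          c k * (((real k - 1 - \<kappa>) - s * (trunc e k x \<bullet> gs_field S x)) * (?h x * W k x))"
          by (simp add: W_def mult_ac)
      qed
      also have "\<dots> \<le> (\<Sum>k=2..n. c k * (((real k - 1 - \<kappa>) * (?h x * W k x) + (trunc e k x \<bullet> ?dh x) * W k x) + gs_flux S \<kappa> s u g x))"
      proof (intro sum_mono mult_left_mono)
        fix k assume k: "k \<in> {2..n}"
        have "trunc e k x \<bullet> ?dh x = trunc e k x \<bullet> (?t x *\<^sub>R G) - s * ?h x * (trunc e k x \<bullet> gs_field S x)"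
          unfolding dh by (simp add: inner_diff_right)
        then have "(trunc e k x \<bullet> ?dh x) * W k x = (trunc e k x \<bullet> (?t x *\<^sub>R G)) * W k x - s * (trunc e k x \<bullet> gs_field S x) * (?h x * W k x)"
          by (simp only: left_diff_distrib) (simp only: mult_ac)
        then show "((real k - 1 - \<kappa>) - s * (trunc e k x \<bullet> gs_field S x)) * (?h x * W k x)
          \<le> ((real k - 1 - \<kappa>) * (?h x * W k x) + (trunc e k x \<bullet> ?dh x) * W k x) + gs_flux S \<kappa> s u g x"
          using H[OF k] by (simp only: left_diff_distrib)
        show "0 \<le> c k" using c(1)[of k] by simp
      qed
      also have "\<dots> = ?Z x + K * gs_flux S \<kappa> s u g x"
        by (simp only: distrib_left sum.distrib K_def sum_distrib_right)
      finally show ?case .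
    qed
    have "\<eta> * (LBINT x. r 2 x powr (- (\<kappa> + 1)) * \<bar>u x\<bar> powr s) = (LBINT x. \<eta> * (r 2 x powr (- (\<kappa> + 1)) * \<bar>u x\<bar> powr s))"
      by simp
    also have "\<dots> \<le> (LBINT x. ?Z x + K * gs_flux S \<kappa> s u g x)"
      by (intro integral_mono_AE pw integrable_mult_right i2 Bochner_Integration.integrable_add Zint integrable_gs_flux u \<kappa> s)
    also have "\<dots> = (LBINT x. ?Z x) + (LBINT x. K * gs_flux S \<kappa> s u g x)"
      by (intro Bochner_Integration.integral_add integrable_mult_right Zint integrable_gs_flux u \<kappa> s)
    also have "\<dots> = K * (LBINT x. gs_flux S \<kappa> s u g x)" unfolding Z0 by simp
    finally show "(LBINT x. r 2 x powr (- (\<kappa> + 1)) * \<bar>u x\<bar> powr s) \<le> K / \<eta> * (LBINT x. gs_flux S \<kappa> s u g x)"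
      using \<eta> by (simp add: field_simps)
  qed
qed

text \<open>In the gradient of |X_2|^(-\<kappa>) |u|^s, everything beyond the flux comes from
  \<open>gs_field\<close> and from differentiating the weight. Both parts are multiples of
  |X_2|^(-(\<kappa> + 1)) |u|^s, the integrand that the Hardy inequality controls.\<close>

lemma weighted_Gagliardo_Nirenberg:
  fixes S :: "nat \<Rightarrow> real"
  assumes u: "C1c u g" and \<kappa>: "0 \<le> \<kappa>" "\<kappa> < 1" and s: "s > 1" and D: "D > 0"
    and flux: "(LBINT x. gs_flux S \<kappa> s u g x) \<le> D"
    and hint: "integrable lborel (\<lambda>x. r 2 x powr (- (\<kappa> + 1)) * \<bar>u x\<bar> powr s)"
    and hardy: "(LBINT x. r 2 x powr (- (\<kappa> + 1)) * \<bar>u x\<bar> powr s) \<le> C * D" and C: "C \<ge> 0"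
  shows "(\<integral>\<^sup>+x. ennreal ((r 2 x powr (- \<kappa>) * \<bar>u x\<bar> powr s) powr (n / (real n - 1))) \<partial>lborel)
    \<le> ennreal ((n * ((1 + (s * (\<Sum>k=3..n. \<bar>S k - S (k - 1)\<bar>) + \<kappa>) * C) * D)) powr (n / (real n - 1)))"
proof -
  define \<Gamma> where "\<Gamma> = (\<Sum>k=3..n. \<bar>S k - S (k - 1)\<bar>)"
  have \<Gamma>0: "\<Gamma> \<ge> 0" by (simp add: \<Gamma>_def sum_nonneg)
  define K where "K = (1 + (s * \<Gamma> + \<kappa>) * C) * D"
  have K0: "K > 0" unfolding K_def using D C \<Gamma>0 s \<kappa> by (intro mult_pos_pos add_pos_nonneg mult_nonneg_nonneg add_nonneg_nonneg) auto
  let ?p = "n / (real n - 1)"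
  let ?h = "\<lambda>x. \<bar>u x\<bar> powr s" and ?dh = "\<lambda>x. (s * \<bar>u x\<bar> powr (s - 1) * sgn (u x)) *\<^sub>R g x"
  let ?w = "\<lambda>x. r 2 x powr (- (\<kappa> + 1)) * \<bar>u x\<bar> powr s"
  note [measurable] = C1cD(4,5)[OF u]
  note h = C1c_abs_powr[OF u s]
  define \<epsilon> where "\<epsilon> i = 1 / real (Suc i)" for i
  have \<epsilon>0: "\<epsilon> i \<noteq> 0" for i by (simp add: \<epsilon>_def)
  have \<epsilon>lim: "\<epsilon> \<longlonglongrightarrow> 0" unfolding \<epsilon>_def using LIMSEQ_inverse_real_of_nat by (simp add: inverse_eq_divide)
  define f where "f i x = ((r 2 x)\<^sup>2 + (\<epsilon> i)\<^sup>2) powr (- \<kappa> / 2) * ?h x" for i x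
  define df where "df i x = ((r 2 x)\<^sup>2 + (\<epsilon> i)\<^sup>2) powr (- \<kappa> / 2) *\<^sub>R ?dh x + (2 * (- \<kappa> / 2) * ((r 2 x)\<^sup>2 + (\<epsilon> i)\<^sup>2) powr (- \<kappa> / 2 - 1) * ?h x) *\<^sub>R trunc e 2 x" for i x
  have fC: "C1c (f i) (df i)" for i
    unfolding f_def[abs_def] df_def[abs_def] by (rule C1c_regularized[OF h \<epsilon>0])
  have le: "norm (df i x) \<le> gs_flux S \<kappa> s u g x + (s * \<Gamma> + \<kappa>) * ?w x" if x: "\<forall>i. x $ i \<noteq> 0" for i x
  proof -
    have p2: "r 2 x > 0" using r_pos[OF x, of 2] n3 by simp
    have r23: "r 2 x \<le> r 3 x" using r_mono[of 2 3 x] n3 by auto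
    have sq: "(r 2 x)\<^sup>2 powr q = r 2 x powr (2 * q)" for q
      using p2 by (simp add: powr_powr flip: powr_numeral)
    have b1: "((r 2 x)\<^sup>2 + (\<epsilon> i)\<^sup>2) powr q \<le> r 2 x powr (2 * q)" if "q \<le> 0" for q
      using powr_mono2'[OF that, of "(r 2 x)\<^sup>2" "(r 2 x)\<^sup>2 + (\<epsilon> i)\<^sup>2"] p2 sq[of q] by simp
    have "norm (g x) \<le> norm (gs_grad S u g x) + norm (u x *\<^sub>R gs_field S x)"
      using norm_triangle_ineq4[of "gs_grad S u g x" "u x *\<^sub>R gs_field S x"] by simp
    also have "norm (u x *\<^sub>R gs_field S x) \<le> \<bar>u x\<bar> * (\<Gamma> / r 2 x)"
    proof -
      have "norm (gs_field S x) \<le> \<Gamma> / r 3 x" using norm_gs_field_le[OF x] by (simp add: \<Gamma>_def)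
      also have "\<dots> \<le> \<Gamma> / r 2 x" using \<Gamma>0 r23 p2 by (intro divide_left_mono mult_pos_pos) auto
      finally show ?thesis unfolding norm_scaleR real_norm_def by (rule mult_left_mono) simp
    qed
    finally have ng: "norm (g x) \<le> norm (gs_grad S u g x) + \<bar>u x\<bar> * (\<Gamma> / r 2 x)" by simp
    have hu: "\<bar>u x\<bar> powr (s - 1) * \<bar>u x\<bar> = ?h x" by (cases "u x = 0") (auto simp: powr_diff)
    have nd: "norm (?dh x) \<le> s * \<bar>u x\<bar> powr (s - 1) * norm (g x)"
      using s by (auto simp: abs_mult sgn_if)
    have "norm (((r 2 x)\<^sup>2 + (\<epsilon> i)\<^sup>2) powr (- \<kappa> / 2) *\<^sub>R ?dh x) \<le> r 2 x powr (- \<kappa>) * (s * \<bar>u x\<bar> powr (s - 1) * norm (g x))"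
    proof -
      let ?A = "((r 2 x)\<^sup>2 + (\<epsilon> i)\<^sup>2) powr (- \<kappa> / 2)"
      have "norm (?A *\<^sub>R ?dh x) = ?A * norm (?dh x)" using norm_scaleR[of ?A "?dh x"] by (simp del: norm_scaleR)
      also have "\<dots> \<le> r 2 x powr (- \<kappa>) * (s * \<bar>u x\<bar> powr (s - 1) * norm (g x))"
        using b1[of "- \<kappa> / 2"] \<kappa> by (intro mult_mono nd) auto
      finally show ?thesis .
    qed
    also have "\<dots> \<le> r 2 x powr (- \<kappa>) * (s * \<bar>u x\<bar> powr (s - 1) * (norm (gs_grad S u g x) + \<bar>u x\<bar> * (\<Gamma> / r 2 x)))"
      using s ng by (intro mult_left_mono) auto
    also have "\<dots> = gs_flux S \<kappa> s u g x + s * \<Gamma> * (r 2 x powr (- \<kappa>) * r 2 x powr (- 1) * (\<bar>u x\<bar> powr (s - 1) * \<bar>u x\<bar>))"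
      using p2 by (simp add: gs_flux_def distrib_left powr_minus_divide)
    also have "\<dots> = gs_flux S \<kappa> s u g x + s * \<Gamma> * ?w x"
      unfolding hu powr_minus_Suc by (simp only: mult.assoc)
    finally have 1: "norm (((r 2 x)\<^sup>2 + (\<epsilon> i)\<^sup>2) powr (- \<kappa> / 2) *\<^sub>R ?dh x) \<le> gs_flux S \<kappa> s u g x + s * \<Gamma> * ?w x" .
    have "norm ((2 * (- \<kappa> / 2) * ((r 2 x)\<^sup>2 + (\<epsilon> i)\<^sup>2) powr (- \<kappa> / 2 - 1) * ?h x) *\<^sub>R trunc e 2 x)
      = \<kappa> * (((r 2 x)\<^sup>2 + (\<epsilon> i)\<^sup>2) powr (- \<kappa> / 2 - 1) * r 2 x) * ?h x"
      using \<kappa> by (simp add: abs_mult)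
    also have "\<dots> \<le> \<kappa> * (r 2 x powr (2 * (- \<kappa> / 2 - 1)) * r 2 x powr 1) * ?h x"
      using b1[of "- \<kappa> / 2 - 1"] \<kappa> p2 by (intro mult_right_mono mult_left_mono) auto
    also have "r 2 x powr (2 * (- \<kappa> / 2 - 1)) * r 2 x powr 1 = r 2 x powr (- (\<kappa> + 1))"
    proof -
      have "2 * (- \<kappa> / 2 - 1) + 1 = - (\<kappa> + 1)" by (simp add: field_simps)
      then show ?thesis by (simp only: powr_add[symmetric])
    qed
    finally have 2: "norm ((2 * (- \<kappa> / 2) * ((r 2 x)\<^sup>2 + (\<epsilon> i)\<^sup>2) powr (- \<kappa> / 2 - 1) * ?h x) *\<^sub>R trunc e 2 x) \<le> \<kappa> * ?w x"
      by (simp only: mult.assoc)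
    have "norm (df i x) \<le> (gs_flux S \<kappa> s u g x + s * \<Gamma> * ?w x) + \<kappa> * ?w x"
      unfolding df_def by (rule order_trans[OF norm_triangle_ineq add_mono[OF 1 2]])
    then show ?thesis by (simp only: distrib_right add.assoc)
  qed
  have w0: "?w x \<ge> 0" for x by simp
  have H0: "gs_flux S \<kappa> s u g x \<ge> 0" for x using s by (simp add: gs_flux_def)
  have Kb: "(\<integral>\<^sup>+x. ennreal (norm (df i x)) \<partial>lborel) \<le> ennreal K" for i
  proof -
    have "(\<integral>\<^sup>+x. ennreal (norm (df i x)) \<partial>lborel) \<le> (\<integral>\<^sup>+x. ennreal (gs_flux S \<kappa> s u g x + (s * \<Gamma> + \<kappa>) * ?w x) \<partial>lborel)"
      by (rule nn_integral_mono_AE, rule AE_mp[OF AE_nonzero], rule AE_I2) (use le in \<open>auto intro!: ennreal_leI\<close>)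
    also have "\<dots> = ennreal (LBINT x. gs_flux S \<kappa> s u g x + (s * \<Gamma> + \<kappa>) * ?w x)"
    proof (rule nn_integral_eq_integral)
      show "integrable lborel (\<lambda>x. gs_flux S \<kappa> s u g x + (s * \<Gamma> + \<kappa>) * ?w x)"
        by (intro Bochner_Integration.integrable_add integrable_mult_right hint integrable_gs_flux u \<kappa> s)
      show "AE x in lborel. 0 \<le> gs_flux S \<kappa> s u g x + (s * \<Gamma> + \<kappa>) * ?w x"
        using H0 w0 \<Gamma>0 s \<kappa> by (intro AE_I2 add_nonneg_nonneg mult_nonneg_nonneg) auto
    qed
    also have "(LBINT x. gs_flux S \<kappa> s u g x + (s * \<Gamma> + \<kappa>) * ?w x) = (LBINT x. gs_flux S \<kappa> s u g x) + (LBINT x. (s * \<Gamma> + \<kappa>) * ?w x)"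
      by (intro Bochner_Integration.integral_add integrable_mult_right hint integrable_gs_flux u \<kappa> s)
    also have "(LBINT x. (s * \<Gamma> + \<kappa>) * ?w x) = (s * \<Gamma> + \<kappa>) * (LBINT x. ?w x)"
      by (rule Bochner_Integration.integral_mult_right_zero)
    also have "(LBINT x. gs_flux S \<kappa> s u g x) + (s * \<Gamma> + \<kappa>) * (LBINT x. ?w x) \<le> D + (s * \<Gamma> + \<kappa>) * (C * D)"
      using \<Gamma>0 s \<kappa> by (intro add_mono flux mult_left_mono hardy) auto
    also have "\<dots> = K" by (simp add: K_def algebra_simps)
    finally show ?thesis by (simp add: ennreal_leI)
  qed
  have GN: "(\<integral>\<^sup>+x. ennreal (\<bar>f i x\<bar> powr ?p) \<partial>lborel) \<le> ennreal ((n * K) powr ?p)" for i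
    using Gagliardo_Nirenberg_L1[OF fC _ K0 Kb, of i] n3 unfolding DIM_eq by simp
  have [measurable]: "f i \<in> borel_measurable borel" for i using C1cD(4)[OF fC] .
  \<comment> \<open>The bound for the regularized functions is uniform in \<epsilon>, so Fatou's
    lemma carries it to the singular weight.\<close>
  have "(\<integral>\<^sup>+x. ennreal ((r 2 x powr (- \<kappa>) * ?h x) powr ?p) \<partial>lborel) = (\<integral>\<^sup>+x. liminf (\<lambda>i. ennreal (\<bar>f i x\<bar> powr ?p)) \<partial>lborel)"
  proof (rule nn_integral_cong_AE, rule AE_mp[OF AE_nonzero], intro AE_I2 impI)
    fix x :: "real ^ 'n" assume x: "\<forall>i. x $ i \<noteq> 0"
    have p2: "r 2 x > 0" using r_pos[OF x, of 2] n3 by simp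
    have "(\<lambda>i. ((r 2 x)\<^sup>2 + (\<epsilon> i)\<^sup>2) powr (- \<kappa> / 2)) \<longlonglongrightarrow> ((r 2 x)\<^sup>2 + 0\<^sup>2) powr (- \<kappa> / 2)"
      using p2 by (intro tendsto_intros \<epsilon>lim) auto
    moreover have "((r 2 x)\<^sup>2 + 0\<^sup>2) powr (- \<kappa> / 2) = r 2 x powr (- \<kappa>)"
      using p2 by (simp add: powr_powr flip: powr_numeral)
    ultimately have "(\<lambda>i. ((r 2 x)\<^sup>2 + (\<epsilon> i)\<^sup>2) powr (- \<kappa> / 2)) \<longlonglongrightarrow> r 2 x powr (- \<kappa>)" by simp
    then have "(\<lambda>i. \<bar>f i x\<bar>) \<longlonglongrightarrow> \<bar>r 2 x powr (- \<kappa>) * ?h x\<bar>"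
      unfolding f_def by (intro tendsto_rabs tendsto_mult[OF _ tendsto_const])
    then have "(\<lambda>i. \<bar>f i x\<bar> powr ?p) \<longlonglongrightarrow> (r 2 x powr (- \<kappa>) * ?h x) powr ?p"
      using n3 by (intro tendsto_powr') auto
    then have "(\<lambda>i. ennreal (\<bar>f i x\<bar> powr ?p)) \<longlonglongrightarrow> ennreal ((r 2 x powr (- \<kappa>) * ?h x) powr ?p)"
      by (rule tendsto_ennrealI)
    from lim_imp_Liminf[OF _ this]
    show "ennreal ((r 2 x powr (- \<kappa>) * ?h x) powr ?p) = liminf (\<lambda>i. ennreal (\<bar>f i x\<bar> powr ?p))" by simp
  qed
  also have "\<dots> \<le> liminf (\<lambda>i. \<integral>\<^sup>+x. ennreal (\<bar>f i x\<bar> powr ?p) \<partial>lborel)"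
    by (rule nn_integral_liminf) measurable
  also have "\<dots> \<le> liminf (\<lambda>i. ennreal ((n * K) powr ?p))"
    by (intro Liminf_mono always_eventually allI GN)
  also have "\<dots> = ennreal ((n * K) powr ?p)" by (simp add: Liminf_const)
  finally show ?thesis unfolding K_def \<Gamma>_def .
qed

lemma integrable_r2_powr_u:
  assumes u: "C1c u g" and a: "0 \<le> a" "a < 2" and q: "0 \<le> q"
  shows "integrable lborel (\<lambda>x. r 2 x powr (- a) * \<bar>u x\<bar> powr q)"
proof -
  obtain R M where R: "R > 0" "M > 0" "\<And>x. norm x > R \<Longrightarrow> u x = 0" "\<And>x. norm x > R \<Longrightarrow> g x = 0"
    "\<And>x. \<bar>u x\<bar> \<le> M" "\<And>x. norm (g x) \<le> M" using C1c_bound[OF u] by metis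
  note [measurable] = C1cD(4)[OF u]
  show ?thesis
  proof (rule Bochner_Integration.integrable_bound)
    show "integrable lborel (\<lambda>x. M powr q * (indicator (cball 0 R) x * r 2 x powr (- a)))"
      by (intro integrable_mult_right integrable_r2 a)
    show "(\<lambda>x. r 2 x powr (- a) * \<bar>u x\<bar> powr q) \<in> borel_measurable lborel" by measurable
    show "AE x in lborel. norm (r 2 x powr (- a) * \<bar>u x\<bar> powr q) \<le> norm (M powr q * (indicator (cball 0 R) x * r 2 x powr (- a)))"
    proof (rule AE_I2)
      fix x
      have "\<bar>u x\<bar> powr q \<le> M powr q * indicator (cball 0 R) x"
        using R(3)[of x] R(5)[of x] q by (auto intro!: powr_mono2 split: split_indicator)
      from mult_right_mono[OF this, of "r 2 x powr (- a)"]
      show "norm (r 2 x powr (- a) * \<bar>u x\<bar> powr q) \<le> norm (M powr q * (indicator (cball 0 R) x * r 2 x powr (- a)))"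
        using R by (simp add: abs_mult mult_ac)
    qed
  qed
qed

text \<open>As s - 1 = Q / 2, the flux is s times the geometric mean of |X_2|^(-2\<kappa>) |u|^Q and
  the energy density.\<close>

lemma gs_flux_Cauchy_Schwarz:
  assumes u: "C1c u g" and \<kappa>: "0 \<le> \<kappa>" "\<kappa> < 1" and s: "s = Q / 2 + 1" and Q: "Q > 0"
    and N: "N > 0" "(LBINT x. r 2 x powr (- (2 * \<kappa>)) * \<bar>u x\<bar> powr Q) \<le> N"
    and Eint: "integrable lborel (\<lambda>x. (norm (gs_grad S u g x))\<^sup>2)"
    and E: "E > 0" "(LBINT x. (norm (gs_grad S u g x))\<^sup>2) \<le> E"
  shows "(LBINT x. gs_flux S \<kappa> s u g x) \<le> s * (N powr (1/2) * E powr (1/2))"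
proof -
  note [measurable] = C1cD(4,5)[OF u]
  have s1: "s > 1" using s Q by simp
  let ?A = "\<lambda>x. r 2 x powr (- (2 * \<kappa>)) * \<bar>u x\<bar> powr Q"
  let ?B = "\<lambda>x. (norm (gs_grad S u g x))\<^sup>2"
  have eq: "gs_flux S \<kappa> s u g x = s * (?A x powr (1/2) * ?B x powr (1/2))" for x
  proof -
    have "?B x powr (1/2) = norm (gs_grad S u g x)"
      by (simp add: powr_half_sqrt)
    moreover have "?A x powr (1/2) = r 2 x powr (- \<kappa>) * \<bar>u x\<bar> powr (Q / 2)"
      by (simp add: powr_mult powr_powr)
    ultimately show ?thesis using s by (simp add: gs_flux_def)
  qed
  have "(\<integral>\<^sup>+x. ennreal (?A x powr (1/2) * ?B x powr (1/2)) \<partial>lborel) \<le> ennreal (N powr (1/2) * E powr (1/2))"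
  proof (rule nn_integral_Hoelder_powr)
    have "(\<integral>\<^sup>+x. ennreal (?A x) \<partial>lborel) = ennreal (LBINT x. ?A x)"
      using \<kappa> Q by (intro nn_integral_eq_integral integrable_r2_powr_u[OF u]) auto
    then show "(\<integral>\<^sup>+x. ennreal (?A x) \<partial>lborel) \<le> ennreal N" using N by (simp add: ennreal_leI)
    have "(\<integral>\<^sup>+x. ennreal (?B x) \<partial>lborel) = ennreal (LBINT x. ?B x)"
      by (intro nn_integral_eq_integral Eint) auto
    then show "(\<integral>\<^sup>+x. ennreal (?B x) \<partial>lborel) \<le> ennreal E" using E by (simp add: ennreal_leI)
  qed (use N E in auto)
  then have "ennreal s * (\<integral>\<^sup>+x. ennreal (?A x powr (1/2) * ?B x powr (1/2)) \<partial>lborel) \<le> ennreal s * ennreal (N powr (1/2) * E powr (1/2))"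
    by (rule mult_left_mono) simp
  moreover have "ennreal s * (\<integral>\<^sup>+x. ennreal (?A x powr (1/2) * ?B x powr (1/2)) \<partial>lborel) = (\<integral>\<^sup>+x. ennreal (gs_flux S \<kappa> s u g x) \<partial>lborel)"
    unfolding eq using s1 by (subst nn_integral_cmult[symmetric]) (auto simp: ennreal_mult)
  moreover have "(\<integral>\<^sup>+x. ennreal (gs_flux S \<kappa> s u g x) \<partial>lborel) = ennreal (LBINT x. gs_flux S \<kappa> s u g x)"
    using s1 by (intro nn_integral_eq_integral integrable_gs_flux u \<kappa> AE_I2) (auto simp: gs_flux_def)
  moreover have "ennreal s * ennreal (N powr (1/2) * E powr (1/2)) = ennreal (s * (N powr (1/2) * E powr (1/2)))"
    using s1 by (simp add: ennreal_mult)
  ultimately show ?thesis using s1 N E by (simp add: ennreal_le_iff)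
qed

text \<open>Interpolation bounds N, the weighted integral of |u|^Q, by a power of the flux, and the
  flux is at most s (N E)^(1/2). Hence N <= C0 (N E)^(q/2) with q/2 = Q/(Q + 2) < 1: a power of N
  can be divided out, and 2/Q is the exponent that makes E linear.\<close>

proposition weighted_Sobolev:
  assumes S2: "S 2 = 0" and Q: "Q > 2" "Q \<le> 2 * real n / (real n - 2)"
    and \<kappa>_def: "\<kappa> = 1 - (Q - 2) * (real n - 2) / 4"
    and sub: "\<And>k. k \<in> {2..n} \<Longrightarrow> \<kappa> + (Q / 2 + 1) * S k < real k - 1"
  shows "\<exists>C>0. \<forall>u g. C1c u g \<longrightarrow> integrable lborel (\<lambda>x. (norm (gs_grad S u g x))\<^sup>2) \<longrightarrow>
    C * (LBINT x. r 2 x powr (- (2 * \<kappa>)) * \<bar>u x\<bar> powr Q) powr (2 / Q) \<le> (LBINT x. (norm (gs_grad S u g x))\<^sup>2)"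
proof -
  define m where "m = real n"
  have m3: "m \<ge> 3" using n3 by (simp add: m_def)
  have Qm: "Q * (m - 2) \<le> 2 * m" using Q m3 by (simp add: m_def field_simps)
  define s where "s = Q / 2 + 1"
  have s1: "s > 1" using Q by (simp add: s_def)
  have "(Q - 2) * (m - 2) \<le> 4" using Qm by (simp add: algebra_simps)
  then have \<kappa>0: "0 \<le> \<kappa>" by (simp add: \<kappa>_def m_def)
  have "(Q - 2) * (m - 2) > 0" using Q m3 by (intro mult_pos_pos) auto
  then have \<kappa>1: "\<kappa> < 1" by (simp add: \<kappa>_def m_def)
  define p where "p = m / (m - 1)"
  \<comment> \<open>Solution of \<theta> + p (1 - \<theta>) = Q / s, which matches the powers of
    |u|. The matching of the powers of |X_2| requires \<theta> = \<kappa> (2 - q), and the value of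
    \<kappa> is exactly the one for which both agree. At Q = 2n/(n - 2) both \<kappa> and \<theta>
    vanish.\<close>
  define \<theta> where "\<theta> = (2 * m + 2 * Q - m * Q) / (Q + 2)"
  have Q2: "Q + 2 > 0" using Q by simp
  have \<theta>0: "0 \<le> \<theta>" unfolding \<theta>_def using Qm Q by (intro divide_nonneg_pos) (auto simp: algebra_simps)
  have th1: "1 - \<theta> = (m - 1) * (Q - 2) / (Q + 2)" using Q by (simp add: \<theta>_def field_simps)
  have \<theta>1: "0 \<le> 1 - \<theta>" unfolding th1 using Q m3 by (intro divide_nonneg_pos mult_nonneg_nonneg) auto
  have pth: "p * (1 - \<theta>) = m * (Q - 2) / (Q + 2)" unfolding th1 p_def using m3 by simp
  define q where "q = 2 * Q / (Q + 2)"
  have thq: "\<theta> + p * (1 - \<theta>) = q"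
  proof -
    have "\<theta> + p * (1 - \<theta>) = (2 * m + 2 * Q - m * Q + m * (Q - 2)) / (Q + 2)"
      by (simp only: pth add_divide_distrib) (simp only: \<theta>_def)
    also have "2 * m + 2 * Q - m * Q + m * (Q - 2) = 2 * Q" by (simp add: algebra_simps)
    finally show ?thesis by (simp add: q_def)
  qed
  have q_half: "q / 2 = Q / (Q + 2)" unfolding q_def using Q by (simp add: divide_simps)
  have e1: "s * \<theta> + s * (p * (1 - \<theta>)) = Q"
    unfolding distrib_left[symmetric] thq s_def q_def using Q by (simp add: field_simps)
  have e2: "- (\<kappa> + 1) * \<theta> + - \<kappa> * (p * (1 - \<theta>)) = - (2 * \<kappa>)"
  proof -
    define P where "P = p * (1 - \<theta>)"
    have "- (\<kappa> + 1) * \<theta> + - \<kappa> * P = - \<theta> - \<kappa> * (\<theta> + P)" by (simp add: algebra_simps)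
    then have "- (\<kappa> + 1) * \<theta> + - \<kappa> * (p * (1 - \<theta>)) = - \<theta> - \<kappa> * q"
      by (simp only: P_def thq)
    moreover have "\<theta> = \<kappa> * (2 - q)"
    proof -
      have "2 - q = 4 / (Q + 2)" using Q by (simp add: q_def field_simps)
      moreover have "\<kappa> * 4 = 2 * m + 2 * Q - m * Q" by (simp add: \<kappa>_def m_def field_simps)
      ultimately show ?thesis by (simp add: \<theta>_def)
    qed
    ultimately show ?thesis by (simp only:) (simp add: algebra_simps)
  qed
  obtain Ch where Ch: "Ch > 0" and hardy: "\<And>u g. C1c u g \<Longrightarrow>
    integrable lborel (\<lambda>x. r 2 x powr (- (\<kappa> + 1)) * \<bar>u x\<bar> powr s) \<and>
    (LBINT x. r 2 x powr (- (\<kappa> + 1)) * \<bar>u x\<bar> powr s) \<le> Ch * (LBINT x. gs_flux S \<kappa> s u g x)"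
    using L1_Hardy[of S \<kappa> s, OF S2 \<kappa>0 \<kappa>1 s1] sub unfolding s_def by blast
  define CG where "CG = m * (1 + (s * (\<Sum>k=3..n. \<bar>S k - S (k - 1)\<bar>) + \<kappa>) * Ch)"
  have CG: "CG > 0" unfolding CG_def using m3 s1 \<kappa>0 Ch
    by (intro mult_pos_pos add_pos_nonneg mult_nonneg_nonneg add_nonneg_nonneg sum_nonneg) auto
  define C0 where "C0 = Ch powr \<theta> * CG powr (p * (1 - \<theta>)) * s powr q"
  have C0: "C0 > 0" unfolding C0_def using Ch CG s1 by simp
  define C1 where "C1 = C0 powr ((Q + 2) / Q)"
  have C1: "C1 > 0" unfolding C1_def using C0 by simp
  show ?thesis
  proof (intro exI[of _ "1 / C1"] conjI allI impI)
    show "1 / C1 > 0" using C1 by simp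
    fix u :: "real ^ 'n \<Rightarrow> real" and g
    assume u: "C1c u g" and Eint: "integrable lborel (\<lambda>x. (norm (gs_grad S u g x))\<^sup>2)"
    note [measurable] = C1cD(4,5)[OF u]
    define N where "N = (LBINT x. r 2 x powr (- (2 * \<kappa>)) * \<bar>u x\<bar> powr Q)"
    define E where "E = (LBINT x. (norm (gs_grad S u g x))\<^sup>2)"
    have E0: "E \<ge> 0" by (simp add: E_def)
    have N0: "N \<ge> 0" by (simp add: N_def)
    have "1 / C1 * N powr (2 / Q) \<le> E"
    proof (cases "N = 0")
      case True
      then show ?thesis using E0 by simp
    next
      case False
      then have Npos: "N > 0" using N0 by simp
      \<comment> \<open>The Hoelder bounds have to be positive, and E is not yet known to be so; a
        number slightly above E is used and then lowered to E.\<close>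
      have "1 / C1 * N powr (2 / Q) \<le> E'" if E': "E < E'" for E'
      proof -
        have E'0: "E' > 0" using E' E0 by simp
        define D where "D = s * (N powr (1/2) * E' powr (1/2))"
        have D0: "D > 0" unfolding D_def using s1 Npos E'0 by simp
        have fl: "(LBINT x. gs_flux S \<kappa> s u g x) \<le> D"
          unfolding D_def using Q Npos E'0 E' Eint
          by (intro gs_flux_Cauchy_Schwarz[where Q = Q] u \<kappa>0 \<kappa>1 s_def) (auto simp: N_def E_def)
        have ha: "(LBINT x. r 2 x powr (- (\<kappa> + 1)) * \<bar>u x\<bar> powr s) \<le> Ch * D"
          using order_trans[OF conjunct2[OF hardy[OF u]] mult_left_mono[OF fl, of Ch]] Ch by auto
        have hint: "integrable lborel (\<lambda>x. r 2 x powr (- (\<kappa> + 1)) * \<bar>u x\<bar> powr s)" using hardy[OF u] by auto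
        have GN: "(\<integral>\<^sup>+x. ennreal ((r 2 x powr (- \<kappa>) * \<bar>u x\<bar> powr s) powr p) \<partial>lborel) \<le> ennreal ((CG * D) powr p)"
          using weighted_Gagliardo_Nirenberg[OF u \<kappa>0 \<kappa>1 s1 D0 fl hint ha] Ch
          by (simp add: p_def m_def CG_def mult.assoc)
        have w1: "(\<integral>\<^sup>+x. ennreal (r 2 x powr (- (\<kappa> + 1)) * \<bar>u x\<bar> powr s) \<partial>lborel) \<le> ennreal (Ch * D)"
        proof -
          have "(\<integral>\<^sup>+x. ennreal (r 2 x powr (- (\<kappa> + 1)) * \<bar>u x\<bar> powr s) \<partial>lborel) = ennreal (LBINT x. r 2 x powr (- (\<kappa> + 1)) * \<bar>u x\<bar> powr s)"
            by (intro nn_integral_eq_integral hint) auto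
          then show ?thesis using ha by (simp add: ennreal_leI)
        qed
        have pw: "r 2 x powr (- (2 * \<kappa>)) * \<bar>u x\<bar> powr Q
          = (r 2 x powr (- (\<kappa> + 1)) * \<bar>u x\<bar> powr s) powr \<theta> * ((r 2 x powr (- \<kappa>) * \<bar>u x\<bar> powr s) powr p) powr (1 - \<theta>)" for x
        proof -
          have "(r 2 x powr (- (\<kappa> + 1)) * \<bar>u x\<bar> powr s) powr \<theta> * ((r 2 x powr (- \<kappa>) * \<bar>u x\<bar> powr s) powr p) powr (1 - \<theta>)
            = (r 2 x powr (- (\<kappa> + 1) * \<theta>) * r 2 x powr (- \<kappa> * (p * (1 - \<theta>)))) * (\<bar>u x\<bar> powr (s * \<theta>) * \<bar>u x\<bar> powr (s * (p * (1 - \<theta>))))"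
            by (simp add: powr_mult powr_powr mult_ac)
          also have "\<dots> = r 2 x powr (- (2 * \<kappa>)) * \<bar>u x\<bar> powr Q"
            unfolding powr_add[symmetric] e1 e2 ..
          finally show ?thesis ..
        qed
        have "ennreal N = (\<integral>\<^sup>+x. ennreal (r 2 x powr (- (2 * \<kappa>)) * \<bar>u x\<bar> powr Q) \<partial>lborel)"
          unfolding N_def using \<kappa>0 \<kappa>1 Q
          by (intro nn_integral_eq_integral[symmetric] integrable_r2_powr_u[OF u]) auto
        also have "\<dots> \<le> ennreal ((Ch * D) powr \<theta> * ((CG * D) powr p) powr (1 - \<theta>))"
          unfolding pw using \<theta>0 \<theta>1 Ch D0 CG by (intro nn_integral_Hoelder_powr GN w1) auto
        finally have "N \<le> (Ch * D) powr \<theta> * ((CG * D) powr p) powr (1 - \<theta>)"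
          by (simp add: ennreal_le_iff)
        also have "\<dots> = Ch powr \<theta> * CG powr (p * (1 - \<theta>)) * (D powr \<theta> * D powr (p * (1 - \<theta>)))"
          using Ch CG D0 by (simp add: powr_mult powr_powr mult_ac)
        also have "D powr \<theta> * D powr (p * (1 - \<theta>)) = D powr q" unfolding powr_add[symmetric] thq ..
        also have "D powr q = s powr q * (N powr (q / 2) * E' powr (q / 2))"
          unfolding D_def using s1 Npos E'0 by (simp add: powr_mult powr_powr)
        finally have le: "N \<le> C0 * (N powr (q / 2) * E' powr (q / 2))"
          by (simp add: C0_def mult_ac)
        have N1: "N = N powr (q / 2) * N powr (2 / (Q + 2))"
        proof -
          have "q / 2 + 2 / (Q + 2) = 1" unfolding q_half add_divide_distrib[symmetric] using Q by simp
          then show ?thesis using Npos by (simp flip: powr_add)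
        qed
        have "N powr (q / 2) * N powr (2 / (Q + 2)) \<le> N powr (q / 2) * (C0 * E' powr (q / 2))"
          using le N1 by (simp add: mult_ac)
        then have "N powr (2 / (Q + 2)) \<le> C0 * E' powr (q / 2)"
          using Npos by (subst (asm) mult_le_cancel_left_pos) auto
        then have "(N powr (2 / (Q + 2))) powr ((Q + 2) / Q) \<le> (C0 * E' powr (q / 2)) powr ((Q + 2) / Q)"
          using Q by (intro powr_mono2) auto
        also have "(N powr (2 / (Q + 2))) powr ((Q + 2) / Q) = N powr (2 / Q)"
        proof -
          have "2 / (Q + 2) * ((Q + 2) / Q) = 2 / Q" using Q by (simp add: divide_simps)
          then show ?thesis by (simp only: powr_powr)
        qed
        also have "(C0 * E' powr (q / 2)) powr ((Q + 2) / Q) = C1 * E'"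
        proof -
          have "q / 2 * ((Q + 2) / Q) = 1" unfolding q_half using Q by simp
          then have "(E' powr (q / 2)) powr ((Q + 2) / Q) = E'" using E'0 by (simp only: powr_powr) simp
          then show ?thesis using C0 by (simp add: powr_mult C1_def)
        qed
        finally show ?thesis using C1 by (simp add: field_simps)
      qed
      then show ?thesis by (rule dense_ge)
    qed
    then show "1 / C1 * (LBINT x. r 2 x powr (- (2 * \<kappa>)) * \<bar>u x\<bar> powr Q) powr (2 / Q)
      \<le> (LBINT x. (norm (gs_grad S u g x))\<^sup>2)"
      unfolding N_def E_def .
  qed
qed

end

section \<open>Smooth functions\<close>

lemma C_diff_SucD: "C_diff (Suc k) f \<Longrightarrow> C_diff k f"
proof (induction k arbitrary: f)
  case 0
  then show ?case
    by (auto simp: continuous_on_eq_continuous_at intro: differentiable_imp_continuous_within)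
next
  case (Suc k)
  then show ?case by simp
qed

lemma frechet_derivative_eq:
  assumes "(f has_derivative D) (at x)"
  shows "frechet_derivative f (at x) = D"
  using frechet_derivative_at[OF assms] by simp

lemma C_diff_const: "C_diff k (\<lambda>x. c)"
proof (induction k arbitrary: c)
  case (Suc k)
  have "frechet_derivative (\<lambda>x::'a. c) (at x) = (\<lambda>v. 0)" for x :: 'a
    by (rule frechet_derivative_eq) simp
  then show ?case using Suc by simp
qed simp

lemma C_diff_bounded_linear:
  assumes f: "bounded_linear f" shows "C_diff k f"
proof (cases k)
  case 0
  then show ?thesis using linear_continuous_on[OF f] by simp
next
  case (Suc j)
  have d: "(f has_derivative f) (at x)" for x by (rule bounded_linear_imp_has_derivative[OF f])
  have "frechet_derivative f (at x) = f" for x by (rule frechet_derivative_eq[OF d])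
  then show ?thesis using Suc d C_diff_const by (auto simp: differentiable_def)
qed

lemma has_frechet_derivative:
  "f differentiable (at x) \<Longrightarrow> (f has_derivative frechet_derivative f (at x)) (at x)"
  by (simp add: frechet_derivative_works)

lemma C_diff_add: "C_diff k f \<Longrightarrow> C_diff k g \<Longrightarrow> C_diff k (\<lambda>x. f x + g x)"
proof (induction k arbitrary: f g)
  case 0
  then show ?case by (auto intro: continuous_on_add)
next
  case (Suc k)
  have d: "((\<lambda>x. f x + g x) has_derivative (\<lambda>v. frechet_derivative f (at x) v + frechet_derivative g (at x) v)) (at x)" for x
    using Suc.prems by (intro has_derivative_add has_frechet_derivative) auto
  have eq: "frechet_derivative (\<lambda>x. f x + g x) (at x) v = frechet_derivative f (at x) v + frechet_derivative g (at x) v" for x v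
    by (simp only: frechet_derivative_eq[OF d])
  have "C_diff k (\<lambda>x. frechet_derivative f (at x) v + frechet_derivative g (at x) v)" for v
    using Suc.prems by (intro Suc.IH) auto
  then show ?case using d by (auto simp: differentiable_def eq)
qed

lemma C_diff_mult: "C_diff k f \<Longrightarrow> C_diff k g \<Longrightarrow> C_diff k (\<lambda>x. f x * g x)"
proof (induction k arbitrary: f g)
  case 0
  then show ?case by (auto intro: continuous_on_mult)
next
  case (Suc k)
  have d: "((\<lambda>x. f x * g x) has_derivative (\<lambda>v. f x * frechet_derivative g (at x) v + frechet_derivative f (at x) v * g x)) (at x)" for x
    using Suc.prems by (intro has_derivative_mult has_frechet_derivative) auto
  have eq: "frechet_derivative (\<lambda>x. f x * g x) (at x) v = f x * frechet_derivative g (at x) v + frechet_derivative f (at x) v * g x" for x v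
    by (simp only: frechet_derivative_eq[OF d])
  have "C_diff k (\<lambda>x. f x * frechet_derivative g (at x) v + frechet_derivative f (at x) v * g x)" for v
    using Suc.prems C_diff_SucD[of k f] C_diff_SucD[of k g] by (intro C_diff_add Suc.IH) auto
  then show ?case using d by (auto simp: differentiable_def eq)
qed

lemma C_diff_prod:
  assumes "finite A" "\<And>i. i \<in> A \<Longrightarrow> C_diff k (f i)"
  shows "C_diff k (\<lambda>x. \<Prod>i\<in>A. f i x)"
  using assms by (induction A rule: finite_induct) (auto intro: C_diff_mult C_diff_const)

lemma C_diff_sum:
  assumes "finite A" "\<And>i. i \<in> A \<Longrightarrow> C_diff k (f i)"
  shows "C_diff k (\<lambda>x. \<Sum>i\<in>A. f i x)"
  using assms by (induction A rule: finite_induct) (auto intro: C_diff_add C_diff_const)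

text \<open>The whole sequence of derivatives of the outer function is given in advance. Then j can
  vary in the induction on k, and each step costs one chain rule and one product rule, with no
  formula for higher derivatives of a composition.\<close>

lemma C_diff_compose:
  fixes \<phi> :: "nat \<Rightarrow> real \<Rightarrow> real"
  assumes \<phi>: "\<And>j t. t \<in> S \<Longrightarrow> DERIV (\<phi> j) t :> \<phi> (Suc j) t"
  shows "C_diff k f \<Longrightarrow> (\<And>x. f x \<in> S) \<Longrightarrow> C_diff k (\<lambda>x. \<phi> j (f x))"
proof (induction k arbitrary: j)
  case 0
  have "isCont (\<phi> j) (f x)" for x using \<phi>[OF 0(2)] by (rule DERIV_isCont)
  then show ?case using 0 by (auto simp: continuous_on_eq_continuous_at intro: isCont_o2)
next
  case (Suc k)
  have d: "((\<lambda>x. \<phi> j (f x)) has_derivative (\<lambda>v. \<phi> (Suc j) (f x) * frechet_derivative f (at x) v)) (at x)" for x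
    using Suc.prems \<phi>[OF Suc.prems(2), of j x, unfolded has_field_derivative_def]
    by (intro has_derivative_compose[of f _ x UNIV "\<phi> j"] has_frechet_derivative) auto
  have eq: "frechet_derivative (\<lambda>x. \<phi> j (f x)) (at x) v = \<phi> (Suc j) (f x) * frechet_derivative f (at x) v" for x v
    by (simp only: frechet_derivative_eq[OF d])
  have "C_diff k (\<lambda>x. \<phi> (Suc j) (f x) * frechet_derivative f (at x) v)" for v
    using Suc.prems C_diff_SucD[of k f] by (intro C_diff_mult Suc.IH) auto
  then show ?case using d by (auto simp: differentiable_def eq)
qed

lemma C_diff_powr:
  assumes "C_diff k f" "\<And>x. f x > 0"
  shows "C_diff k (\<lambda>x. f x powr p)"
proof -
  define \<phi> where "\<phi> j t = (\<Prod>i<j. p - real i) * t powr (p - real j)" for j and t :: real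
  have "DERIV (\<phi> j) t :> \<phi> (Suc j) t" if "t \<in> {0<..}" for j t
    unfolding \<phi>_def using that by (auto intro!: derivative_eq_intros simp: algebra_simps)
  from C_diff_compose[of "{0<..}" \<phi>, OF this assms(1), of 0] assms(2)
  show ?thesis by (simp add: \<phi>_def)
qed

text \<open>Flat functions P(y) e^(-y) with y = 1/t, extended by 0. The class is closed under
  differentiation, which sends P to y^2 (P - P'); so all derivatives are covered by one
  statement.\<close>

definition exp_poly :: "real poly \<Rightarrow> real \<Rightarrow> real" where
  "exp_poly P t = (if t \<le> 0 then 0 else poly P (1 / t) * exp (- (1 / t)))"

lemma poly_times_exp_neg_tendsto_0: "((\<lambda>y. poly P y * exp (- y)) \<longlongrightarrow> (0::real)) at_top"
proof (induction P)
  case 0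
  then show ?case by simp
next
  case (pCons a P)
  have "((\<lambda>y. poly Q y * exp (- y)) \<longlongrightarrow> (0::real)) at_top" for Q
  proof -
    have "((\<lambda>y. \<Sum>i\<le>degree Q. coeff Q i * (y ^ i / exp y)) \<longlongrightarrow> (\<Sum>i\<le>degree Q. coeff Q i * 0)) at_top"
      by (intro tendsto_intros tendsto_power_div_exp_0)
    then show ?thesis by (simp add: poly_altdef exp_minus divide_inverse sum_distrib_right mult.assoc)
  qed
  then show ?case .
qed

lemma DERIV_exp_poly:
  "DERIV (exp_poly P) t :> exp_poly ([:0, 0, 1:] * (P - pderiv P)) t"
proof -
  consider "t > 0" | "t < 0" | "t = 0" by linarith
  then show ?thesis
  proof cases
    case 1
    have "DERIV (\<lambda>t. poly P (1 / t) * exp (- (1 / t))) t :> poly (pderiv P) (1 / t) * (- (1 / t\<^sup>2)) * exp (- (1 / t)) + poly P (1 / t) * (exp (- (1 / t)) * (1 / t\<^sup>2))"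
      using 1 by (auto intro!: derivative_eq_intros DERIV_chain2[OF poly_DERIV] simp: power2_eq_square)
    also have "poly (pderiv P) (1 / t) * (- (1 / t\<^sup>2)) * exp (- (1 / t)) + poly P (1 / t) * (exp (- (1 / t)) * (1 / t\<^sup>2)) = exp_poly ([:0, 0, 1:] * (P - pderiv P)) t"
      using 1 by (simp add: exp_poly_def power2_eq_square algebra_simps)
    finally show ?thesis
      by (rule has_field_derivative_transform_within_open[where S = "{0<..}"]) (use 1 in \<open>auto simp: exp_poly_def\<close>)
  next
    case 2
    have "DERIV (\<lambda>t. 0) t :> (0::real)" by simp
    then have "DERIV (exp_poly P) t :> 0"
      by (rule has_field_derivative_transform_within_open[where S = "{..<0}"]) (use 2 in \<open>auto simp: exp_poly_def\<close>)
    then show ?thesis using 2 by (simp add: exp_poly_def)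
  next
    case 3
    \<comment> \<open>At 0 the difference quotient has the same shape, with P(y) replaced by y P(y);
      hence \<open>pCons 0 P\<close>.\<close>
    have lim: "((\<lambda>y. poly (pCons 0 P) y * exp (- y)) \<longlongrightarrow> 0) at_top" by (rule poly_times_exp_neg_tendsto_0)
    have "filterlim (\<lambda>h::real. 1 / h) at_top (at_right 0)"
      using filterlim_inverse_at_top_right by (simp add: inverse_eq_divide)
    from filterlim_compose[OF lim this]
    have "((\<lambda>h. (1 / h) * (poly P (1 / h) * exp (- (1 / h)))) \<longlongrightarrow> 0) (at_right 0)" by (simp add: mult.assoc)
    then have r: "((\<lambda>h. exp_poly P h / h) \<longlongrightarrow> 0) (at_right 0)"
      by (rule Lim_transform_eventually) (auto simp: eventually_at_filter exp_poly_def)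
    have l: "((\<lambda>h. exp_poly P h / h) \<longlongrightarrow> 0) (at_left 0)"
      by (rule Lim_transform_eventually[OF tendsto_const]) (auto simp: eventually_at_filter exp_poly_def)
    have "((\<lambda>h. exp_poly P h / h) \<longlongrightarrow> 0) (at 0)" using l r by (simp add: filterlim_split_at)
    then show ?thesis using 3 by (simp add: has_field_derivative_iff exp_poly_def)
  qed
qed

text \<open>The usual partition quotient, equal to 1 up to t = 1 and to 0 from t = 3. Division is
  written as a power so that \<open>C_diff_powr\<close> applies. It is evaluated at |x|^2, which is
  smooth at the origin; the threshold 3 lies below 4, the factor by which |x|^2 grows between dyadic
  scales.\<close>

definition bump_step :: "real \<Rightarrow> real" where
  "bump_step t = exp_poly 1 (3 - t) * (exp_poly 1 (3 - t) + exp_poly 1 (t - 1)) powr (-1)"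

lemma exp_poly_1: "exp_poly 1 t \<ge> 0" "t > 0 \<Longrightarrow> exp_poly 1 t > 0" "t \<le> 0 \<Longrightarrow> exp_poly 1 t = 0"
  by (auto simp: exp_poly_def)

lemma bump_step_denominator: "exp_poly 1 (3 - t) + exp_poly 1 (t - 1) > 0"
proof (cases "t < 3")
  case True
  then show ?thesis using exp_poly_1(1)[of "t - 1"] exp_poly_1(2)[of "3 - t"] by simp
next
  case False
  then show ?thesis using exp_poly_1(1)[of "3 - t"] exp_poly_1(2)[of "t - 1"] by simp
qed

lemma bump_step_eq: "t \<le> 1 \<Longrightarrow> bump_step t = 1" "t \<ge> 3 \<Longrightarrow> bump_step t = 0"
  using bump_step_denominator[of t] by (auto simp: bump_step_def exp_poly_1(3) powr_minus divide_inverse)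

lemma C_diff_bump_step:
  assumes "C_diff k f"
  shows "C_diff k (\<lambda>x. bump_step (f x))"
proof -
  define P where "P j = ((\<lambda>P :: real poly. [:0, 0, 1:] * (P - pderiv P)) ^^ j) 1" for j :: nat
  have E: "C_diff k (\<lambda>x. exp_poly 1 (g x))" if "C_diff k g" for g :: "'a \<Rightarrow> real"
  proof -
    have "DERIV (exp_poly (P j)) t :> exp_poly (P (Suc j)) t" for j t
      using DERIV_exp_poly[of "P j" t] by (simp only: P_def funpow.simps o_apply)
    from C_diff_compose[of UNIV "\<lambda>j. exp_poly (P j)", OF this that, of 0]
    show ?thesis by (simp add: P_def)
  qed
  have lin: "C_diff k (\<lambda>x. 3 - f x)" "C_diff k (\<lambda>x. f x - 1)"
    using C_diff_add[OF C_diff_const[of k 3] C_diff_mult[OF C_diff_const[of k "-1"] assms]]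
      C_diff_add[OF assms C_diff_const[of k "-1"]] by simp_all
  show ?thesis unfolding bump_step_def
    by (intro C_diff_mult C_diff_powr C_diff_add E lin bump_step_denominator)
qed

lemma C_infty_compact_bound:
  assumes "u \<in> C_infty_compact"
  obtains R where "\<And>x. norm x > R \<Longrightarrow> u x = 0"
proof -
  have "bounded (closure (support_on UNIV u))"
    using assms by (auto simp: C_infty_compact_def intro: compact_imp_bounded)
  then obtain R where R: "\<And>x. x \<in> closure (support_on UNIV u) \<Longrightarrow> norm x \<le> R"
    by (auto simp: bounded_iff)
  have "u x = 0" if "norm x > R" for x
  proof (rule ccontr)
    assume "u x \<noteq> 0"
    then have "x \<in> support_on UNIV u" by (simp add: support_on_def)
    then have "x \<in> closure (support_on UNIV u)" using closure_subset by blast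
    then show False using R that by fastforce
  qed
  then show ?thesis by (rule that)
qed

lemma C_infty_compactI:
  fixes u :: "'a::euclidean_space \<Rightarrow> real"
  assumes "\<And>k. C_diff k u" and R: "\<And>x. norm x > R \<Longrightarrow> u x = 0"
  shows "u \<in> C_infty_compact"
proof -
  have "support_on UNIV u \<subseteq> cball 0 R" using R by (auto simp: support_on_def) (meson not_less)
  then have "bounded (support_on UNIV u)" using bounded_cball bounded_subset by blast
  then show ?thesis using assms(1) by (auto simp: C_infty_compact_def compact_closure)
qed

lemma frechet_derivative_grad:
  assumes "u differentiable (at x)"
  shows "(u has_derivative (\<lambda>v. grad u x \<bullet> v)) (at x)"
proof -
  let ?D = "frechet_derivative u (at x)"
  have d: "(u has_derivative ?D) (at x)" using assms by (rule has_frechet_derivative)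
  have lin: "linear ?D" using has_derivative_linear[OF d] .
  have "?D v = grad u x \<bullet> v" for v
  proof -
    have "?D v = ?D (\<Sum>i\<in>UNIV. (v $ i) *\<^sub>R axis i 1)"
      using basis_expansion[of v] by (simp add: scalar_mult_eq_scaleR)
    also have "\<dots> = (\<Sum>i\<in>UNIV. (v $ i) * ?D (axis i 1))"
      by (simp add: linear_sum[OF lin] linear_scale[OF lin])
    also have "\<dots> = grad u x \<bullet> v"
      by (simp add: grad_def inner_vec_def mult.commute)
    finally show ?thesis .
  qed
  then have "?D = (\<lambda>v. grad u x \<bullet> v)" by (rule ext)
  then show ?thesis using d by simp
qed

lemma C_infty_compact_C1c:
  fixes u :: "real ^ 'n \<Rightarrow> real"
  assumes "u \<in> C_infty_compact"
  shows "C1c u (grad u)"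
proof -
  have C1: "C_diff (Suc 0) u" using assms by (auto simp: C_infty_compact_def)
  have d: "(u has_derivative (\<lambda>v. grad u x \<bullet> v)) (at x)" for x
    using C1 by (intro frechet_derivative_grad) auto
  obtain R where R: "\<And>x. norm x > R \<Longrightarrow> u x = 0" using C_infty_compact_bound[OF assms] by metis
  have g0: "grad u x = 0" if "norm x > R" for x
  proof -
    have "open {x :: real ^ 'n. norm x > R}" by (intro open_Collect_less continuous_intros)
    then have "(u has_derivative (\<lambda>v. 0)) (at x)"
      using that R by (intro has_derivative_transform_within_open[OF has_derivative_const[of 0]]) auto
    from has_derivative_unique[OF d this] have "grad u x \<bullet> v = 0" for v by (rule fun_cong)
    then show ?thesis by (metis inner_eq_zero_iff)
  qed
  have "continuous_on UNIV (grad u)"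
    unfolding grad_def[abs_def] using C1 by (intro continuous_on_vec_lambda) auto
  then show ?thesis using d R g0 unfolding C1c_def by blast
qed

section \<open>The inequality for negative \<alpha>_n\<close>

context enumerated_coordinates
begin

definition gs_exponent :: "(nat \<Rightarrow> real) \<Rightarrow> nat \<Rightarrow> real" where
  "gs_exponent \<alpha> k = (if k \<le> 2 then 0 else (real k - 2) / 2 + \<alpha> k)"

text \<open>Completing squares, the right side is (S_(k-1) - (k - 2)/2)^2 - (S_k - (k - 2)/2)^2,
  that is (\<alpha>_(k-1) - 1/2)^2 - \<alpha>_k^2. For k = 3 the value S_2 = 0 acts as \<alpha>_2 =
  0 and gives the 1/4.\<close>

lemma beta_gs_exponent:
  assumes "k \<in> {3..n}"
  shows "beta \<alpha> k = (real k - 2) * (gs_exponent \<alpha> k - gs_exponent \<alpha> (k - 1)) - (gs_exponent \<alpha> k)\<^sup>2 + (gs_exponent \<alpha> (k - 1))\<^sup>2"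
proof (cases "k = 3")
  case True
  then show ?thesis by (simp add: beta_def gs_exponent_def power2_eq_square algebra_simps)
next
  case False
  then obtain j where j: "k = Suc j" "j \<ge> 3" using assms by (cases k) auto
  then show ?thesis by (simp add: beta_def gs_exponent_def power2_eq_square field_simps)
qed

lemma gs_exponent_2: "gs_exponent \<alpha> 2 = 0" by (simp add: gs_exponent_def)

theorem Hardy_Sobolev_Mazya_holds:
  assumes \<alpha>: "\<forall>m\<in>{3..n}. \<alpha> m \<le> 0" and \<alpha>n: "\<alpha> n < 0" and Q: "2 < Q" "Q \<le> 2 * real n / (real n - 2)"
  shows "\<exists>C>0. \<forall>u \<in> (C_infty_compact :: (real ^ 'n \<Rightarrow> real) set). hardy_sobolev_mazya n e \<alpha> Q C u"
proof -
  define \<kappa> where "\<kappa> = 1 - (Q - 2) * (real n - 2) / 4"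
  let ?S = "gs_exponent \<alpha>"
  have sub: "\<kappa> + (Q / 2 + 1) * ?S k < real k - 1" if k: "k \<in> {2..n}" for k
  proof (cases "k = 2")
    case True
    have "(Q - 2) * (real n - 2) > 0" using Q n3 by (intro mult_pos_pos) auto
    then show ?thesis using True by (simp add: \<kappa>_def gs_exponent_def)
  next
    case False
    then have k3: "k \<in> {3..n}" using k by auto
    \<comment> \<open>For k < n the term with n - k provides the strict inequality since Q > 2; for
      k = n it disappears and the strictness has to come from \<alpha>_n < 0.\<close>
    have eq: "\<kappa> + (Q / 2 + 1) * ?S k = real k - 1 - (Q - 2) * (real n - real k) / 4 + (Q / 2 + 1) * \<alpha> k"
      using k3 by (simp add: \<kappa>_def gs_exponent_def field_simps)
    have "(Q / 2 + 1) * \<alpha> k < (Q - 2) * (real n - real k) / 4"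
    proof (cases "k = n")
      case True
      then show ?thesis using \<alpha>n Q by (simp add: mult_pos_neg)
    next
      case False
      have "(Q - 2) * (real n - real k) > 0" using False k Q by (intro mult_pos_pos) auto
      moreover have "(Q / 2 + 1) * \<alpha> k \<le> 0" using \<alpha> k3 Q by (intro mult_nonneg_nonpos) auto
      ultimately show ?thesis by linarith
    qed
    then show ?thesis unfolding eq by linarith
  qed
  obtain C where C: "C > 0" and ineq: "\<And>u g. C1c u g \<Longrightarrow> integrable lborel (\<lambda>x. (norm (gs_grad ?S u g x))\<^sup>2) \<Longrightarrow>
    C * (LBINT x. r 2 x powr (- (2 * \<kappa>)) * \<bar>u x\<bar> powr Q) powr (2 / Q) \<le> (LBINT x. (norm (gs_grad ?S u g x))\<^sup>2)"
    using weighted_Sobolev[of ?S Q \<kappa>, OF gs_exponent_2 Q \<kappa>_def] sub by blast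
  have \<sigma>: "(Q - 2) / 2 * real n - Q = - (2 * \<kappa>)" by (simp add: \<kappa>_def field_simps)
  show ?thesis
  proof (intro exI[of _ C] conjI ballI C)
    fix u :: "real ^ 'n \<Rightarrow> real" assume "u \<in> C_infty_compact"
    then have u: "C1c u (grad u)" by (rule C_infty_compact_C1c)
    note G = ground_state_representation[of u "grad u" ?S "beta \<alpha>", OF u gs_exponent_2 beta_gs_exponent]
    show "hardy_sobolev_mazya n e \<alpha> Q C u"
      unfolding hardy_sobolev_mazya_def \<sigma> using ineq[OF u G(1)] G(3) by simp
  qed
qed

section \<open>Trial functions in the critical case\<close>

text \<open>The ground state with |X_k|^2 replaced by |X_k|^2 + \<epsilon>^2 in every factor, hence
  smooth for \<epsilon> \<noteq> 0 and equal to \<Phi> at \<epsilon> = 0 off the singular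
  sets.\<close>

definition gs_reg :: "(nat \<Rightarrow> real) \<Rightarrow> real \<Rightarrow> real ^ 'n \<Rightarrow> real" where
  "gs_reg \<gamma> \<epsilon> x = (\<Prod>k=3..n. ((r k x)\<^sup>2 + \<epsilon>\<^sup>2) powr (- \<gamma> k / 2))"

lemma measurable_gs_reg[measurable]: "gs_reg \<gamma> \<epsilon> \<in> borel_measurable borel"
  unfolding gs_reg_def by measurable

lemma gs_reg_nonneg: "gs_reg \<gamma> \<epsilon> x \<ge> 0"
  unfolding gs_reg_def by (intro prod_nonneg) auto

lemma has_derivative_gs_reg:
  assumes "\<epsilon> \<noteq> 0"
  shows "(gs_reg \<gamma> \<epsilon> has_derivative
    (\<lambda>v. (- gs_reg \<gamma> \<epsilon> x) *\<^sub>R (\<Sum>k=3..n. (\<gamma> k / ((r k x)\<^sup>2 + \<epsilon>\<^sup>2)) *\<^sub>R trunc e k x) \<bullet> v)) (at x)"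
proof -
  let ?R = "\<lambda>k. (r k x)\<^sup>2 + \<epsilon>\<^sup>2"
  let ?f = "\<lambda>k x. ((r k x)\<^sup>2 + \<epsilon>\<^sup>2) powr (- \<gamma> k / 2)"
  have pos: "?R k > 0" for k using assms by (simp add: add_nonneg_pos)
  have "((\<lambda>x. \<Prod>k=3..n. ?f k x) has_derivative
    (\<lambda>v. \<Sum>k=3..n. (2 * (- \<gamma> k / 2) * ?R k powr (- \<gamma> k / 2 - 1) * (trunc e k x \<bullet> v)) * (\<Prod>j\<in>{3..n} - {k}. ?f j x))) (at x)"
    by (intro has_derivative_prod has_derivative_r_powr assms) auto
  moreover have "(\<Sum>k=3..n. (2 * (- \<gamma> k / 2) * ?R k powr (- \<gamma> k / 2 - 1) * (trunc e k x \<bullet> v)) * (\<Prod>j\<in>{3..n} - {k}. ?f j x))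
     = (- gs_reg \<gamma> \<epsilon> x) *\<^sub>R (\<Sum>k=3..n. (\<gamma> k / ?R k) *\<^sub>R trunc e k x) \<bullet> v" for v
  proof -
    have "(2 * (- \<gamma> k / 2) * ?R k powr (- \<gamma> k / 2 - 1) * (trunc e k x \<bullet> v)) * (\<Prod>j\<in>{3..n} - {k}. ?f j x)
       = - gs_reg \<gamma> \<epsilon> x * (\<gamma> k / ?R k * (trunc e k x \<bullet> v))" if k: "k \<in> {3..n}" for k
    proof -
      have "gs_reg \<gamma> \<epsilon> x = ?f k x * (\<Prod>j\<in>{3..n} - {k}. ?f j x)"
        unfolding gs_reg_def using k by (intro prod.remove) auto
      moreover have "?R k powr (- \<gamma> k / 2 - 1) = ?f k x / ?R k"
        using pos[of k] by (simp add: powr_diff)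
      ultimately show ?thesis by simp
    qed
    then have "(\<Sum>k=3..n. (2 * (- \<gamma> k / 2) * ?R k powr (- \<gamma> k / 2 - 1) * (trunc e k x \<bullet> v)) * (\<Prod>j\<in>{3..n} - {k}. ?f j x))
      = (\<Sum>k=3..n. - gs_reg \<gamma> \<epsilon> x * (\<gamma> k / ?R k * (trunc e k x \<bullet> v)))" by (intro sum.cong) auto
    moreover have "(- gs_reg \<gamma> \<epsilon> x) *\<^sub>R (\<Sum>k=3..n. (\<gamma> k / ?R k) *\<^sub>R trunc e k x) \<bullet> v
      = - gs_reg \<gamma> \<epsilon> x * (\<Sum>k=3..n. \<gamma> k / ?R k * (trunc e k x \<bullet> v))"
      by (simp add: inner_sum_left)
    ultimately show ?thesis by (simp only: sum_distrib_left)
  qed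
  ultimately show ?thesis unfolding gs_reg_def[abs_def] by (simp only:)
qed

lemma C_diff_nth: "C_diff k (\<lambda>x :: real ^ 'n. x $ i)"
  by (rule C_diff_bounded_linear) (rule bounded_linear_vec_nth)

lemma C_diff_power2: "C_diff k f \<Longrightarrow> C_diff k (\<lambda>x. (f x)\<^sup>2)"
  by (simp only: power2_eq_square C_diff_mult)

lemma C_diff_r_sq: "j \<le> n \<Longrightarrow> C_diff k (\<lambda>x. (r j x)\<^sup>2)"
  by (simp only: r_sq) (intro C_diff_sum C_diff_power2 C_diff_nth, simp)

lemma C_diff_norm_sq: "C_diff k (\<lambda>x :: real ^ 'n. (norm x)\<^sup>2)"
  using C_diff_r_sq[of n k] by (simp add: r_n)

lemma C_diff_gs_reg:
  assumes "\<epsilon> \<noteq> 0" shows "C_diff m (gs_reg \<gamma> \<epsilon>)"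
  unfolding gs_reg_def[abs_def] using assms
  by (intro C_diff_prod C_diff_powr C_diff_add C_diff_r_sq C_diff_const) (auto simp: add_nonneg_pos)

section \<open>The averaged dyadic cutoff\<close>

definition eta :: "real ^ 'n \<Rightarrow> real" where "eta x = bump_step ((norm x)\<^sup>2)"

text \<open>The gradients of the \<open>L\<close> summands have disjoint supports: this gives the energy \<open>O(1/L)\<close>.\<close>

definition cutoff :: "nat \<Rightarrow> real ^ 'n \<Rightarrow> real" where
  "cutoff L x = (1 / real L) * (\<Sum>j<L. eta ((1/2) ^ j *\<^sub>R x))"

definition grad_cutoff :: "nat \<Rightarrow> real ^ 'n \<Rightarrow> real ^ 'n" where
  "grad_cutoff L x = (1 / real L) *\<^sub>R (\<Sum>j<L. (1/2) ^ j *\<^sub>R grad eta ((1/2) ^ j *\<^sub>R x))"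

lemma eta_smooth: "eta \<in> C_infty_compact"
proof (rule C_infty_compactI)
  show "C_diff k eta" for k
    unfolding eta_def[abs_def] by (intro C_diff_bump_step C_diff_norm_sq)
  show "eta x = 0" if "norm x > 2" for x
  proof -
    have "(norm x)\<^sup>2 \<ge> 2\<^sup>2" using that by (intro power_mono) auto
    then show ?thesis by (simp add: eta_def bump_step_eq)
  qed
qed

lemma eta_1: "norm x \<le> 1 \<Longrightarrow> eta x = 1"
  by (simp add: eta_def bump_step_eq power_le_one)

lemmas eta_C1c = C_infty_compact_C1c[OF eta_smooth]

lemma grad_eta_support:
  assumes "grad eta x \<noteq> 0" shows "1 \<le> (norm x)\<^sup>2" "(norm x)\<^sup>2 \<le> 3"
proof -
  have z: "grad eta x = 0" if S: "open S" "x \<in> S" and c: "\<And>y. y \<in> S \<Longrightarrow> c = eta y" for S c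
  proof -
    have "(eta has_derivative (\<lambda>v. 0)) (at x)"
      by (rule has_derivative_transform_within_open[OF has_derivative_const[of c] S c])
    from has_derivative_unique[OF C1cD(1)[OF eta_C1c] this]
    have "grad eta x \<bullet> v = 0" for v by (rule fun_cong)
    then show ?thesis by (metis inner_eq_zero_iff)
  qed
  have "open {y :: real ^ 'n. (norm y)\<^sup>2 < 1}" by (intro open_Collect_less continuous_intros)
  from z[OF this, of 1] show "1 \<le> (norm x)\<^sup>2" using assms by (force simp: eta_def bump_step_eq)
  have "open {y :: real ^ 'n. 3 < (norm y)\<^sup>2}" by (intro open_Collect_less continuous_intros)
  from z[OF this, of 0] show "(norm x)\<^sup>2 \<le> 3" using assms by (force simp: eta_def bump_step_eq)
qed

lemma C_diff_cutoff: "C_diff k (cutoff L)"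
proof -
  have "C_diff k (\<lambda>x. eta ((1/2) ^ j *\<^sub>R x))" for j
  proof -
    have "C_diff k (\<lambda>x :: real ^ 'n. bump_step (((1/2) ^ j)\<^sup>2 * (norm x)\<^sup>2))"
      by (intro C_diff_bump_step C_diff_mult C_diff_const C_diff_norm_sq)
    then show ?thesis by (simp add: eta_def power_mult_distrib)
  qed
  then show ?thesis unfolding cutoff_def[abs_def] by (intro C_diff_mult C_diff_const C_diff_sum) auto
qed

lemma has_derivative_cutoff: "(cutoff L has_derivative (\<lambda>v. grad_cutoff L x \<bullet> v)) (at x)"
proof -
  have d: "((\<lambda>x. eta ((1/2) ^ j *\<^sub>R x)) has_derivative (\<lambda>v. grad eta ((1/2) ^ j *\<^sub>R x) \<bullet> ((1/2) ^ j *\<^sub>R v))) (at x)" for j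
    by (rule has_derivative_compose[OF _ C1cD(1)[OF eta_C1c]]) (auto intro!: derivative_eq_intros)
  have "((\<lambda>x. (1 / real L) * (\<Sum>j<L. eta ((1/2) ^ j *\<^sub>R x))) has_derivative
    (\<lambda>v. (1 / real L) * (\<Sum>j<L. grad eta ((1/2) ^ j *\<^sub>R x) \<bullet> ((1/2) ^ j *\<^sub>R v)))) (at x)"
    by (intro has_derivative_mult_right has_derivative_sum d)
  then show ?thesis unfolding cutoff_def[abs_def]
    by (rule has_derivative_eq_rhs) (simp add: fun_eq_iff grad_cutoff_def inner_sum_left)
qed

lemma cutoff_1: "norm x \<le> 1 \<Longrightarrow> L > 0 \<Longrightarrow> cutoff L x = 1"
proof -
  assume x: "norm x \<le> 1" and L: "L > 0"
  have "eta ((1/2) ^ j *\<^sub>R x) = 1" for j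
    using x mult_mono[of "(1/2)^j" 1 "norm x" 1] by (intro eta_1) (auto simp: power_le_one)
  then show ?thesis using L by (simp add: cutoff_def)
qed

lemma cutoff_smooth: "cutoff L \<in> C_infty_compact"
proof (rule C_infty_compactI)
  show "C_diff k (cutoff L)" for k by (rule C_diff_cutoff)
  show "cutoff L x = 0" if x: "norm x > 2 * 2 ^ L" for x
  proof -
    have "eta ((1/2) ^ j *\<^sub>R x) = 0" if "j < L" for j
    proof -
      have "(2::real) ^ j \<le> 2 ^ L" using that by (intro power_increasing) auto
      then have "norm x > 2 * 2 ^ j" using x by linarith
      then have "norm ((1/2) ^ j *\<^sub>R x) \<ge> 2" by (simp add: power_divide field_simps)
      then have "(norm ((1/2) ^ j *\<^sub>R x))\<^sup>2 \<ge> 2\<^sup>2" by (intro power_mono) auto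
      then show ?thesis by (simp add: eta_def bump_step_eq)
    qed
    then show ?thesis by (simp add: cutoff_def)
  qed
qed

lemma grad_cutoff_eq: "grad (cutoff L) x = grad_cutoff L x"
proof -
  have "(\<lambda>v. grad (cutoff L) x \<bullet> v) = (\<lambda>v. grad_cutoff L x \<bullet> v)"
    by (rule has_derivative_unique[OF C1cD(1)[OF C_infty_compact_C1c[OF cutoff_smooth]] has_derivative_cutoff])
  then have "(grad (cutoff L) x - grad_cutoff L x) \<bullet> v = 0" for v by (simp add: fun_eq_iff inner_diff_left)
  then show ?thesis by (metis inner_eq_zero_iff right_minus_eq)
qed

lemma cutoff_C1c: "C1c (cutoff L) (grad_cutoff L)"
proof -
  have "grad (cutoff L) = grad_cutoff L" by (rule ext) (rule grad_cutoff_eq)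
  then show ?thesis using C_infty_compact_C1c[OF cutoff_smooth, of L] by simp
qed

lemma norm_grad_cutoff_sq:
  "(norm (grad_cutoff L x))\<^sup>2 = (1 / (real L)\<^sup>2) * (\<Sum>j<L. (1/4) ^ j * (norm (grad eta ((1/2) ^ j *\<^sub>R x)))\<^sup>2)"
proof -
  let ?v = "\<lambda>j. (1/2) ^ j *\<^sub>R grad eta ((1/2) ^ j *\<^sub>R x)"
  \<comment> \<open>The j-th gradient lives where 4^j <= |x|^2 <= 3 * 4^j. These annuli are disjoint
    because 3 < 4, so the summands are orthogonal and Pythagoras applies.\<close>
  have disj: "?v i = 0 \<or> ?v j = 0" if ij: "i < j" for i j
  proof (rule ccontr)
    assume "\<not> ?thesis"
    then have a: "grad eta ((1/2) ^ i *\<^sub>R x) \<noteq> 0" and b: "grad eta ((1/2) ^ j *\<^sub>R x) \<noteq> 0" by auto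
    have sq: "(norm ((1/2) ^ m *\<^sub>R x))\<^sup>2 = (1/4) ^ m * (norm x)\<^sup>2" for m
      by (simp add: power_mult_distrib power2_eq_square flip: power_mult_distrib)
    have i: "(1/4) ^ i * (norm x)\<^sup>2 \<le> 3" using grad_eta_support(2)[OF a] by (simp only: sq)
    have j: "1 \<le> (1/4) ^ j * (norm x)\<^sup>2" using grad_eta_support(1)[OF b] by (simp only: sq)
    have "(1/4::real) ^ j \<le> (1/4) ^ (Suc i)" using ij by (intro power_decreasing) auto
    then have "(1/4) ^ j * (norm x)\<^sup>2 \<le> (1/4) ^ (Suc i) * (norm x)\<^sup>2" by (intro mult_right_mono) auto
    then show False using i j by simp
  qed
  have orth: "pairwise (\<lambda>i j. orthogonal (?v i) (?v j)) {..<L}"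
    unfolding pairwise_def
  proof (intro ballI impI)
    fix i j :: nat assume "i \<noteq> j"
    then have "i < j \<or> j < i" by auto
    then show "orthogonal (?v i) (?v j)" using disj[of i j] disj[of j i] by (auto simp: orthogonal_def)
  qed
  have "(norm (grad_cutoff L x))\<^sup>2 = (1 / (real L)\<^sup>2) * (norm (\<Sum>j<L. ?v j))\<^sup>2"
    by (simp add: grad_cutoff_def power_divide power_mult_distrib)
  also have "(norm (\<Sum>j<L. ?v j))\<^sup>2 = (\<Sum>j<L. (norm (?v j))\<^sup>2)"
    using orth by (intro norm_sum_Pythagorean) auto
  also have "\<dots> = (\<Sum>j<L. (1/4) ^ j * (norm (grad eta ((1/2) ^ j *\<^sub>R x)))\<^sup>2)"
    by (intro sum.cong refl) (simp add: power_mult_distrib power2_eq_square flip: power_mult_distrib)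
  finally show ?thesis .
qed

section \<open>Majorants of the squared ground state, uniform in \<epsilon> and \<delta>\<close>

definition gs_major :: "(nat \<Rightarrow> real) \<Rightarrow> real ^ 'n \<Rightarrow> real" where
  "gs_major t x = (\<Prod>k=3..n. r k x powr (- (2 * t k)))"

lemma measurable_gs_major[measurable]: "gs_major t \<in> borel_measurable borel"
  unfolding gs_major_def by measurable

lemma gs_major_nonneg: "gs_major t x \<ge> 0"
  unfolding gs_major_def by (intro prod_nonneg) auto

text \<open>By Abel summation, since \<open>r k x\<close> increases with \<open>k\<close>.\<close>

lemma gs_reg_sq_le:
  assumes x: "\<forall>i. x $ i \<noteq> 0" and ST: "S 2 = T 2" "S n = T n" "\<And>k. k \<in> {3..n} \<Longrightarrow> S k \<le> T k"
    and t: "\<And>k. k \<in> {3..n} \<Longrightarrow> 0 \<le> T k - T (k - 1)"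
  shows "(gs_reg (\<lambda>k. S k - S (k - 1)) \<epsilon> x)\<^sup>2 \<le> gs_major (\<lambda>k. T k - T (k - 1)) x"
proof -
  define R where "R k = (r k x)\<^sup>2 + \<epsilon>\<^sup>2" for k
  define l where "l k = ln (R k) / 2" for k
  define U where "U k = T k - S k" for k
  have rp: "r k x > 0" if "k \<in> {1..n}" for k using r_pos[OF x that] .
  have Rp: "R k > 0" if "k \<in> {1..n}" for k unfolding R_def using rp[OF that] by (intro add_pos_nonneg) auto
  have lmono: "l k \<le> l (Suc k)" if "3 \<le> k" "Suc k \<le> n" for k
  proof -
    have "r k x \<le> r (Suc k) x" using that by (intro r_mono) auto
    then have "R k \<le> R (Suc k)" unfolding R_def by (intro add_right_mono power_mono) auto
    then show ?thesis using Rp[of k] that by (simp add: l_def)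
  qed
  have ex: "gs_reg \<gamma> \<epsilon> x = exp (- (\<Sum>k=3..n. \<gamma> k * l k))" for \<gamma>
  proof -
    have "gs_reg \<gamma> \<epsilon> x = (\<Prod>k=3..n. exp (- (\<gamma> k * l k)))"
      unfolding gs_reg_def
    proof (intro prod.cong refl)
      fix k assume "k \<in> {3..n}"
      then have "R k > 0" using Rp[of k] by simp
      then show "((r k x)\<^sup>2 + \<epsilon>\<^sup>2) powr (- \<gamma> k / 2) = exp (- (\<gamma> k * l k))"
        by (simp add: l_def powr_def flip: R_def)
    qed
    then show ?thesis by (simp only: sum_negf[symmetric] exp_sum finite_atLeastAtMost)
  qed
  \<comment> \<open>\<open>U\<close> vanishes at 2 and at n and is nonnegative in between; so at m =
    n the right side is 0, and exchanging the exponents of S for those of T can only increase the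
    product.\<close>
  have abel: "m \<le> n \<longrightarrow> (\<Sum>k=3..m. (U k - U (k - 1)) * l k) \<le> U m * l m" if "m \<ge> 3" for m
    using that
  proof (induction m rule: dec_induct)
    case base
    then show ?case using ST(1) by (simp add: U_def)
  next
    case (step m)
    show ?case
    proof
      assume m: "Suc m \<le> n"
      have "U m \<ge> 0" using ST(3)[of m] step m by (simp add: U_def)
      then have "U m * l m \<le> U m * l (Suc m)" using lmono[of m] step m by (intro mult_left_mono) auto
      then show "(\<Sum>k=3..Suc m. (U k - U (k - 1)) * l k) \<le> U (Suc m) * l (Suc m)"
        using step m by (simp add: algebra_simps)
    qed
  qed
  have "(\<Sum>k=3..n. (U k - U (k - 1)) * l k) \<le> 0" using abel[of n] n3 ST(2) by (simp add: U_def)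
  moreover have "(\<Sum>k=3..n. (U k - U (k - 1)) * l k) = (\<Sum>k=3..n. (T k - T (k - 1)) * l k) - (\<Sum>k=3..n. (S k - S (k - 1)) * l k)"
    by (simp add: U_def algebra_simps flip: sum_subtractf)
  ultimately have "gs_reg (\<lambda>k. S k - S (k - 1)) \<epsilon> x \<le> gs_reg (\<lambda>k. T k - T (k - 1)) \<epsilon> x"
    unfolding ex by simp
  then have "(gs_reg (\<lambda>k. S k - S (k - 1)) \<epsilon> x)\<^sup>2 \<le> (gs_reg (\<lambda>k. T k - T (k - 1)) \<epsilon> x)\<^sup>2"
    by (intro power_mono gs_reg_nonneg)
  also have "\<dots> = (\<Prod>k=3..n. (R k powr (- (T k - T (k - 1)) / 2))\<^sup>2)"
    by (simp add: gs_reg_def R_def prod_power_distrib)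
  also have "\<dots> \<le> (\<Prod>k=3..n. r k x powr (- (2 * (T k - T (k - 1)))))"
  proof (intro prod_mono conjI)
    fix k assume k: "k \<in> {3..n}"
    have p: "r k x > 0" using rp[of k] k by simp
    have "R k powr (- (T k - T (k - 1)) / 2) \<le> ((r k x)\<^sup>2) powr (- (T k - T (k - 1)) / 2)"
      using t[OF k] p by (intro powr_mono2') (auto simp: R_def)
    also have "((r k x)\<^sup>2) powr (- (T k - T (k - 1)) / 2) = r k x powr (- (T k - T (k - 1)))"
    proof -
      have sq: "((r k x)\<^sup>2) powr q = r k x powr (2 * q)" for q
        using p by (simp add: powr_powr flip: powr_numeral)
      show ?thesis unfolding sq by (rule arg_cong[where f = "\<lambda>q. r k x powr q"]) (simp add: field_simps)
    qed
    finally have "(R k powr (- (T k - T (k - 1)) / 2))\<^sup>2 \<le> (r k x powr (- (T k - T (k - 1))))\<^sup>2"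
      by (intro power_mono) auto
    also have "\<dots> = r k x powr (- (2 * (T k - T (k - 1))))"
      by (simp add: power2_eq_square flip: powr_add)
    finally show "(R k powr (- (T k - T (k - 1)) / 2))\<^sup>2 \<le> r k x powr (- (2 * (T k - T (k - 1))))" .
  qed simp
  finally show ?thesis by (simp add: gs_major_def)
qed

lemma cwt_three_split:
  "cwt (\<lambda>k. if k \<le> 3 then c / 3 else a k) x
    = (\<bar>x $ e 1\<bar> powr (- (c/3)) * \<bar>x $ e 2\<bar> powr (- (c/3)) * \<bar>x $ e 3\<bar> powr (- (c/3))) * (\<Prod>k=4..n. \<bar>x $ e k\<bar> powr (- a k))"
proof -
  have "{1..n} = {1,2,3} \<union> {4..n}" using n3 by auto
  then have "cwt (\<lambda>k. if k \<le> 3 then c / 3 else a k) x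
    = (\<Prod>k\<in>{1,2,3}. \<bar>x $ e k\<bar> powr (- (if k \<le> 3 then c / 3 else a k))) * (\<Prod>k=4..n. \<bar>x $ e k\<bar> powr (- (if k \<le> 3 then c / 3 else a k)))"
    unfolding cwt_def by (simp only:) (rule prod.union_disjoint, auto)
  also have "(\<Prod>k=4..n. \<bar>x $ e k\<bar> powr (- (if k \<le> 3 then c / 3 else a k))) = (\<Prod>k=4..n. \<bar>x $ e k\<bar> powr (- a k))"
    by (intro prod.cong) auto
  finally show ?thesis by simp
qed

text \<open>For k >= 4 the factor |X_k| is estimated by its last coordinate alone, which leaves the
  first three coordinates to carry the exponent of |X_3|.\<close>

lemma powr_r_le_cwt:
  assumes x: "\<forall>i. x $ i \<noteq> 0" and c: "c \<ge> 0" and a: "\<And>k. k \<in> {4..n} \<Longrightarrow> a k \<ge> 0"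
  shows "r 3 x powr (- c) * (\<Prod>k=4..n. r k x powr (- a k)) \<le> cwt (\<lambda>k. if k \<le> 3 then c / 3 else a k) x"
  unfolding cwt_three_split
proof (intro mult_mono prod_mono conjI)
  have "- c = - (c/3) + - (c/3) + - (c/3)" by simp
  then have "r 3 x powr (- c) = r 3 x powr (- (c/3)) * r 3 x powr (- (c/3)) * r 3 x powr (- (c/3))"
    by (simp only: powr_add)
  also have "\<dots> \<le> \<bar>x $ e 1\<bar> powr (- (c/3)) * \<bar>x $ e 2\<bar> powr (- (c/3)) * \<bar>x $ e 3\<bar> powr (- (c/3))"
    using x n3 c abs_nth_le_r[of 1 3 x] abs_nth_le_r[of 2 3 x] abs_nth_le_r[of 3 3 x]
    by (intro mult_mono powr_mono2') auto
  finally show "r 3 x powr (- c) \<le> \<bar>x $ e 1\<bar> powr (- (c/3)) * \<bar>x $ e 2\<bar> powr (- (c/3)) * \<bar>x $ e 3\<bar> powr (- (c/3))" .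
  show "r k x powr (- a k) \<le> \<bar>x $ e k\<bar> powr (- a k)" if "k \<in> {4..n}" for k
    using x that a[OF that] abs_nth_le_r[of k k x] by (intro powr_mono2') auto
qed (auto intro!: prod_nonneg)

lemma gs_major_split: "gs_major t x = r 3 x powr (- (2 * t 3)) * (\<Prod>k=4..n. r k x powr (- (2 * t k)))"
proof -
  have "{3..n} = insert 3 {4..n}" using n3 by auto
  then show ?thesis by (simp add: gs_major_def)
qed

text \<open>The exponent 2 t_3 + 2 on |X_3| is shared by three coordinates, and t_3 < 1/2 keeps it
  below 3; likewise 2 t_k < 1 for the others. This is the dominating function for the limit
  \<epsilon> to 0.\<close>

lemma integrable_gs_major_r3:
  assumes t: "\<And>k. k \<in> {3..n} \<Longrightarrow> 0 \<le> t k \<and> t k < 1/2"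
  shows "integrable lborel (\<lambda>x. indicator (cball 0 R) x * (gs_major t x * r 3 x powr (- 2)))"
proof (rule integrable_cwt_bound[where a = "\<lambda>k. if k \<le> 3 then (2 * t 3 + 2) / 3 else 2 * t k" and C = 1])
  show "(if k \<le> 3 then (2 * t 3 + 2) / 3 else 2 * t k) < 1" if "k \<in> {1..n}" for k
    using t[of 3] t[of k] n3 that by auto
  fix x :: "real ^ 'n" assume x: "\<forall>i. x $ i \<noteq> 0"
  have "gs_major t x * r 3 x powr (- 2) = r 3 x powr (- (2 * t 3 + 2)) * (\<Prod>k=4..n. r k x powr (- (2 * t k)))"
  proof -
    have "- (2 * t 3 + 2) = - (2 * t 3) + - 2" by simp
    then show ?thesis unfolding gs_major_split by (simp only: powr_add mult_ac)
  qed
  also have "\<dots> \<le> cwt (\<lambda>k. if k \<le> 3 then (2 * t 3 + 2) / 3 else 2 * t k) x"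
    using t n3 by (intro powr_r_le_cwt[OF x]) auto
  finally show "\<bar>gs_major t x * r 3 x powr (- 2)\<bar> \<le> 1 * cwt (\<lambda>k. if k \<le> 3 then (2 * t 3 + 2) / 3 else 2 * t k) x"
    using gs_major_nonneg[of t x] by (simp add: abs_mult)
qed measurable

text \<open>The common bound for all \<open>\<delta>\<close>; it keeps the constant in the energy estimate independent of \<open>L\<close>.\<close>

lemma integrable_gs_major_half:
  "integrable lborel (\<lambda>x. indicator (cball 0 R) x * gs_major (\<lambda>k. 1/2) x)"
proof (rule integrable_cwt_bound[where a = "\<lambda>k. if k \<le> 3 then (1 + (real n - 3) / real n) / 3 else 1 - 1 / real n" and C = 1])
  show "(if k \<le> 3 then (1 + (real n - 3) / real n) / 3 else 1 - 1 / real n) < 1" for k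
    using n3 by (auto simp: field_simps)
  fix x :: "real ^ 'n" assume x: "\<forall>i. x $ i \<noteq> 0"
  have p3: "r 3 x > 0" using r_pos[OF x, of 3] n3 by simp
  have "gs_major (\<lambda>k. 1/2) x = r 3 x powr (- 1) * (\<Prod>k=4..n. r k x powr (- 1))"
    using gs_major_split[of "\<lambda>k. 1/2" x] by simp
  \<comment> \<open>An exponent of exactly 1 on a single coordinate is not integrable. From each of
    the n - 3 factors a share 1/n is moved to |X_3|, which has room: its total 1 + (n - 3)/n stays
    below 3.\<close>
  also have "\<dots> \<le> r 3 x powr (- 1) * (\<Prod>k=4..n. r k x powr (- (1 - 1 / real n)) * r 3 x powr (- (1 / real n)))"
  proof (intro mult_left_mono prod_mono conjI)
    fix k assume k: "k \<in> {4..n}"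
    have "- 1 = - (1 - 1 / real n) + - (1 / real n)" by simp
    then have "r k x powr (- 1) = r k x powr (- (1 - 1 / real n)) * r k x powr (- (1 / real n))"
      by (metis powr_add)
    also have "\<dots> \<le> r k x powr (- (1 - 1 / real n)) * r 3 x powr (- (1 / real n))"
      using p3 r_mono[of 3 k x] k by (intro mult_left_mono powr_mono2') auto
    finally show "r k x powr (- 1) \<le> r k x powr (- (1 - 1 / real n)) * r 3 x powr (- (1 / real n))" .
  qed auto
  also have "\<dots> = (r 3 x powr (- 1) * (r 3 x powr (- (1 / real n))) ^ card {4..n}) * (\<Prod>k=4..n. r k x powr (- (1 - 1 / real n)))"
    by (simp add: prod.distrib)
  also have "r 3 x powr (- 1) * (r 3 x powr (- (1 / real n))) ^ card {4..n} = r 3 x powr (- (1 + (real n - 3) / real n))"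
  proof -
    have "(r 3 x powr (- (1 / real n))) ^ card {4..n} = r 3 x powr (- (1 / real n) * real (card {4..n}))"
      using p3 by (simp add: powr_powr flip: powr_realpow)
    also have "real (card {4..n}) = real n - 3" using n3 by (simp add: of_nat_diff)
    finally have "r 3 x powr (- 1) * (r 3 x powr (- (1 / real n))) ^ card {4..n} = r 3 x powr (- 1 + - (1 / real n) * (real n - 3))"
      by (simp only: powr_add)
    then show ?thesis by simp
  qed
  also have "\<dots> * (\<Prod>k=4..n. r k x powr (- (1 - 1 / real n))) \<le> cwt (\<lambda>k. if k \<le> 3 then (1 + (real n - 3) / real n) / 3 else 1 - 1 / real n) x"
    using n3 by (intro powr_r_le_cwt[OF x]) auto
  finally show "\<bar>gs_major (\<lambda>k. 1/2) x\<bar> \<le> 1 * cwt (\<lambda>k. if k \<le> 3 then (1 + (real n - 3) / real n) / 3 else 1 - 1 / real n) x"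
    using gs_major_nonneg[of "\<lambda>k. 1/2" x] by simp
qed measurable

text \<open>On |x| <= 2 each factor differs from the limiting one by |X_k|^(1 - 2 t_k) <= 2,
  whatever t is.\<close>

lemma gs_major_le_half:
  assumes t: "\<And>k. k \<in> {3..n} \<Longrightarrow> 0 \<le> t k \<and> t k < 1/2" and x: "norm x \<le> 2"
  shows "gs_major t x \<le> 2 ^ n * gs_major (\<lambda>k. 1/2) x"
proof -
  have "gs_major t x \<le> (\<Prod>k=3..n. 2 * r k x powr (- (2 * (1/2))))"
    unfolding gs_major_def
  proof (intro prod_mono conjI)
    fix k assume k: "k \<in> {3..n}"
    have r2: "r k x \<le> 2" using r_le_norm[of k x] x k by simp
    have "r k x powr (- (2 * t k)) = r k x powr (1 - 2 * t k) * r k x powr (- 1)"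
    proof -
      have "- (2 * t k) = (1 - 2 * t k) + - 1" by simp
      then show ?thesis by (simp only: powr_add)
    qed
    also have "\<dots> \<le> 2 powr (1 - 2 * t k) * r k x powr (- 1)"
      using t[OF k] r2 by (intro mult_right_mono powr_mono2) auto
    also have "\<dots> \<le> 2 powr 1 * r k x powr (- 1)"
      using t[OF k] by (intro mult_right_mono powr_mono) auto
    finally show "r k x powr (- (2 * t k)) \<le> 2 * r k x powr (- (2 * (1/2)))" by simp
  qed simp
  also have "\<dots> = 2 ^ card {3..n} * gs_major (\<lambda>k. 1/2) x"
    by (simp only: prod.distrib prod_constant gs_major_def)
  also have "\<dots> \<le> 2 ^ n * gs_major (\<lambda>k. 1/2) x"
    by (intro mult_right_mono power_increasing gs_major_nonneg) auto
  finally show ?thesis .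
qed

lemma gs_major_scale:
  assumes "c > 0" shows "gs_major t (c *\<^sub>R x) = c powr (- (2 * (\<Sum>k=3..n. t k))) * gs_major t x"
proof -
  have "gs_major t (c *\<^sub>R x) = (\<Prod>k=3..n. c powr (- (2 * t k)) * r k x powr (- (2 * t k)))"
    unfolding gs_major_def using assms by (intro prod.cong refl) (simp add: trunc_scaleR powr_mult)
  also have "\<dots> = (\<Prod>k=3..n. c powr (- (2 * t k))) * gs_major t x"
    by (simp only: prod.distrib gs_major_def)
  also have "(\<Prod>k=3..n. c powr (- (2 * t k))) = c powr (\<Sum>k=3..n. - (2 * t k))"
    using assms by (simp add: powr_sum)
  also have "(\<Sum>k=3..n. - (2 * t k)) = - (2 * (\<Sum>k=3..n. t k))" by (simp add: sum_negf sum_distrib_left)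
  finally show ?thesis .
qed

lemma CARD_eq: "CARD('n) = n"
  using DIM_eq by simp

lemma lborel_integral_scale:
  fixes f :: "real ^ 'n \<Rightarrow> real"
  assumes "f \<in> borel_measurable borel" "c > 0"
  shows "(LBINT x. f x) = c ^ n * (LBINT x. f (c *\<^sub>R x))"
proof -
  have "(\<Sum>j\<in>Basis. (c * (x \<bullet> j)) *\<^sub>R j) = c *\<^sub>R x" for x :: "real ^ 'n"
    by (simp add: euclidean_representation flip: scaleR_scaleR scaleR_sum_right)
  then show ?thesis using lborel_integral_diagonal[OF assms(1), of "\<lambda>_. c"] assms(2) by (simp add: CARD_eq)
qed

lemma integrable_gs_major_eta:
  assumes t: "\<And>k. k \<in> {3..n} \<Longrightarrow> 0 \<le> t k \<and> t k < 1/2"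
  shows "integrable lborel (\<lambda>x. gs_major t x * (norm (grad eta x))\<^sup>2)"
    and "M \<ge> 0 \<Longrightarrow> (\<And>x. norm (grad eta x) \<le> M) \<Longrightarrow>
      (LBINT x. gs_major t x * (norm (grad eta x))\<^sup>2)
      \<le> M\<^sup>2 * (2 ^ n * (LBINT x. indicator (cball 0 2) x * gs_major (\<lambda>k. 1/2) x))"
proof -
  note [measurable] = C1cD(5)[OF eta_C1c]
  have le: "gs_major t x * (norm (grad eta x))\<^sup>2 \<le> M\<^sup>2 * (2 ^ n * (indicator (cball 0 2) x * gs_major (\<lambda>k. 1/2) x))"
    if M: "M \<ge> 0" "\<And>x. norm (grad eta x) \<le> M" for M x
  proof (cases "norm x \<le> 2")
    case True
    have "gs_major t x * (norm (grad eta x))\<^sup>2 \<le> (2 ^ n * gs_major (\<lambda>k. 1/2) x) * M\<^sup>2"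
      using M True by (intro mult_mono gs_major_le_half t power_mono) (auto simp: gs_major_nonneg)
    then show ?thesis using True by (simp add: mult_ac)
  next
    case False
    have "grad eta x = 0"
    proof (rule ccontr)
      assume "grad eta x \<noteq> 0"
      from grad_eta_support(2)[OF this] have "(norm x)\<^sup>2 \<le> 3" .
      moreover have "(norm x)\<^sup>2 \<ge> 2\<^sup>2" using False by (intro power_mono) auto
      ultimately show False by simp
    qed
    then show ?thesis using M(1) gs_major_nonneg by simp
  qed
  have hi: "integrable lborel (\<lambda>x. M\<^sup>2 * (2 ^ n * (indicator (cball 0 2) x * gs_major (\<lambda>k. 1/2) x)))" for M
    by (intro integrable_mult_right integrable_gs_major_half)
  obtain M0 where M0: "M0 > 0" "\<And>x. norm (grad eta x) \<le> M0" using C1c_bound[OF eta_C1c] by metis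
  show int: "integrable lborel (\<lambda>x. gs_major t x * (norm (grad eta x))\<^sup>2)"
    by (rule Bochner_Integration.integrable_bound[OF hi[of M0]])
       (use le[of M0] M0 gs_major_nonneg in \<open>auto intro!: AE_I2 simp: abs_mult\<close>)
  show "(LBINT x. gs_major t x * (norm (grad eta x))\<^sup>2)
      \<le> M\<^sup>2 * (2 ^ n * (LBINT x. indicator (cball 0 2) x * gs_major (\<lambda>k. 1/2) x))"
    if M: "M \<ge> 0" "\<And>x. norm (grad eta x) \<le> M"
  proof -
    have "(LBINT x. gs_major t x * (norm (grad eta x))\<^sup>2)
      \<le> (LBINT x. M\<^sup>2 * (2 ^ n * (indicator (cball 0 2) x * gs_major (\<lambda>k. 1/2) x)))"
      by (intro integral_mono int hi le M)
    then show ?thesis by simp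
  qed
qed

text \<open>Rescaling the j-th summand by 2^j gives the exponent j n - 2 j - j (n - 2 - 2/L) = 2 j /
  L, from the volume, the squared gradient and the weight. This is at most 2 for j < L, so every
  scale contributes at most 4 times the integral for \<open>eta\<close>; L scales against the factor
  1/L^2 leave 4/L.\<close>

lemma integral_gs_major_grad_cutoff:
  assumes t: "\<And>k. k \<in> {3..n} \<Longrightarrow> 0 \<le> t k \<and> t k < 1/2" and L: "L > 0"
    and sum_t: "(\<Sum>k=3..n. t k) = (real n - 2) / 2 - 1 / real L"
  shows "integrable lborel (\<lambda>x. gs_major t x * (norm (grad_cutoff L x))\<^sup>2)"
    and "(LBINT x. gs_major t x * (norm (grad_cutoff L x))\<^sup>2)
      \<le> 4 / real L * (LBINT x. gs_major t x * (norm (grad eta x))\<^sup>2)"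
proof -
  note [measurable] = C1cD(5)[OF eta_C1c]
  let ?I = "\<integral>x. gs_major t x * (norm (grad eta x))\<^sup>2 \<partial>lborel"
  have I0: "?I \<ge> 0" by (intro integral_nonneg_AE AE_I2 mult_nonneg_nonneg gs_major_nonneg) auto
  define f where "f j x = (1/4) ^ j * (gs_major t x * (norm (grad eta ((1/2) ^ j *\<^sub>R x)))\<^sup>2)" for j and x :: "real ^ 'n"
  have fm[measurable]: "f j \<in> borel_measurable borel" for j unfolding f_def by measurable
  have sc: "f j (2 ^ j *\<^sub>R x) = (1/4) ^ j * 2 powr (- (real j * (real n - 2 - 2 / real L))) * (gs_major t x * (norm (grad eta x))\<^sup>2)" for j x
  proof -
    have "((2::real) ^ j) powr (- (2 * ((real n - 2) / 2 - 1 / real L))) = 2 powr (- (real j * (real n - 2 - 2 / real L)))"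
    proof -
      have "((2::real) ^ j) powr q = 2 powr (real j * q)" for q
        by (simp add: powr_powr flip: powr_realpow)
      then show ?thesis by (simp only:) (rule arg_cong[where f = "\<lambda>q. 2 powr q"], simp add: field_simps)
    qed
    then show ?thesis
      unfolding f_def by (simp add: gs_major_scale sum_t power_divide mult_ac)
  qed
  have fint: "integrable lborel (f j)" for j
  proof -
    have "integrable lborel (\<lambda>x. f j (2 ^ j *\<^sub>R x))"
      unfolding sc by (intro integrable_mult_right integrable_gs_major_eta(1) t)
    then have "integrable lborel (\<lambda>x. (2 ^ j) ^ CARD('n) *\<^sub>R f j (2 ^ j *\<^sub>R x))"
      by (rule integrable_scaleR_right)
    then have "integrable (distr lborel borel (\<lambda>x. 2 ^ j *\<^sub>R x)) (\<lambda>x. (2 ^ j) ^ CARD('n) *\<^sub>R f j x)"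
      by (subst integrable_distr_eq) auto
    then have "integrable (density (distr lborel borel (\<lambda>x. 2 ^ j *\<^sub>R x)) (\<lambda>_. ennreal ((2 ^ j) ^ CARD('n)))) (f j)"
      by (subst integrable_density) auto
    moreover have "(lborel :: (real ^ 'n) measure) = density (distr lborel borel (\<lambda>x. 2 ^ j *\<^sub>R x)) (\<lambda>_. ennreal ((2 ^ j) ^ CARD('n)))"
      using lborel_affine[of "2 ^ j" "0 :: real ^ 'n"] by (simp add: ennreal_power)
    ultimately show ?thesis by simp
  qed
  have fle: "(LBINT x. f j x) \<le> 4 * ?I" if j: "j < L" for j
  proof -
    have "(LBINT x. f j x) = (2 ^ j) ^ n * (LBINT x. f j (2 ^ j *\<^sub>R x))"
      by (rule lborel_integral_scale) auto
    also have "\<dots> = ((2 ^ j) ^ n * ((1/4) ^ j * 2 powr (- (real j * (real n - 2 - 2 / real L))))) * ?I"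
      unfolding sc by simp
    also have "(2 ^ j) ^ n * ((1/4) ^ j * 2 powr (- (real j * (real n - 2 - 2 / real L)))) = 2 powr (2 * (real j / real L))"
    proof -
      have a: "((2::real) ^ j) ^ n = 2 powr (real j * real n)"
        by (simp add: powr_realpow flip: power_mult of_nat_mult)
      have b: "(1/4::real) ^ j = 2 powr (- (2 * real j))"
      proof -
        have "(2::real) powr (2 * real j) = (2 powr 2) powr real j" by (simp only: powr_powr)
        also have "(2::real) powr 2 = 4" by simp
        also have "(4::real) powr real j = 4 ^ j" by (rule powr_realpow) simp
        finally have "(2::real) powr (2 * real j) = 4 ^ j" .
        then have "(2::real) powr (- (2 * real j)) = inverse (4 ^ j)" by (simp only: powr_minus)
        also have "\<dots> = (1/4) ^ j" by (simp only: inverse_eq_divide power_one_over)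
        finally show ?thesis ..
      qed
      show ?thesis unfolding a b powr_add[symmetric] by (rule arg_cong[where f = "\<lambda>t. 2 powr t"]) (simp add: algebra_simps)
    qed
    also have "\<dots> \<le> 2 powr 2"
    proof (intro powr_mono)
      have "real j / real L \<le> 1" using j L by simp
      then show "2 * (real j / real L) \<le> 2" by linarith
    qed simp
    finally show ?thesis using I0 by (simp add: mult_right_mono)
  qed
  have eq: "(\<lambda>x. gs_major t x * (norm (grad_cutoff L x))\<^sup>2) = (\<lambda>x. (1 / (real L)\<^sup>2) * (\<Sum>j<L. f j x))"
    by (simp add: fun_eq_iff norm_grad_cutoff_sq f_def sum_distrib_left mult_ac)
  show "integrable lborel (\<lambda>x. gs_major t x * (norm (grad_cutoff L x))\<^sup>2)"
    unfolding eq by (intro integrable_mult_right Bochner_Integration.integrable_sum fint)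
  have "(LBINT x. gs_major t x * (norm (grad_cutoff L x))\<^sup>2) = (1 / (real L)\<^sup>2) * (\<Sum>j<L. \<integral>x. f j x \<partial>lborel)"
    unfolding eq by (simp add: Bochner_Integration.integral_sum fint)
  also have "\<dots> \<le> (1 / (real L)\<^sup>2) * (\<Sum>j<L. 4 * ?I)"
    by (intro mult_left_mono sum_mono fle) auto
  also have "\<dots> = 4 / real L * ?I" using L by (simp add: power2_eq_square)
  finally show "(LBINT x. gs_major t x * (norm (grad_cutoff L x))\<^sup>2) \<le> 4 / real L * ?I" .
qed

section \<open>Trial functions and their energy\<close>

definition trial :: "(nat \<Rightarrow> real) \<Rightarrow> nat \<Rightarrow> real \<Rightarrow> real ^ 'n \<Rightarrow> real" where
  "trial S L \<epsilon> x = gs_reg (\<lambda>k. S k - S (k - 1)) \<epsilon> x * cutoff L x"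

lemma trial_smooth:
  assumes "\<epsilon> \<noteq> 0" shows "trial S L \<epsilon> \<in> C_infty_compact"
proof -
  obtain R where R: "\<And>x. norm x > R \<Longrightarrow> cutoff L x = 0" using C_infty_compact_bound[OF cutoff_smooth] by metis
  show ?thesis
  proof (rule C_infty_compactI)
    show "C_diff k (trial S L \<epsilon>)" for k
      unfolding trial_def[abs_def] by (intro C_diff_mult C_diff_gs_reg C_diff_cutoff assms)
    show "trial S L \<epsilon> x = 0" if "norm x > R" for x using R[OF that] by (simp add: trial_def)
  qed
qed

text \<open>The logarithmic gradient of the exact \<Phi> would cancel against
  \<open>gs_field\<close>. With the regularization only their difference remains in front of the
  cutoff, and it tends to 0 almost everywhere as \<epsilon> does.\<close>

lemma trial_flux:
  assumes "\<epsilon> \<noteq> 0"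
  shows "gs_grad S (trial S L \<epsilon>) (grad (trial S L \<epsilon>)) x
    = gs_reg (\<lambda>k. S k - S (k - 1)) \<epsilon> x *\<^sub>R (grad_cutoff L x +
        cutoff L x *\<^sub>R (\<Sum>k=3..n. ((S k - S (k - 1)) * (1 / (r k x)\<^sup>2 - 1 / ((r k x)\<^sup>2 + \<epsilon>\<^sup>2))) *\<^sub>R trunc e k x))"
proof -
  define \<gamma> where "\<gamma> k = S k - S (k - 1)" for k
  define A where "A = (\<Sum>k=3..n. (\<gamma> k / ((r k x)\<^sup>2 + \<epsilon>\<^sup>2)) *\<^sub>R trunc e k x)"
  have tr: "trial S L \<epsilon> = (\<lambda>x. gs_reg \<gamma> \<epsilon> x * cutoff L x)" by (simp only: trial_def[abs_def] \<gamma>_def[abs_def])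
  have "(trial S L \<epsilon> has_derivative (\<lambda>v. (gs_reg \<gamma> \<epsilon> x *\<^sub>R grad_cutoff L x - (cutoff L x * gs_reg \<gamma> \<epsilon> x) *\<^sub>R A) \<bullet> v)) (at x)"
    unfolding tr using has_derivative_mult[OF has_derivative_gs_reg[OF assms, of \<gamma> x] has_derivative_cutoff[of L x]]
    by (rule has_derivative_eq_rhs) (simp add: fun_eq_iff A_def inner_diff_left)
  from has_derivative_unique[OF C1cD(1)[OF C_infty_compact_C1c[OF trial_smooth[OF assms, of S L]]] this]
  have "(grad (trial S L \<epsilon>) x - (gs_reg \<gamma> \<epsilon> x *\<^sub>R grad_cutoff L x - (cutoff L x * gs_reg \<gamma> \<epsilon> x) *\<^sub>R A)) \<bullet> v = 0" for v
    by (simp add: fun_eq_iff inner_diff_left)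
  then have g: "grad (trial S L \<epsilon>) x = gs_reg \<gamma> \<epsilon> x *\<^sub>R grad_cutoff L x - (cutoff L x * gs_reg \<gamma> \<epsilon> x) *\<^sub>R A"
    by (metis inner_eq_zero_iff right_minus_eq)
  have "(\<Sum>k=3..n. (\<gamma> k * (1 / (r k x)\<^sup>2 - 1 / ((r k x)\<^sup>2 + \<epsilon>\<^sup>2))) *\<^sub>R trunc e k x) = gs_field S x - A"
    by (simp add: gs_field_def A_def \<gamma>_def right_diff_distrib scaleR_left_diff_distrib sum_subtractf)
  note sum_eq = this
  have "gs_grad S (trial S L \<epsilon>) (grad (trial S L \<epsilon>)) x
    = gs_reg \<gamma> \<epsilon> x *\<^sub>R (grad_cutoff L x + cutoff L x *\<^sub>R (\<Sum>k=3..n. (\<gamma> k * (1 / (r k x)\<^sup>2 - 1 / ((r k x)\<^sup>2 + \<epsilon>\<^sup>2))) *\<^sub>R trunc e k x))"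
    unfolding g sum_eq unfolding tr by (simp add: scaleR_add_right scaleR_diff_right mult.commute)
  then show ?thesis unfolding \<gamma>_def[abs_def] .
qed

text \<open>A lower bound valid for every \<epsilon> survives the limit \<epsilon> to 0, in which
  only \<Phi> times the cutoff gradient is left. The limit is taken by dominated convergence with L
  fixed; the dominating function may depend on L, the constant in the conclusion does so only
  through 4/L and T.\<close>

lemma trial_energy_limit:
  assumes ST: "S 2 = 0" "T 2 = 0" "S n = T n" "\<And>k. k \<in> {3..n} \<Longrightarrow> S k \<le> T k"
    and t: "\<And>k. k \<in> {3..n} \<Longrightarrow> 0 \<le> T k - T (k - 1) \<and> T k - T (k - 1) < 1/2"
    and L: "L > 0" and Tn: "T n = (real n - 2) / 2 - 1 / real L"
    and lb: "\<And>\<epsilon>. 0 < \<epsilon> \<Longrightarrow> \<epsilon> \<le> 1 \<Longrightarrow>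
      c \<le> (LBINT x. (norm (gs_grad S (trial S L \<epsilon>) (grad (trial S L \<epsilon>)) x))\<^sup>2)"
  shows "c \<le> 4 / real L * (LBINT x. gs_major (\<lambda>k. T k - T (k - 1)) x * (norm (grad eta x))\<^sup>2)"
proof -
  define \<gamma> where "\<gamma> k = S k - S (k - 1)" for k
  define t' where "t' k = T k - T (k - 1)" for k
  have t': "0 \<le> t' k \<and> t' k < 1/2" if "k \<in> {3..n}" for k using t[OF that] by (simp add: t'_def)
  have sum_t: "(\<Sum>k=3..n. t' k) = (real n - 2) / 2 - 1 / real L"
  proof -
    have "(\<Sum>k=3..m. t' k) = T m" if "m \<ge> 2" for m
      using that by (induction m rule: dec_induct) (auto simp: ST(2) t'_def)
    then show ?thesis using n3 Tn by simp
  qed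
  note [measurable] = C1cD(4,5)[OF cutoff_C1c[of L]]
  obtain R M where R: "R > 0" "M > 0" "\<And>x. norm x > R \<Longrightarrow> cutoff L x = 0" "\<And>x. norm x > R \<Longrightarrow> grad_cutoff L x = 0"
    "\<And>x. \<bar>cutoff L x\<bar> \<le> M" "\<And>x. norm (grad_cutoff L x) \<le> M" using C1c_bound[OF cutoff_C1c[of L]] by metis
  define \<Gamma> where "\<Gamma> = (\<Sum>k=3..n. \<bar>\<gamma> k\<bar>)"
  have \<Gamma>0: "\<Gamma> \<ge> 0" by (simp add: \<Gamma>_def sum_nonneg)
  define \<epsilon> where "\<epsilon> i = 1 / real (Suc i)" for i
  have \<epsilon>0: "0 < \<epsilon> i" "\<epsilon> i \<le> 1" "\<epsilon> i \<noteq> 0" for i by (auto simp: \<epsilon>_def)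
  have \<epsilon>lim: "\<epsilon> \<longlonglongrightarrow> 0" unfolding \<epsilon>_def using LIMSEQ_inverse_real_of_nat by (simp add: inverse_eq_divide)
  define B where "B i x = (\<Sum>k=3..n. (\<gamma> k * (1 / (r k x)\<^sup>2 - 1 / ((r k x)\<^sup>2 + (\<epsilon> i)\<^sup>2))) *\<^sub>R trunc e k x)" for i x
  define G where "G i x = gs_reg \<gamma> (\<epsilon> i) x *\<^sub>R (grad_cutoff L x + cutoff L x *\<^sub>R B i x)" for i x
  have [measurable]: "B i \<in> borel_measurable borel" for i unfolding B_def by measurable
  have Gm: "(\<lambda>x. (norm (G i x))\<^sup>2) \<in> borel_measurable lborel" for i unfolding G_def by measurable
  have Glb: "c \<le> (LBINT x. (norm (G i x))\<^sup>2)" for i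
    using lb[OF \<epsilon>0(1,2), of i] unfolding trial_flux[OF \<epsilon>0(3)] G_def B_def \<gamma>_def .
  have regle: "(gs_reg \<gamma> \<epsilon>' x)\<^sup>2 \<le> gs_major t' x" if "\<forall>i. x $ i \<noteq> 0" for \<epsilon>' x
    unfolding \<gamma>_def[abs_def] t'_def[abs_def] using ST t by (intro gs_reg_sq_le that) auto
  \<comment> \<open>The error term \<open>B i\<close> is of size 1/|X_3| for every \<epsilon>, and
    the squared regularized ground state is below \<open>gs_major t'\<close>.\<close>
  let ?dom = "\<lambda>x. (M * (R + \<Gamma>))\<^sup>2 * (indicator (cball 0 R) x * (gs_major t' x * r 3 x powr (- 2)))"
  have domint: "integrable lborel ?dom" by (intro integrable_mult_right integrable_gs_major_r3 t')
  have bnd: "AE x in lborel. norm ((norm (G i x))\<^sup>2) \<le> ?dom x" for i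
    using AE_nonzero
  proof eventually_elim
    case (elim x)
    show ?case
    proof (cases "norm x \<le> R")
      case False
      then show ?thesis using R(3,4)[of x] by (simp add: G_def)
    next
      case True
      have p3: "r 3 x > 0" using r_pos[OF elim, of 3] n3 by simp
      have r3R: "r 3 x \<le> R" using r_le_norm[of 3 x] n3 True by simp
      have "norm (B i x) \<le> (\<Sum>k=3..n. norm ((\<gamma> k * (1 / (r k x)\<^sup>2 - 1 / ((r k x)\<^sup>2 + (\<epsilon> i)\<^sup>2))) *\<^sub>R trunc e k x))"
        unfolding B_def by (rule norm_sum)
      also have "\<dots> \<le> (\<Sum>k=3..n. \<bar>\<gamma> k\<bar> / r 3 x)"
      proof (intro sum_mono)
        fix k assume k: "k \<in> {3..n}"
        have p: "r k x > 0" using r_pos[OF elim, of k] k by simp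
        have d0: "0 \<le> 1 / (r k x)\<^sup>2 - 1 / ((r k x)\<^sup>2 + (\<epsilon> i)\<^sup>2)"
          using p by (simp add: frac_le)
        have d1: "1 / (r k x)\<^sup>2 - 1 / ((r k x)\<^sup>2 + (\<epsilon> i)\<^sup>2) \<le> 1 / (r k x)\<^sup>2" by simp
        have "norm ((\<gamma> k * (1 / (r k x)\<^sup>2 - 1 / ((r k x)\<^sup>2 + (\<epsilon> i)\<^sup>2))) *\<^sub>R trunc e k x)
          = \<bar>\<gamma> k\<bar> * (1 / (r k x)\<^sup>2 - 1 / ((r k x)\<^sup>2 + (\<epsilon> i)\<^sup>2)) * r k x"
          using d0 by (simp only: norm_scaleR real_norm_def abs_mult abs_of_nonneg)
        also have "\<dots> \<le> \<bar>\<gamma> k\<bar> * (1 / (r k x)\<^sup>2) * r k x"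
          using d1 p by (intro mult_right_mono mult_left_mono) auto
        also have "\<dots> = \<bar>\<gamma> k\<bar> / r k x" using p by (simp add: power2_eq_square)
        also have "\<dots> \<le> \<bar>\<gamma> k\<bar> / r 3 x"
          using p p3 r_mono[of 3 k x] k by (intro divide_left_mono mult_pos_pos) auto
        finally show "norm ((\<gamma> k * (1 / (r k x)\<^sup>2 - 1 / ((r k x)\<^sup>2 + (\<epsilon> i)\<^sup>2))) *\<^sub>R trunc e k x) \<le> \<bar>\<gamma> k\<bar> / r 3 x" .
      qed
      also have "\<dots> = \<Gamma> / r 3 x" by (simp add: \<Gamma>_def sum_divide_distrib)
      finally have nB: "norm (B i x) \<le> \<Gamma> / r 3 x" .
      have "norm (grad_cutoff L x + cutoff L x *\<^sub>R B i x) \<le> norm (grad_cutoff L x) + \<bar>cutoff L x\<bar> * norm (B i x)"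
        by (rule order_trans[OF norm_triangle_ineq]) simp
      also have "\<dots> \<le> M * (R / r 3 x) + M * (\<Gamma> / r 3 x)"
      proof (intro add_mono mult_mono nB)
        have "norm (grad_cutoff L x) \<le> M * 1" using R(6) by simp
        also have "\<dots> \<le> M * (R / r 3 x)" using R(2) r3R p3 by (intro mult_left_mono) auto
        finally show "norm (grad_cutoff L x) \<le> M * (R / r 3 x)" .
      qed (use R in auto)
      also have "\<dots> = M * (R + \<Gamma>) * (1 / r 3 x)" by (simp add: distrib_left add_divide_distrib)
      finally have "(norm (grad_cutoff L x + cutoff L x *\<^sub>R B i x))\<^sup>2 \<le> (M * (R + \<Gamma>) * (1 / r 3 x))\<^sup>2"
        by (intro power_mono) auto
      also have "\<dots> = (M * (R + \<Gamma>))\<^sup>2 * r 3 x powr (- 2)"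
        using p3 by (simp add: power_mult_distrib power_divide powr_minus_divide)
      finally have f: "(norm (grad_cutoff L x + cutoff L x *\<^sub>R B i x))\<^sup>2 \<le> (M * (R + \<Gamma>))\<^sup>2 * r 3 x powr (- 2)" .
      have "(norm (G i x))\<^sup>2 = (gs_reg \<gamma> (\<epsilon> i) x)\<^sup>2 * (norm (grad_cutoff L x + cutoff L x *\<^sub>R B i x))\<^sup>2"
        by (simp add: G_def power_mult_distrib)
      also have "\<dots> \<le> gs_major t' x * ((M * (R + \<Gamma>))\<^sup>2 * r 3 x powr (- 2))"
        by (intro mult_mono regle[OF elim] f gs_major_nonneg) auto
      finally show ?thesis using True by (simp add: mult_ac)
    qed
  qed
  let ?lim = "\<lambda>x. (norm (gs_reg \<gamma> 0 x *\<^sub>R grad_cutoff L x))\<^sup>2"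
  have limm: "?lim \<in> borel_measurable lborel" by measurable
  have lim: "AE x in lborel. (\<lambda>i. (norm (G i x))\<^sup>2) \<longlonglongrightarrow> ?lim x"
    using AE_nonzero
  proof eventually_elim
    case (elim x)
    have p: "r k x \<noteq> 0" if "k \<in> {3..n}" for k using r_pos[OF elim, of k] that by simp
    have reg: "(\<lambda>i. gs_reg \<gamma> (\<epsilon> i) x) \<longlonglongrightarrow> gs_reg \<gamma> 0 x"
      unfolding gs_reg_def using p by (intro tendsto_prod tendsto_powr tendsto_add tendsto_power \<epsilon>lim tendsto_const) auto
    have "(\<lambda>i. B i x) \<longlonglongrightarrow> (\<Sum>k=3..n. (\<gamma> k * (1 / (r k x)\<^sup>2 - 1 / ((r k x)\<^sup>2 + 0\<^sup>2))) *\<^sub>R trunc e k x)"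
      unfolding B_def using p
      by (intro tendsto_sum tendsto_scaleR tendsto_mult tendsto_diff tendsto_divide tendsto_add tendsto_power \<epsilon>lim tendsto_const) auto
    then have B0: "(\<lambda>i. B i x) \<longlonglongrightarrow> 0" by simp
    have "(\<lambda>i. G i x) \<longlonglongrightarrow> gs_reg \<gamma> 0 x *\<^sub>R (grad_cutoff L x + cutoff L x *\<^sub>R 0)"
      unfolding G_def by (intro tendsto_scaleR reg tendsto_add tendsto_const B0)
    then have "(\<lambda>i. (norm (G i x))\<^sup>2) \<longlonglongrightarrow> (norm (gs_reg \<gamma> 0 x *\<^sub>R (grad_cutoff L x + cutoff L x *\<^sub>R 0)))\<^sup>2"
      by (intro tendsto_power tendsto_norm)
    then show ?case by (simp only: scaleR_zero_right add_0_right)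
  qed
  have conv: "(\<lambda>i. \<integral>x. (norm (G i x))\<^sup>2 \<partial>lborel) \<longlonglongrightarrow> (LBINT x. ?lim x)"
    by (rule integral_dominated_convergence[OF limm Gm domint lim bnd])
  have limint: "integrable lborel ?lim"
    by (rule integrable_dominated_convergence[OF limm Gm domint lim bnd])
  have "c \<le> (LBINT x. ?lim x)"
    by (rule LIMSEQ_le_const[OF conv]) (use Glb in auto)
  also have "\<dots> \<le> (LBINT x. gs_major t' x * (norm (grad_cutoff L x))\<^sup>2)"
  proof (rule integral_mono_AE[OF limint integral_gs_major_grad_cutoff(1)[OF t' L sum_t]])
    show "AE x in lborel. ?lim x \<le> gs_major t' x * (norm (grad_cutoff L x))\<^sup>2"
      using AE_nonzero
    proof eventually_elim
      case (elim x)
      then show ?case using mult_right_mono[OF regle[OF elim, of 0], of "(norm (grad_cutoff L x))\<^sup>2"]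
        by (simp add: power_mult_distrib)
    qed
  qed
  also have "\<dots> \<le> 4 / real L * (LBINT x. gs_major t' x * (norm (grad eta x))\<^sup>2)"
    by (rule integral_gs_major_grad_cutoff(2)[OF t' L sum_t])
  finally show ?thesis unfolding t'_def .
qed

end

text \<open>Going down from \<delta>_n = 1/L, put \<delta>_(k-1) = \<delta>_k^2 / B, where B exceeds
  every factor 1 - 2 \<alpha>_(k-1) + \<delta>_(k-1). Squaring numbers <= 1/4 makes them strictly
  smaller, whence the monotonicity; L >= 4 starts the sequence at or below 1/4.\<close>

lemma ladder_exists:
  fixes \<alpha> :: "nat \<Rightarrow> real"
  assumes \<alpha>: "\<forall>m\<in>{3..n}. \<alpha> m \<le> 0" and L: "L \<ge> (4::nat)"
  shows "\<exists>\<delta> :: nat \<Rightarrow> real. \<delta> n = 1 / real L \<and> (\<forall>k\<le>n. 0 < \<delta> k \<and> \<delta> k \<le> 1/4) \<and>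
    (\<forall>k\<in>{4..n}. \<delta> (k - 1) < \<delta> k \<and> \<delta> (k - 1) * (1 - 2 * \<alpha> (k - 1) + \<delta> (k - 1)) \<le> (\<delta> k)\<^sup>2)"
proof -
  define B where "B = 2 + (\<Sum>k=3..n. 2 * \<bar>\<alpha> k\<bar>)"
  have B2: "B \<ge> 2" by (simp add: B_def sum_nonneg)
  define D where "D = rec_nat (1 / real L) (\<lambda>_ d. d\<^sup>2 / B)"
  have D0: "D 0 = 1 / real L" and DS: "D (Suc j) = (D j)\<^sup>2 / B" for j by (simp_all add: D_def)
  have sq: "d\<^sup>2 / B > 0" "d\<^sup>2 / B < d" if "0 < d" "d \<le> 1/4" for d
  proof -
    show "d\<^sup>2 / B > 0" using that B2 by simp
    have "d\<^sup>2 / B \<le> d\<^sup>2 / 1" using B2 by (intro divide_left_mono) auto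
    also have "\<dots> < d" using that by (simp add: power2_eq_square)
    finally show "d\<^sup>2 / B < d" .
  qed
  have Db: "0 < D j \<and> D j \<le> 1/4" for j
  proof (induction j)
    case 0
    then show ?case using L by (simp add: D0)
  next
    case (Suc j)
    then have "0 < D (Suc j)" "D (Suc j) < D j" unfolding DS using sq[of "D j"] by auto
    then show ?case using Suc by linarith
  qed
  have step: "D (Suc j) < D j" for j using sq(2)[of "D j"] Db[of j] by (simp add: DS)
  show ?thesis
  \<comment> \<open>D counts steps down from the top index, so the recursion step leads from k to k
    - 1.\<close>
  proof (intro exI[of _ "\<lambda>k. D (n - k)"] conjI allI ballI impI)
    fix k assume k: "k \<in> {4..n}"
    then have eq: "n - (k - 1) = Suc (n - k)" by auto
    show "D (n - (k - 1)) < D (n - k)" unfolding eq by (rule step)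
    let ?d = "D (Suc (n - k))"
    have "2 * \<bar>\<alpha> (k - 1)\<bar> \<le> (\<Sum>k=3..n. 2 * \<bar>\<alpha> k\<bar>)"
      using k by (intro member_le_sum) auto
    then have "1 - 2 * \<alpha> (k - 1) + ?d \<le> B" using Db[of "Suc (n - k)"] unfolding B_def by linarith
    then have "?d * (1 - 2 * \<alpha> (k - 1) + ?d) \<le> ?d * B" using Db[of "Suc (n - k)"] by (intro mult_left_mono) auto
    also have "\<dots> = (D (n - k))\<^sup>2" using B2 by (simp add: DS)
    finally show "D (n - (k - 1)) * (1 - 2 * \<alpha> (k - 1) + D (n - (k - 1))) \<le> (D (n - k))\<^sup>2" unfolding eq .
  qed (use Db D0 in auto)
qed

context enumerated_coordinates
begin

text \<open>As \<alpha>_k <= 0, replacing \<alpha>_k by \<alpha>_k - \<delta>_k increases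
  \<alpha>_k^2 by at least \<delta>_k^2. This gain covers the growth of (\<alpha>_(k-1) - 1/2)^2,
  which is exactly \<delta>_(k-1) (1 - 2 \<alpha>_(k-1) + \<delta>_(k-1)).\<close>

lemma beta_ladder_le:
  assumes \<alpha>: "\<forall>m\<in>{3..n}. \<alpha> m \<le> 0" and \<delta>: "\<And>k. k \<le> n \<Longrightarrow> 0 < \<delta> k"
    and ladder: "\<And>k. k \<in> {4..n} \<Longrightarrow> \<delta> (k - 1) * (1 - 2 * \<alpha> (k - 1) + \<delta> (k - 1)) \<le> (\<delta> k)\<^sup>2"
    and k: "k \<in> {3..n}"
  shows "beta (\<lambda>k. \<alpha> k - \<delta> k) k \<le> beta \<alpha> k"
proof -
  have "\<alpha> k * \<delta> k \<le> 0" using \<alpha> k \<delta>[of k] by (intro mult_nonpos_nonneg) auto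
  moreover have "(\<alpha> k - \<delta> k)\<^sup>2 = (\<alpha> k)\<^sup>2 - 2 * (\<alpha> k * \<delta> k) + (\<delta> k)\<^sup>2" by (simp add: power2_diff)
  ultimately have a: "(\<alpha> k)\<^sup>2 + (\<delta> k)\<^sup>2 \<le> (\<alpha> k - \<delta> k)\<^sup>2" by simp
  show ?thesis
  proof (cases "k = 3")
    case True
    have "(\<alpha> k)\<^sup>2 \<le> (\<alpha> k - \<delta> k)\<^sup>2" using a zero_le_power2[of "\<delta> k"] by linarith
    then show ?thesis using True by (simp add: beta_def)
  next
    case False
    then have k4: "k \<in> {4..n}" using k by auto
    have "(\<alpha> (k - 1) - \<delta> (k - 1) - 1/2)\<^sup>2 = (\<alpha> (k - 1) - 1/2)\<^sup>2 + \<delta> (k - 1) * (1 - 2 * \<alpha> (k - 1) + \<delta> (k - 1))"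
      by (simp add: power2_eq_square algebra_simps)
    then have "(\<alpha> (k - 1) - \<delta> (k - 1) - 1/2)\<^sup>2 \<le> (\<alpha> (k - 1) - 1/2)\<^sup>2 + (\<delta> k)\<^sup>2"
      using ladder[OF k4] by simp
    then show ?thesis using a False by (simp add: beta_def)
  qed
qed

text \<open>Here every |X_k|^2 + \<epsilon>^2 lies between 1/(4 n^2) and 4 n^2, so a power with
  exponent at most \<Gamma>/2 in modulus stays above a constant free of L, \<epsilon> and S; the
  cutoff equals 1.\<close>

lemma trial_lower_bound:
  assumes \<epsilon>: "0 < \<epsilon>" "\<epsilon> \<le> 1" and L: "L > 0" and \<Gamma>: "\<And>k. k \<in> {3..n} \<Longrightarrow> \<bar>S k - S (k - 1)\<bar> \<le> \<Gamma>"
    and x: "norm x \<le> 1" "r 1 x \<ge> 1 / (2 * real n)"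
  shows "trial S L \<epsilon> x \<ge> (exp (- (\<Gamma> / 2 * ln (4 * (real n)\<^sup>2)))) ^ card {3..n}"
proof -
  let ?c = "exp (- (\<Gamma> / 2 * ln (4 * (real n)\<^sup>2)))"
  have n0: "real n \<ge> 3" using n3 by simp
  then have n1: "(real n)\<^sup>2 \<ge> 1" by (simp add: one_le_power)
  have fac: "?c \<le> ((r k x)\<^sup>2 + \<epsilon>\<^sup>2) powr (- (S k - S (k - 1)) / 2)" if k: "k \<in> {3..n}" for k
  proof -
    let ?R = "(r k x)\<^sup>2 + \<epsilon>\<^sup>2"
    have "1 / (2 * real n) \<le> r k x" using x(2) r_mono[of 1 k x] k by simp
    then have "(1 / (2 * real n))\<^sup>2 \<le> (r k x)\<^sup>2" by (intro power_mono) auto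
    then have lo: "1 / (4 * (real n)\<^sup>2) \<le> ?R" by (simp add: power_divide power_mult_distrib add_increasing2)
    have "(r k x)\<^sup>2 \<le> 1\<^sup>2" using x(1) r_le_norm[of k x] k by (intro power_mono) auto
    moreover have "\<epsilon>\<^sup>2 \<le> 1\<^sup>2" using \<epsilon> by (intro power_mono) auto
    ultimately have hi: "?R \<le> 4 * (real n)\<^sup>2" using n1 by simp
    have pos: "?R > 0" using \<epsilon> by (simp add: add_nonneg_pos)
    then have ne: "?R \<noteq> 0" by linarith
    have "ln ?R \<le> ln (4 * (real n)\<^sup>2)" using hi pos n0 by (subst ln_le_cancel_iff) auto
    moreover have "- ln (4 * (real n)\<^sup>2) \<le> ln ?R"
    proof -
      have "- ln (4 * (real n)\<^sup>2) = ln (1 / (4 * (real n)\<^sup>2))" using n0 by (simp add: ln_div)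
      also have "\<dots> \<le> ln ?R" using lo pos n0 by (subst ln_le_cancel_iff) auto
      finally show ?thesis .
    qed
    ultimately have al: "\<bar>ln ?R\<bar> \<le> ln (4 * (real n)\<^sup>2)" by simp
    have "(S k - S (k - 1)) * ln ?R \<le> \<bar>S k - S (k - 1)\<bar> * \<bar>ln ?R\<bar>" by (metis abs_ge_self abs_mult)
    also have "\<dots> \<le> \<Gamma> * ln (4 * (real n)\<^sup>2)" using \<Gamma>[OF k] al by (intro mult_mono) auto
    finally have "(S k - S (k - 1)) * ln ?R \<le> \<Gamma> * ln (4 * (real n)\<^sup>2)" .
    moreover have "- (S k - S (k - 1)) / 2 * ln ?R = - ((S k - S (k - 1)) * ln ?R) / 2"
      and "\<Gamma> / 2 * ln (4 * (real n)\<^sup>2) = \<Gamma> * ln (4 * (real n)\<^sup>2) / 2"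
      by (simp_all only: minus_mult_left times_divide_eq_left)
    ultimately have "- (\<Gamma> / 2 * ln (4 * (real n)\<^sup>2)) \<le> - (S k - S (k - 1)) / 2 * ln ?R" by linarith
    then have "?c \<le> exp (- (S k - S (k - 1)) / 2 * ln ?R)" by (simp only: exp_le_cancel_iff)
    also have "\<dots> = ?R powr (- (S k - S (k - 1)) / 2)" unfolding powr_def if_not_P[OF ne] ..
    finally show ?thesis .
  qed
  have "?c ^ card {3..n} = (\<Prod>k=3..n. ?c)" by simp
  also have "\<dots> \<le> gs_reg (\<lambda>k. S k - S (k - 1)) \<epsilon> x"
    unfolding gs_reg_def by (intro prod_mono conjI fac) auto
  finally show ?thesis using cutoff_1[OF x(1) L] by (simp add: trial_def)
qed

text \<open>Integrate over the cube with all coordinates in [1/(2n), 1/n], which lies in the unit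
  ball and away from the singular sets. Only \<Gamma> is fixed before N0, so N0 serves all L,
  \<epsilon> and all the perturbed S.\<close>

lemma trial_norm_lower_bound:
  assumes Q: "Q > 0" and a: "0 \<le> a" "a < 2"
  shows "\<exists>N0>0. \<forall>S L \<epsilon>. 0 < \<epsilon> \<longrightarrow> \<epsilon> \<le> 1 \<longrightarrow> L > 0 \<longrightarrow> (\<forall>k\<in>{3..n}. \<bar>S k - S (k - 1)\<bar> \<le> \<Gamma>) \<longrightarrow>
    N0 \<le> (LBINT x. r 2 x powr (- a) * \<bar>trial S L \<epsilon> x\<bar> powr Q)"
proof -
  define l where "l = (\<chi> i. 1 / (2 * real n) :: real ^ 'n)"
  define h where "h = (\<chi> i. 1 / real n :: real ^ 'n)"
  define c where "c = (exp (- (\<Gamma> / 2 * ln (4 * (real n)\<^sup>2)))) ^ card {3..n}"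
  have c0: "c > 0" by (simp add: c_def)
  have n0: "real n \<ge> 3" using n3 by simp
  have lh: "l \<bullet> i < h \<bullet> i" if "i \<in> Basis" for i
    using that n0 by (auto simp: Basis_vec_def l_def h_def inner_axis frac_less2)
  have m0: "measure lborel (cbox l h) > 0"
    using content_pos_lt[of l h] lh by simp
  have box: "norm x \<le> 1" "r 1 x \<ge> 1 / (2 * real n)" "r 2 x > 0" if x: "x \<in> cbox l h" for x
  proof -
    have xi: "1 / (2 * real n) \<le> x $ i" "x $ i \<le> 1 / real n" for i
      using x by (auto simp: mem_box_cart l_def h_def)
    have pos: "x $ i \<ge> 0" for i
      using xi(1)[of i] by (rule order_trans[rotated]) simp
    have "(norm x)\<^sup>2 = (\<Sum>j=1..n. (x $ e j)\<^sup>2)" using r_sq[of n x] by (simp add: r_n)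
    also have "\<dots> \<le> (\<Sum>j=1..n. (1 / real n)\<^sup>2)" using xi pos by (intro sum_mono power_mono) auto
    also have "\<dots> = 1 / real n" using n0 by (simp add: power2_eq_square)
    also have "\<dots> \<le> 1\<^sup>2" using n0 by simp
    finally show "norm x \<le> 1" by (rule power2_le_imp_le) simp
    have "1 / (2 * real n) \<le> \<bar>x $ e 1\<bar>" using xi(1)[of "e 1"] by simp
    also have "\<dots> \<le> r 1 x" using n3 by (intro abs_nth_le_r) auto
    finally show r1: "r 1 x \<ge> 1 / (2 * real n)" .
    have "0 < 1 / (2 * real n)" using n0 by simp
    then show "r 2 x > 0" using r1 r_mono[of 1 2 x] n3 by linarith
  qed
  show ?thesis
  proof (intro exI[of _ "c powr Q * measure lborel (cbox l h)"] conjI allI impI)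
    show "c powr Q * measure lborel (cbox l h) > 0" using c0 m0 by simp
    fix S :: "nat \<Rightarrow> real" and L :: nat and \<epsilon> :: real
    assume A: "0 < \<epsilon>" "\<epsilon> \<le> 1" "L > 0" "\<forall>k\<in>{3..n}. \<bar>S k - S (k - 1)\<bar> \<le> \<Gamma>"
    have u: "C1c (trial S L \<epsilon>) (grad (trial S L \<epsilon>))"
      using A by (intro C_infty_compact_C1c trial_smooth) auto
    have "c powr Q * measure lborel (cbox l h) = (LBINT x. c powr Q * indicator (cbox l h) x)"
      by simp
    also have "\<dots> \<le> (LBINT x. r 2 x powr (- a) * \<bar>trial S L \<epsilon> x\<bar> powr Q)"
    proof (rule integral_mono)
      show "integrable lborel (\<lambda>x. c powr Q * indicat_real (cbox l h) x)"
        using emeasure_bounded_finite[OF bounded_cbox, of l h] by (intro integrable_mult_right integrable_real_indicator) auto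
      show "integrable lborel (\<lambda>x. r 2 x powr (- a) * \<bar>trial S L \<epsilon> x\<bar> powr Q)"
        using Q by (intro integrable_r2_powr_u[OF u] a) auto
      fix x
      show "c powr Q * indicat_real (cbox l h) x \<le> r 2 x powr (- a) * \<bar>trial S L \<epsilon> x\<bar> powr Q"
      proof (cases "x \<in> cbox l h")
        case True
        have "c \<le> trial S L \<epsilon> x" unfolding c_def
          using A box[OF True] by (intro trial_lower_bound) auto
        then have "c powr Q \<le> \<bar>trial S L \<epsilon> x\<bar> powr Q" using c0 Q by (intro powr_mono2) auto
        moreover have "1 \<le> r 2 x powr (- a)"
        proof -
          have "r 2 x \<le> 1" using r_le_norm[of 2 x] box(1)[OF True] n3 by simp
          then have "1 powr (- a) \<le> r 2 x powr (- a)" using box(3)[OF True] a by (intro powr_mono2') auto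
          then show ?thesis by simp
        qed
        ultimately have "1 * c powr Q \<le> r 2 x powr (- a) * \<bar>trial S L \<epsilon> x\<bar> powr Q" by (intro mult_mono) auto
        then show ?thesis using True by simp
      qed simp
    qed
    finally show "c powr Q * measure lborel (cbox l h) \<le> (LBINT x. r 2 x powr (- a) * \<bar>trial S L \<epsilon> x\<bar> powr Q)" .
  qed
qed

text \<open>Since the perturbed potential is smaller, the perturbed form dominates the original one,
  so the assumed inequality bounds it from below by a fixed c > 0 on every trial function. Its limit
  as \<epsilon> tends to 0 is at most 4 K / L, a contradiction for large L.\<close>

theorem Hardy_Sobolev_Mazya_fails:
  assumes \<alpha>: "\<forall>m\<in>{3..n}. \<alpha> m \<le> 0" and \<alpha>n: "\<alpha> n = 0" and Q: "2 < Q" "Q \<le> 2 * real n / (real n - 2)"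
  shows "\<not> (\<exists>C>0. \<forall>u \<in> (C_infty_compact :: (real ^ 'n \<Rightarrow> real) set). hardy_sobolev_mazya n e \<alpha> Q C u)"
proof
  assume "\<exists>C>0. \<forall>u \<in> (C_infty_compact :: (real ^ 'n \<Rightarrow> real) set). hardy_sobolev_mazya n e \<alpha> Q C u"
  then obtain C where C: "C > 0" and ineq: "\<And>u :: real ^ 'n \<Rightarrow> real. u \<in> C_infty_compact \<Longrightarrow> hardy_sobolev_mazya n e \<alpha> Q C u"
    by blast
  define a where "a = Q - (Q - 2) / 2 * real n"
  have n0: "real n \<ge> 3" using n3 by simp
  have "Q * (real n - 2) \<le> 2 * real n" using Q n0 by (simp add: field_simps)
  then have a0: "0 \<le> a" by (simp add: a_def algebra_simps)
  have "(Q - 2) * (real n - 2) > 0" using Q n0 by (intro mult_pos_pos) auto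
  then have a2: "a < 2" by (simp add: a_def field_simps)
  have a_eq: "(Q - 2) / 2 * real n - Q = - a" by (simp add: a_def)
  define A where "A = (\<Sum>k=3..n. \<bar>\<alpha> k\<bar>)"
  \<comment> \<open>Twice a bound for all |S_k|; it is independent of L because every \<delta>_k is
    at most 1/4.\<close>
  define \<Gamma> where "\<Gamma> = 2 * (real n + A + 1)"
  obtain N0 where N0: "N0 > 0" and Nlow: "\<And>S L \<epsilon>. 0 < \<epsilon> \<Longrightarrow> \<epsilon> \<le> 1 \<Longrightarrow> L > 0 \<Longrightarrow> (\<And>k. k \<in> {3..n} \<Longrightarrow> \<bar>S k - S (k - 1)\<bar> \<le> \<Gamma>) \<Longrightarrow>
    N0 \<le> (LBINT x. r 2 x powr (- a) * \<bar>trial S L \<epsilon> x\<bar> powr Q)"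
    using trial_norm_lower_bound[of Q a \<Gamma>] a0 a2 Q by force
  obtain M where M: "M > 0" "\<And>x. norm (grad eta x) \<le> M" using C1c_bound[OF eta_C1c] by metis
  define K where "K = M\<^sup>2 * (2 ^ n * (LBINT x. indicator (cball 0 2) x * gs_major (\<lambda>k. 1/2) x))"
  define c where "c = C * N0 powr (2 / Q)"
  have c0: "c > 0" using C N0 by (simp add: c_def)
  have main: "c \<le> 4 / real L * K" if L: "L \<ge> 4" for L
  proof -
    obtain \<delta> :: "nat \<Rightarrow> real" where \<delta>n: "\<delta> n = 1 / real L" and \<delta>: "\<And>k. k \<le> n \<Longrightarrow> 0 < \<delta> k" "\<And>k. k \<le> n \<Longrightarrow> \<delta> k \<le> 1/4"
      and \<delta>mono: "\<And>k. k \<in> {4..n} \<Longrightarrow> \<delta> (k - 1) < \<delta> k"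
      and ladder: "\<And>k. k \<in> {4..n} \<Longrightarrow> \<delta> (k - 1) * (1 - 2 * \<alpha> (k - 1) + \<delta> (k - 1)) \<le> (\<delta> k)\<^sup>2"
      using ladder_exists[OF \<alpha> L] by blast
    let ?\<alpha>' = "\<lambda>k. \<alpha> k - \<delta> k"
    define S where "S = gs_exponent ?\<alpha>'"
    \<comment> \<open>The same perturbation with \<alpha> dropped. It dominates S because \<alpha>
      <= 0 and meets S at n because \<alpha>_n = 0, as the Abel summation requires.\<close>
    define T where "T = gs_exponent (\<lambda>k. - \<delta> k)"
    have ST2: "S 2 = 0" "T 2 = 0" by (simp_all add: S_def T_def gs_exponent_def)
    have STn: "S n = T n" using \<alpha>n by (simp add: S_def T_def gs_exponent_def)
    have STle: "S k \<le> T k" if "k \<in> {3..n}" for k using \<alpha> that by (simp add: S_def T_def gs_exponent_def)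
    have t: "0 \<le> T k - T (k - 1) \<and> T k - T (k - 1) < 1/2" if k: "k \<in> {3..n}" for k
    proof (cases "k = 3")
      case True
      then show ?thesis using \<delta>[of 3] n3 by (simp add: T_def gs_exponent_def)
    next
      case False
      then have k4: "k \<in> {4..n}" using k by auto
      then obtain j where "k = Suc j" "j \<ge> 3" by (cases k) auto
      \<comment> \<open>Strict growth of \<delta> puts this below 1/2, and \<delta>_k <= 1/4 keeps
        it nonnegative.\<close>
      then have "T k - T (k - 1) = 1/2 - \<delta> k + \<delta> (k - 1)"
        by (simp add: T_def gs_exponent_def field_simps)
      moreover have "\<delta> (k - 1) > 0" "\<delta> k \<le> 1/4" using \<delta>(1)[of "k - 1"] \<delta>(2)[of k] k by auto
      ultimately show ?thesis using \<delta>mono[OF k4] by linarith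
    qed
    have Tn: "T n = (real n - 2) / 2 - 1 / real L" using n3 by (simp add: T_def gs_exponent_def \<delta>n)
    have Sb: "\<bar>S k\<bar> \<le> real n + A + 1" if "k \<le> n" for k
    proof (cases "k \<le> 2")
      case True
      then show ?thesis by (simp add: S_def gs_exponent_def A_def sum_nonneg add_nonneg_nonneg)
    next
      case False
      have "\<bar>\<alpha> k\<bar> \<le> A" unfolding A_def using False that by (intro member_le_sum) auto
      then have "\<alpha> k \<le> A" "- \<alpha> k \<le> A" by (auto dest: abs_le_D1 abs_le_D2)
      moreover have "S k = (real k - 2) / 2 + \<alpha> k - \<delta> k" using False by (simp add: S_def gs_exponent_def)
      moreover have "real k \<ge> 2" "real k \<le> real n" using False that by auto
      ultimately show ?thesis using \<delta>[OF that] by (intro abs_leI) argo+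
    qed
    have Sd: "\<bar>S k - S (k - 1)\<bar> \<le> \<Gamma>" if "k \<in> {3..n}" for k
    proof -
      have "\<bar>S k\<bar> \<le> real n + A + 1" "\<bar>S (k - 1)\<bar> \<le> real n + A + 1" using that by (auto intro!: Sb)
      then show ?thesis unfolding \<Gamma>_def by (smt (verit))
    qed
    have "c \<le> 4 / real L * (LBINT x. gs_major (\<lambda>k. T k - T (k - 1)) x * (norm (grad eta x))\<^sup>2)"
    proof (rule trial_energy_limit[OF ST2 STn STle t _ Tn])
      show "L > 0" using L by simp
      fix \<epsilon> :: real assume \<epsilon>: "0 < \<epsilon>" "\<epsilon> \<le> 1"
      define u where "u = trial S L \<epsilon>"
      have us: "u \<in> C_infty_compact" unfolding u_def using \<epsilon> by (intro trial_smooth) auto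
      note u = C_infty_compact_C1c[OF us]
      have G: "integrable lborel (\<lambda>x. (\<Sum>k=3..n. beta ?\<alpha>' k / (r k x)\<^sup>2) * (u x)\<^sup>2)"
        "(LBINT x. (norm (gs_grad S u (grad u) x))\<^sup>2)
          = (LBINT x. (norm (grad u x))\<^sup>2) - (LBINT x. (\<Sum>k=3..n. beta ?\<alpha>' k / (r k x)\<^sup>2) * (u x)\<^sup>2)"
        using ground_state_representation(2,3)[of u "grad u" S "beta ?\<alpha>'", OF u ST2(1)] beta_gs_exponent[of _ ?\<alpha>']
        by (auto simp: S_def)
      have G2: "integrable lborel (\<lambda>x. (\<Sum>k=3..n. beta \<alpha> k / (r k x)\<^sup>2) * (u x)\<^sup>2)"
        by (rule ground_state_representation(2)[of u "grad u" "gs_exponent \<alpha>" "beta \<alpha>", OF u gs_exponent_2 beta_gs_exponent])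
      have "(LBINT x. (\<Sum>k=3..n. beta ?\<alpha>' k / (r k x)\<^sup>2) * (u x)\<^sup>2) \<le> (LBINT x. (\<Sum>k=3..n. beta \<alpha> k / (r k x)\<^sup>2) * (u x)\<^sup>2)"
        by (intro integral_mono G(1) G2 mult_right_mono sum_mono divide_right_mono beta_ladder_le \<alpha> \<delta>(1) ladder) auto
      moreover have "(LBINT x. (norm (grad u x))\<^sup>2) \<ge>
       (LBINT x. (\<Sum>k=3..n. beta \<alpha> k / (r k x)\<^sup>2) * (u x)\<^sup>2) +
       C * (LBINT x. r 2 x powr (- a) * \<bar>u x\<bar> powr Q) powr (2 / Q)"
        using ineq[OF us] unfolding hardy_sobolev_mazya_def a_eq .
      moreover have "c \<le> C * (LBINT x. r 2 x powr (- a) * \<bar>u x\<bar> powr Q) powr (2 / Q)"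
        unfolding c_def u_def using C N0 Q L \<epsilon> Sd by (intro mult_left_mono powr_mono2 Nlow) auto
      ultimately have "c \<le> (LBINT x. (norm (gs_grad S u (grad u) x))\<^sup>2)"
        unfolding G(2) by linarith
      then show "c \<le> (LBINT x. (norm (gs_grad S (trial S L \<epsilon>) (grad (trial S L \<epsilon>)) x))\<^sup>2)"
        unfolding u_def .
    qed
    also have "\<dots> \<le> 4 / real L * K"
      unfolding K_def using t M by (intro mult_left_mono integrable_gs_major_eta(2)) auto
    finally show ?thesis .
  qed
  have "K \<ge> 0" unfolding K_def
    by (intro mult_nonneg_nonneg integral_nonneg_AE AE_I2 gs_major_nonneg) auto
  obtain L where L: "real L > max 4 (4 * K / c)" using reals_Archimedean2 by blast
  then have L4: "L \<ge> 4" by simp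
  have "4 * K / c < real L" using L by simp
  then have "4 * K < real L * c" using c0 by (simp add: divide_less_eq)
  then have "4 / real L * K < c" using L4 by (simp add: field_simps)
  then show False using main[OF L4] by simp
qed

end

theorem theoremB:
  fixes n :: nat and e :: "nat \<Rightarrow> 'n::finite" and \<alpha> :: "nat \<Rightarrow> real" and Q :: real
  assumes "n \<ge> 3"
    and "bij_betw e {1..n} (UNIV :: 'n set)"
    and "\<forall>m\<in>{3..n}. \<alpha> m \<le> 0"
    and "2 < Q" and "Q \<le> 2 * real n / (real n - 2)"
  shows "(\<alpha> n < 0 \<longrightarrow>
            (\<exists>C>0. \<forall>u \<in> (C_infty_compact :: (real ^ 'n \<Rightarrow> real) set). hardy_sobolev_mazya n e \<alpha> Q C u))
       \<and> (\<alpha> n = 0 \<longrightarrow>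
            \<not> (\<exists>C>0. \<forall>u \<in> (C_infty_compact :: (real ^ 'n \<Rightarrow> real) set). hardy_sobolev_mazya n e \<alpha> Q C u))"
proof -
  interpret enumerated_coordinates n e
    by standard fact+
  show ?thesis
    using Hardy_Sobolev_Mazya_holds[of \<alpha> Q] Hardy_Sobolev_Mazya_fails[of \<alpha> Q] assms(3-5) by blast
qed

end
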